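(* Suppose that $f:\Sigma\to\mathcal{Z}$ is an umbilic-free $\Omega$-surface whose middle pencil admits a $2$-dimensional space of linear conserved quantities $P$, such that $g_0\neq0$ and $g_\infty$ is non-degenerate. Then, in any space form determined by a space form vector $\mathfrak{q}$ and point sphere complex $\mathfrak{p}$ with $\mathfrak{q},\mathfrak{p}\in P(0)$, $f$ projects to a surface which, where it immerses, is a non-tubular linear Weingarten surface with linear Weingarten condition $[W]=[\phi_0\circ\phi_\infty^{-1}(g_\infty)]$.
   Context: $\mathbb{R}^{4,2}$ is a 6-dimensional real vector space with a non-degenerate symmetric bilinear form $(\,,\,)$ of signature $(4,2)$, $\mathcal{L}$ its lightcone; $\wedge^2\mathbb{R}^{4,2}\cong\mathfrak{o}(4,2)$ via $a\wedge b\,(c)=(a,c)b-(b,c)a$; $a\odot b=\frac12(a\otimes b+b\otimes a)$. $\Sigma$ is a smooth 2-manifold, $\underline{\mathbb{R}}^{4,2}=\Sigma\times\mathbb{R}^{4,2}$, $d$ its trivial connection; $W^{(1)}$ is spanned by sections of a subbundle $W$ and their derivatives. $\mathcal{Z}$ is the Grassmannian of isotropic 2-dimensional subspaces; a smooth $f:\Sigma\to\mathcal{Z}$ (a rank 2 subbundle) is a Legendre map if $f^{(1)}\le f^\perp$ and no non-zero $X\in T\Sigma$ satisfies $d_X\sigma\in f$ for all $\sigma\in\Gamma f$. A curvature sphere at $p$ is a line $s(p)\le f(p)$ killed by $\sigma\mapsto d_X\sigma\bmod f$ for all $X$ in some non-zero (maximal) subspace $T_{s(p)}\le T_p\Sigma$.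 $f$ is umbilic-free if there are exactly two curvature spheres at each point, forming rank 1 bundles $s_1,s_2$ with curvature subbundles $T_1,T_2$. A gauge potential is a closed $\eta\in\Omega^1(f\wedge f^\perp)$ with $[\eta\wedge\eta]=0$ such that $q(X,Y)=\mathrm{tr}(\sigma\mapsto\eta(X)d_Y\sigma:f\to f)$ is non-zero; a Legendre map $f$ is an $\Omega$-surface if $q$ is non-degenerate on a dense open set. Standing assumption: $q$ has constant signature. The gauge orbit is $\{\eta-d\tau:\tau\in\Gamma(\wedge^2f)\}$. With $S_1=\langle\sigma_1,d_Y\sigma_1,d_Yd_Y\sigma_1\rangle$, $S_2=\langle\sigma_2,d_X\sigma_2,d_Xd_X\sigma_2\rangle$ ($\sigma_i\in\Gamma s_i$, $X\in\Gamma T_1$, $Y\in\Gamma T_2$), the middle potential $\eta^{mid}$ is the unique member of the gauge orbit whose $S_1\wedge S_2$-component takes values in $\wedge^2f$; the middle pencil is $\{d+t\eta^{mid}\}_{t\in\mathbb{R}}$. A linear conserved quantity is a degree 1 polynomial $p(t)=p_0+tp_1$, $p_0,p_1\in\Gamma\underline{\mathbb{R}}^{4,2}$, with $(d+t\eta^{mid})p(t)=0$ for all $t$. ($p_0$ is then constant.) A 2-dimensional space of linear conserved quantities is a 2-dimensional real vector space $P$ whose non-zero elements are linear conserved quantities; $P(t)=\{p(t):p\in P\}$. On $P$ define $g_t(\alpha,\beta)=(\alpha(t),\beta(t))$ for $t\in\mathbb{R}$ and $g_\infty(\alpha,\beta)=(\alpha_0,\beta_1)+(\beta_0,\alpha_1)$;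 then $g_t=g_0+tg_\infty$, and $g_t,g_\infty$ are constant over $\Sigma$. Let $S^2P$ be the symmetric square. Define $\phi_t:S^2P\to S^2P(t)$, $\alpha\odot\beta\mapsto\alpha(t)\odot\beta(t)$, and $\phi_\infty:\alpha\odot\beta\mapsto(\alpha\odot\beta)_\infty$ from $S^2P$ to symmetric bilinear forms on $P$, $(\alpha\odot\beta)_\infty(\gamma,\delta)=\frac12(g_\infty(\alpha,\gamma)g_\infty(\beta,\delta)+g_\infty(\alpha,\delta)g_\infty(\beta,\gamma))$, an isomorphism when $g_\infty$ is non-degenerate. Space forms: a point sphere complex $\mathfrak{p}$ with $(\mathfrak{p},\mathfrak{p})=\pm1$ and a non-zero space form vector $\mathfrak{q}\in\langle\mathfrak{p}\rangle^\perp$ give $\mathfrak{Q}^3=\{y\in\mathcal{L}:(y,\mathfrak{q})=-1,(y,\mathfrak{p})=0\}$, a (Riemannian or Lorentzian) space form of curvature $\kappa=-(\mathfrak{q},\mathfrak{q})$. The projection $\mathfrak{f}:\Sigma\to\mathfrak{Q}^3$ and tangent plane congruence $\mathfrak{t}$ of $f$ are the sections of $f$ with $(\mathfrak{f},\mathfrak{q})=-1,(\mathfrak{f},\mathfrak{p})=0$ and $(\mathfrak{t},\mathfrak{q})=0,(\mathfrak{t},\mathfrak{p})=-1$ (part of the assertion is that these exist on all of $\Sigma$). Principal curvatures $\kappa_i$: $d_X\mathfrak{t}+\kappa_id_X\mathfrak{f}=0$ for $X\in T_i$; $K=\kappa_1\kappa_2$, $H=\frac12(\kappa_1+\kappa_2)$.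 Where it immerses, $\mathfrak{f}$ is linear Weingarten if $aK+2bH+c=0$ for constants $a,b,c\in\mathbb{R}$, not all zero; its linear Weingarten condition is $[W]\in\mathbb{P}(S^2\mathbb{R}^{4,2})$, $W=a\,\mathfrak{q}\odot\mathfrak{q}+2b\,\mathfrak{q}\odot\mathfrak{p}+c\,\mathfrak{p}\odot\mathfrak{p}$. It is tubular if $b^2-ac=0$, non-tubular otherwise. *)

theory Defs
  imports "HOL-Analysis.Analysis" "HOL-Library.Function_Algebras"
begin

section \<open>Functions into a real vector space\<close>

text \<open>
  Pointwise scalar multiplication turns function types into real vector spaces, so that
  \<^const>\<open>subspace\<close>, \<^const>\<open>span\<close> and \<^const>\<open>dim\<close> apply to spaces of sections, to tangent spaces
  and to spaces of bilinear forms. (\<^const>\<open>dim\<close> is 0 for infinite-dimensional spaces.)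
\<close>

instantiation "fun" :: (type, real_vector) real_vector
begin

definition scaleR_fun :: "real \<Rightarrow> ('a \<Rightarrow> 'b) \<Rightarrow> 'a \<Rightarrow> 'b"
  where "scaleR_fun r h = (\<lambda>x. r *\<^sub>R h x)"

instance
  by standard (simp_all add: scaleR_fun_def plus_fun_def fun_eq_iff scaleR_add_right scaleR_add_left)

end


section \<open>Smooth surfaces\<close>

text \<open>\<open>C\<^sup>k\<close> maps, and smooth maps, on an open subset of a finite-dimensional space.\<close>

primrec ck_on :: "nat \<Rightarrow> 'a::euclidean_space set \<Rightarrow> ('a \<Rightarrow> 'b::real_normed_vector) \<Rightarrow> bool" where
  "ck_on 0 S h \<longleftrightarrow> continuous_on S h"
| "ck_on (Suc k) S h \<longleftrightarrow>
     (\<forall>x\<in>S. h differentiable (at x)) \<and> (\<forall>v. ck_on k S (\<lambda>x. frechet_derivative h (at x) v))"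

definition smooth_on :: "'a::euclidean_space set \<Rightarrow> ('a \<Rightarrow> 'b::real_normed_vector) \<Rightarrow> bool"
  where "smooth_on S h \<longleftrightarrow> (\<forall>k. ck_on k S h)"

text \<open>A chart is a coordinate domain together with a coordinate map.\<close>

type_synonym 'm chart = "'m set \<times> ('m \<Rightarrow> real^2)"

definition chart_inv :: "'m chart \<Rightarrow> real^2 \<Rightarrow> 'm"
  where "chart_inv c = inv_into (fst c) (snd c)"

definition smooth_surface :: "'m::{t2_space,second_countable_topology} chart set \<Rightarrow> bool" where
  "smooth_surface A \<longleftrightarrow>
     (\<Union>c\<in>A. fst c) = UNIV \<and>
     (\<forall>c\<in>A. open (fst c) \<and> open (snd c ` fst c) \<and>
        homeomorphism (fst c) (snd c ` fst c) (snd c) (chart_inv c)) \<and>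
     (\<forall>c\<in>A. \<forall>c'\<in>A. smooth_on (snd c ` (fst c \<inter> fst c')) (snd c' \<circ> chart_inv c))"

definition smooth_map_on ::
  "'m::topological_space chart set \<Rightarrow> 'm set \<Rightarrow> ('m \<Rightarrow> 'b::real_normed_vector) \<Rightarrow> bool" where
  "smooth_map_on A U h \<longleftrightarrow> (\<forall>c\<in>A. smooth_on (snd c ` (U \<inter> fst c)) (h \<circ> chart_inv c))"

text \<open>
  A tangent vector at \<open>x\<close> assigns to every chart around \<open>x\<close> its coordinate vector, subject to the
  usual transformation rule; at all other charts it is 0.
\<close>

type_synonym 'm tvec = "'m chart \<Rightarrow> real^2"

definition tangent_space :: "'m chart set \<Rightarrow> 'm \<Rightarrow> 'm tvec set" where
  "tangent_space A x = {X.
     (\<forall>c. \<not> (c \<in> A \<and> x \<in> fst c) \<longrightarrow> X c = 0) \<and>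
     (\<forall>c\<in>A. \<forall>c'\<in>A. x \<in> fst c \<longrightarrow> x \<in> fst c' \<longrightarrow>
        X c' = frechet_derivative (snd c' \<circ> chart_inv c) (at (snd c x)) (X c))}"

text \<open>The tangent vector at \<open>x\<close> with coordinate vector \<open>v\<close> in the chart \<open>c\<close>.\<close>

definition coord_tvec :: "'m chart set \<Rightarrow> 'm chart \<Rightarrow> real^2 \<Rightarrow> 'm \<Rightarrow> 'm tvec" where
  "coord_tvec A c v x = (\<lambda>c'. if c' \<in> A \<and> x \<in> fst c'
     then frechet_derivative (snd c' \<circ> chart_inv c) (at (snd c x)) v else 0)"

text \<open>The derivative \<open>d\<^sub>X h\<close> at \<open>x\<close>; the choice of chart is immaterial for \<open>X \<in> T\<^sub>x\<Sigma>\<close>.\<close>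

definition tder ::
  "'m chart set \<Rightarrow> ('m \<Rightarrow> 'b::real_normed_vector) \<Rightarrow> 'm \<Rightarrow> 'm tvec \<Rightarrow> 'b" where
  "tder A h x X = (let c = (SOME c. c \<in> A \<and> x \<in> fst c)
     in frechet_derivative (h \<circ> chart_inv c) (at (snd c x)) (X c))"

text \<open>
  Throughout, sections of bundles that enter pointwise (tensorial) constructions are local sections:
  a line bundle need not have a global nowhere vanishing section.
\<close>

definition local_section ::
  "'m::topological_space chart set \<Rightarrow> ('m \<Rightarrow> 'b::real_normed_vector set) \<Rightarrow> 'm set \<Rightarrow> ('m \<Rightarrow> 'b) \<Rightarrow> bool"
  where "local_section A W U \<sigma> \<longleftrightarrow> open U \<and> smooth_map_on A U \<sigma> \<and> (\<forall>y\<in>U. \<sigma> y \<in> W y)"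

definition local_vector_field ::
  "'m::topological_space chart set \<Rightarrow> ('m \<Rightarrow> 'm tvec set) \<Rightarrow> 'm set \<Rightarrow> ('m \<Rightarrow> 'm tvec) \<Rightarrow> bool"
  where "local_vector_field A T U X \<longleftrightarrow> open U \<and>
    (\<forall>y\<in>U. X y \<in> tangent_space A y \<and> X y \<in> T y) \<and>
    (\<forall>c\<in>A. smooth_map_on A (U \<inter> fst c) (\<lambda>y. X y c))"

definition smooth_subbundle ::
  "'m::topological_space chart set \<Rightarrow> nat \<Rightarrow> ('m \<Rightarrow> 'b::real_normed_vector set) \<Rightarrow> bool" where
  "smooth_subbundle A k W \<longleftrightarrow>
     (\<forall>x. subspace (W x) \<and> dim (W x) = k) \<and>
     (\<forall>x. \<exists>U \<sigma>. x \<in> U \<and> (\<forall>i<k. local_section A W U (\<sigma> i)) \<and>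
        (\<forall>y\<in>U. W y = span {\<sigma> i y |i. i < k}))"

text \<open>Vector-valued 1-forms; only the values on tangent spaces are relevant.\<close>

type_synonym ('m, 'b) form1 = "'m \<Rightarrow> 'm tvec \<Rightarrow> 'b"

definition smooth_form1 ::
  "'m::topological_space chart set \<Rightarrow> ('m, 'b::real_normed_vector) form1 \<Rightarrow> bool" where
  "smooth_form1 A \<eta> \<longleftrightarrow>
     (\<forall>x. \<forall>X\<in>tangent_space A x. \<forall>Y\<in>tangent_space A x. \<forall>a b.
        \<eta> x (a *\<^sub>R X + b *\<^sub>R Y) = a *\<^sub>R \<eta> x X + b *\<^sub>R \<eta> x Y) \<and>
     (\<forall>c\<in>A. \<forall>v. smooth_map_on A (fst c) (\<lambda>x. \<eta> x (coord_tvec A c v x)))"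

text \<open>\<open>d\<eta> = 0\<close>, evaluated on pairs of (commuting) constant coefficient coordinate fields.\<close>

definition closed_form1 ::
  "'m chart set \<Rightarrow> ('m, 'b::real_normed_vector) form1 \<Rightarrow> bool" where
  "closed_form1 A \<eta> \<longleftrightarrow> (\<forall>c\<in>A. \<forall>x\<in>fst c. \<forall>v w.
     tder A (\<lambda>y. \<eta> y (coord_tvec A c w y)) x (coord_tvec A c v x)
     - tder A (\<lambda>y. \<eta> y (coord_tvec A c v y)) x (coord_tvec A c w x) = 0)"


section \<open>The space \<open>\<real>\<^sup>4\<^sup>,\<^sup>2\<close> and its exterior square\<close>

type_synonym R42 = "(real^4) \<times> (real^2)"

definition ip :: "R42 \<Rightarrow> R42 \<Rightarrow> real"
  where "ip x y = fst x \<bullet> fst y - snd x \<bullet> snd y"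

lemma bilinear_ip: "bilinear ip"
  unfolding bilinear_def ip_def
  by (auto intro!: linearI simp: inner_add_left inner_add_right algebra_simps)

definition lightcone :: "R42 set"
  where "lightcone = {y. ip y y = 0}"

definition perp :: "R42 set \<Rightarrow> R42 set"
  where "perp V = {y. \<forall>x\<in>V. ip x y = 0}"

definition isotropic :: "R42 set \<Rightarrow> bool"
  where "isotropic V \<longleftrightarrow> (\<forall>x\<in>V. \<forall>y\<in>V. ip x y = 0)"

text \<open>Elements of the exterior square are identified with skew endomorphisms.\<close>

type_synonym o42 = "R42 \<Rightarrow>\<^sub>L R42"

lift_definition wedge :: "R42 \<Rightarrow> R42 \<Rightarrow> o42"
  is "\<lambda>a b c. ip a c *\<^sub>R b - ip b c *\<^sub>R a"
  unfolding linear_conv_bounded_linear[symmetric] ip_def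
  by (auto intro!: linearI simp: inner_add_right algebra_simps)

definition wedge_span :: "R42 set \<Rightarrow> R42 set \<Rightarrow> o42 set"
  where "wedge_span V W = span {wedge a b |a b. a \<in> V \<and> b \<in> W}"

definition lie_bracket :: "o42 \<Rightarrow> o42 \<Rightarrow> o42"
  where "lie_bracket B C = (B o\<^sub>L C) - (C o\<^sub>L B)"

text \<open>\<open>[\<omega> \<and> \<eta>](X, Y) = [\<omega>(X), \<eta>(Y)] - [\<omega>(Y), \<eta>(X)]\<close>\<close>

definition bracket_wedge ::
  "('m, o42) form1 \<Rightarrow> ('m, o42) form1 \<Rightarrow> 'm \<Rightarrow> 'm tvec \<Rightarrow> 'm tvec \<Rightarrow> o42" where
  "bracket_wedge \<omega> \<eta> x X Y = lie_bracket (\<omega> x X) (\<eta> x Y) - lie_bracket (\<omega> x Y) (\<eta> x X)"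


section \<open>Legendre maps and curvature spheres\<close>

definition derived_bundle :: "'m::topological_space chart set \<Rightarrow> ('m \<Rightarrow> R42 set) \<Rightarrow> 'm \<Rightarrow> R42 set" where
  "derived_bundle A W x = span (
     {\<sigma> x |\<sigma> U. x \<in> U \<and> local_section A W U \<sigma>} \<union>
     {tder A \<sigma> x X |\<sigma> U X. x \<in> U \<and> local_section A W U \<sigma> \<and> X \<in> tangent_space A x})"

definition legendre_map :: "'m::topological_space chart set \<Rightarrow> ('m \<Rightarrow> R42 set) \<Rightarrow> bool" where
  "legendre_map A f \<longleftrightarrow>
     smooth_subbundle A 2 f \<and> (\<forall>x. isotropic (f x)) \<and>
     (\<forall>x. derived_bundle A f x \<subseteq> perp (f x)) \<and>
     (\<forall>x. \<forall>X\<in>tangent_space A x.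
        (\<forall>U \<sigma>. x \<in> U \<longrightarrow> local_section A f U \<sigma> \<longrightarrow> tder A \<sigma> x X \<in> f x) \<longrightarrow> X = 0)"

text \<open>The maximal subspace of \<open>T\<^sub>x\<Sigma>\<close> all of whose elements \<open>X\<close> satisfy \<open>d\<^sub>X \<sigma> \<in> f\<close> on the line \<open>L \<le> f(x)\<close>.\<close>

definition curvature_space ::
  "'m::topological_space chart set \<Rightarrow> ('m \<Rightarrow> R42 set) \<Rightarrow> 'm \<Rightarrow> R42 set \<Rightarrow> 'm tvec set" where
  "curvature_space A f x L = {X \<in> tangent_space A x.
     \<forall>U \<sigma>. x \<in> U \<longrightarrow> local_section A f U \<sigma> \<longrightarrow> \<sigma> x \<in> L \<longrightarrow> tder A \<sigma> x X \<in> f x}"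

definition curvature_sphere ::
  "'m::topological_space chart set \<Rightarrow> ('m \<Rightarrow> R42 set) \<Rightarrow> 'm \<Rightarrow> R42 set \<Rightarrow> bool" where
  "curvature_sphere A f x L \<longleftrightarrow>
     subspace L \<and> dim L = 1 \<and> L \<subseteq> f x \<and> curvature_space A f x L \<noteq> {0}"

text \<open>\<open>f\<close> is umbilic-free, with curvature sphere bundles \<open>s1\<close> and \<open>s2\<close>.\<close>

definition umbilic_free ::
  "'m::topological_space chart set \<Rightarrow> ('m \<Rightarrow> R42 set) \<Rightarrow> ('m \<Rightarrow> R42 set) \<Rightarrow> ('m \<Rightarrow> R42 set) \<Rightarrow> bool" where
  "umbilic_free A f s1 s2 \<longleftrightarrow>
     smooth_subbundle A 1 s1 \<and> smooth_subbundle A 1 s2 \<and>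
     (\<forall>x. s1 x \<noteq> s2 x \<and> {L. curvature_sphere A f x L} = {s1 x, s2 x})"

definition curvature_subbundle ::
  "'m::topological_space chart set \<Rightarrow> ('m \<Rightarrow> R42 set) \<Rightarrow> ('m \<Rightarrow> R42 set) \<Rightarrow> 'm \<Rightarrow> 'm tvec set" where
  "curvature_subbundle A f s x = curvature_space A f x (s x)"


section \<open>Gauge potentials and Omega-surfaces\<close>

text \<open>Trace of an endomorphism of a finite-dimensional subspace \<open>V\<close>.\<close>

definition trace_on :: "'b::real_vector set \<Rightarrow> ('b \<Rightarrow> 'b) \<Rightarrow> real" where
  "trace_on V L = (let B = (SOME B. independent B \<and> span B = V)
     in \<Sum>b\<in>B. representation B (L b) b)"

text \<open>
  If \<open>\<eta>\<close> takes values in \<open>f \<and> f\<^sup>\<bottom>\<close>, then \<open>\<eta>(X) d\<^sub>Y \<sigma>\<close> at \<open>x\<close> depends only on \<open>\<sigma>(x)\<close>; this is the induced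
  endomorphism of the fibre \<open>f(x)\<close>, and \<open>q\<close> its trace.
\<close>

definition eta_d ::
  "'m::topological_space chart set \<Rightarrow> ('m \<Rightarrow> R42 set) \<Rightarrow> ('m, o42) form1 \<Rightarrow>
   'm \<Rightarrow> 'm tvec \<Rightarrow> 'm tvec \<Rightarrow> R42 \<Rightarrow> R42" where
  "eta_d A f \<eta> x X Y v = (THE w. \<exists>U \<sigma>. x \<in> U \<and> local_section A f U \<sigma> \<and> \<sigma> x = v \<and>
     w = blinfun_apply (\<eta> x X) (tder A \<sigma> x Y))"

definition qform ::
  "'m::topological_space chart set \<Rightarrow> ('m \<Rightarrow> R42 set) \<Rightarrow> ('m, o42) form1 \<Rightarrow>
   'm \<Rightarrow> 'm tvec \<Rightarrow> 'm tvec \<Rightarrow> real" where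
  "qform A f \<eta> x X Y = trace_on (f x) (eta_d A f \<eta> x X Y)"

definition gauge_potential ::
  "'m::topological_space chart set \<Rightarrow> ('m \<Rightarrow> R42 set) \<Rightarrow> ('m, o42) form1 \<Rightarrow> bool" where
  "gauge_potential A f \<eta> \<longleftrightarrow>
     smooth_form1 A \<eta> \<and>
     (\<forall>x. \<forall>X\<in>tangent_space A x. \<eta> x X \<in> wedge_span (f x) (perp (f x))) \<and>
     closed_form1 A \<eta> \<and>
     (\<forall>x. \<forall>X\<in>tangent_space A x. \<forall>Y\<in>tangent_space A x. bracket_wedge \<eta> \<eta> x X Y = 0) \<and>
     (\<exists>x. \<exists>X\<in>tangent_space A x. \<exists>Y\<in>tangent_space A x. qform A f \<eta> x X Y \<noteq> 0)"

definition nondegenerate_on :: "'v::real_vector set \<Rightarrow> ('v \<Rightarrow> 'v \<Rightarrow> real) \<Rightarrow> bool" where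
  "nondegenerate_on V B \<longleftrightarrow> (\<forall>v\<in>V. (\<forall>w\<in>V. B v w = 0) \<longrightarrow> v = 0)"

text \<open>\<open>f\<close> is an Omega-surface by virtue of the gauge potential \<open>\<eta>\<close>.\<close>

definition Omega_surface ::
  "'m::topological_space chart set \<Rightarrow> ('m \<Rightarrow> R42 set) \<Rightarrow> ('m, o42) form1 \<Rightarrow> bool" where
  "Omega_surface A f \<eta> \<longleftrightarrow> legendre_map A f \<and> gauge_potential A f \<eta> \<and>
     (\<exists>D. open D \<and> closure D = UNIV \<and>
        (\<forall>x\<in>D. nondegenerate_on (tangent_space A x) (qform A f \<eta> x)))"

text \<open>Index of positivity; the signature is that of \<open>B\<close> together with that of \<open>-B\<close>.\<close>

definition pos_index :: "'v::real_vector set \<Rightarrow> ('v \<Rightarrow> 'v \<Rightarrow> real) \<Rightarrow> nat" where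
  "pos_index V B = Max {dim W |W. subspace W \<and> W \<subseteq> V \<and> (\<forall>w\<in>W. w \<noteq> 0 \<longrightarrow> B w w > 0)}"

definition signature_on :: "'v::real_vector set \<Rightarrow> ('v \<Rightarrow> 'v \<Rightarrow> real) \<Rightarrow> nat \<times> nat" where
  "signature_on V B = (pos_index V B, pos_index V (\<lambda>v w. - B v w))"

definition constant_signature ::
  "'m::topological_space chart set \<Rightarrow> ('m \<Rightarrow> R42 set) \<Rightarrow> ('m, o42) form1 \<Rightarrow> bool" where
  "constant_signature A f \<eta> \<longleftrightarrow> (\<forall>x y.
     signature_on (tangent_space A x) (qform A f \<eta> x) =
     signature_on (tangent_space A y) (qform A f \<eta> y))"

text \<open>The gauge orbit, up to values off the tangent spaces.\<close>

definition gauge_orbit ::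
  "'m::topological_space chart set \<Rightarrow> ('m \<Rightarrow> R42 set) \<Rightarrow> ('m, o42) form1 \<Rightarrow> ('m, o42) form1 set" where
  "gauge_orbit A f \<eta> = {\<omega>. \<exists>\<tau>. local_section A (\<lambda>x. wedge_span (f x) (f x)) UNIV \<tau> \<and>
     (\<forall>x. \<forall>X\<in>tangent_space A x. \<omega> x X = \<eta> x X - tder A \<tau> x X)}"

text \<open>
  The fibre of \<open>\<langle>\<sigma>, d\<^sub>Y \<sigma>, d\<^sub>Y d\<^sub>Y \<sigma>\<rangle>\<close>, where \<open>\<sigma>\<close> is a section of \<open>s\<close> and \<open>Y\<close> one of \<open>T\<close>. The span over all
  \<open>\<sigma>\<close> and \<open>Y\<close> is the span for a single nowhere vanishing choice.
\<close>

definition cyclide_bundle ::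
  "'m::topological_space chart set \<Rightarrow> ('m \<Rightarrow> R42 set) \<Rightarrow> ('m \<Rightarrow> 'm tvec set) \<Rightarrow> 'm \<Rightarrow> R42 set" where
  "cyclide_bundle A s T x = span (\<Union>{
     {\<sigma> x, tder A \<sigma> x (Y x), tder A (\<lambda>y. tder A \<sigma> y (Y y)) x (Y x)} |\<sigma> Y U.
       x \<in> U \<and> local_section A s U \<sigma> \<and> local_vector_field A T U Y})"

text \<open>
  The \<open>S\<^sub>1 \<and> S\<^sub>2\<close> component of \<open>B\<close> with respect to the splitting of the exterior square as
  \<open>(\<and>\<^sup>2S\<^sub>1 \<oplus> \<and>\<^sup>2S\<^sub>2) \<oplus> S\<^sub>1 \<and> S\<^sub>2\<close> induced by \<open>\<real>\<^sup>4\<^sup>,\<^sup>2 = S\<^sub>1 \<oplus> S\<^sub>2\<close>.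
\<close>

definition mixed_component :: "R42 set \<Rightarrow> R42 set \<Rightarrow> o42 \<Rightarrow> o42" where
  "mixed_component S1 S2 B = (THE C. C \<in> wedge_span S1 S2 \<and>
     B - C \<in> span (wedge_span S1 S1 \<union> wedge_span S2 S2))"

text \<open>\<open>\<omega>\<close> is the middle potential in the gauge orbit of \<open>\<eta>\<close>. Note that \<open>S\<^sub>1\<close> is built from \<open>s\<^sub>1\<close> and \<open>T\<^sub>2\<close>.\<close>

definition middle_potential ::
  "'m::topological_space chart set \<Rightarrow> ('m \<Rightarrow> R42 set) \<Rightarrow> ('m \<Rightarrow> R42 set) \<Rightarrow> ('m \<Rightarrow> R42 set) \<Rightarrow>
   ('m, o42) form1 \<Rightarrow> ('m, o42) form1 \<Rightarrow> bool" where
  "middle_potential A f s1 s2 \<eta> \<omega> \<longleftrightarrow> \<omega> \<in> gauge_orbit A f \<eta> \<and>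
     (let S1 = cyclide_bundle A s1 (curvature_subbundle A f s2);
          S2 = cyclide_bundle A s2 (curvature_subbundle A f s1)
      in \<forall>x. \<forall>X\<in>tangent_space A x.
           mixed_component (S1 x) (S2 x) (\<omega> x X) \<in> wedge_span (f x) (f x))"


section \<open>Linear conserved quantities\<close>

text \<open>A linear polynomial \<open>p\<^sub>0 + t p\<^sub>1\<close> with coefficients maps from \<open>\<Sigma>\<close> to \<open>\<real>\<^sup>4\<^sup>,\<^sup>2\<close> is the pair \<open>(p\<^sub>0, p\<^sub>1)\<close>.\<close>

type_synonym 'm lpoly = "('m \<Rightarrow> R42) \<times> ('m \<Rightarrow> R42)"

definition at_param :: "real \<Rightarrow> 'm lpoly \<Rightarrow> 'm \<Rightarrow> R42"
  where "at_param t \<alpha> = (\<lambda>x. fst \<alpha> x + t *\<^sub>R snd \<alpha> x)"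

definition linear_conserved_quantity ::
  "'m::topological_space chart set \<Rightarrow> ('m, o42) form1 \<Rightarrow> 'm lpoly \<Rightarrow> bool" where
  "linear_conserved_quantity A \<omega> \<alpha> \<longleftrightarrow>
     smooth_map_on A UNIV (fst \<alpha>) \<and> smooth_map_on A UNIV (snd \<alpha>) \<and> snd \<alpha> \<noteq> 0 \<and>
     (\<forall>t x. \<forall>X\<in>tangent_space A x.
        tder A (at_param t \<alpha>) x X + t *\<^sub>R blinfun_apply (\<omega> x X) (at_param t \<alpha> x) = 0)"

definition lcq_plane ::
  "'m::topological_space chart set \<Rightarrow> ('m, o42) form1 \<Rightarrow> 'm lpoly set \<Rightarrow> bool" where
  "lcq_plane A \<omega> P \<longleftrightarrow> subspace P \<and> dim P = 2 \<and>
     (\<forall>\<alpha>\<in>P. \<alpha> \<noteq> 0 \<longrightarrow> linear_conserved_quantity A \<omega> \<alpha>)"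

text \<open>
  The forms \<open>g\<^sub>t\<close> and \<open>g\<^sub>\<infinity>\<close> evaluated at a base point \<open>z\<close>; on a space of linear conserved quantities over
  a connected surface they do not depend on \<open>z\<close>, and \<open>g\<^sub>t = g\<^sub>0 + t g\<^sub>\<infinity>\<close>. The quadratic term in the lemma
  below vanishes there.
\<close>

definition g_at :: "'m \<Rightarrow> real \<Rightarrow> 'm lpoly \<Rightarrow> 'm lpoly \<Rightarrow> real"
  where "g_at z t \<alpha> \<beta> = ip (at_param t \<alpha> z) (at_param t \<beta> z)"

definition g_inf :: "'m \<Rightarrow> 'm lpoly \<Rightarrow> 'm lpoly \<Rightarrow> real"
  where "g_inf z \<alpha> \<beta> = ip (fst \<alpha> z) (snd \<beta> z) + ip (fst \<beta> z) (snd \<alpha> z)"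

lemma g_at_expand: "g_at z t \<alpha> \<beta> = g_at z 0 \<alpha> \<beta> + t * g_inf z \<alpha> \<beta> + t\<^sup>2 * ip (snd \<alpha> z) (snd \<beta> z)"
  by (simp add: g_at_def g_inf_def at_param_def ip_def inner_commute power2_eq_square algebra_simps
      inner_add_left inner_add_right)


section \<open>Symmetric squares\<close>

text \<open>
  \<open>v \<odot> w = (v \<otimes> w + w \<otimes> v) / 2\<close>, regarded as a symmetric bilinear function of pairs of linear functionals.
  The guard makes the product bilinear in \<open>v\<close> and \<open>w\<close>.
\<close>

type_synonym 'v tensor2 = "('v \<Rightarrow> real) \<Rightarrow> ('v \<Rightarrow> real) \<Rightarrow> real"

definition odot :: "'v::real_vector \<Rightarrow> 'v \<Rightarrow> 'v tensor2"  (infixl "\<odot>" 75) where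
  "v \<odot> w = (\<lambda>\<phi> \<psi>. if linear \<phi> \<and> linear \<psi> then (\<phi> v * \<psi> w + \<phi> w * \<psi> v) / 2 else 0)"

definition sym_square :: "'v::real_vector set \<Rightarrow> 'v tensor2 set"
  where "sym_square V = span {v \<odot> w |v w. v \<in> V \<and> w \<in> V}"

text \<open>
  \<open>\<phi>\<^sub>t\<close>, with the sections in \<open>P(t)\<close> evaluated at the base point \<open>z\<close>: the symmetric square of the linear
  map \<open>\<alpha> \<mapsto> \<alpha>(t)(z)\<close>.
\<close>

definition phi_at :: "'m \<Rightarrow> real \<Rightarrow> 'm lpoly tensor2 \<Rightarrow> R42 tensor2" where
  "phi_at z t \<Theta> = (\<lambda>\<phi> \<psi>. if linear \<phi> \<and> linear \<psi>
     then \<Theta> (\<lambda>\<alpha>. \<phi> (at_param t \<alpha> z)) (\<lambda>\<alpha>. \<psi> (at_param t \<alpha> z)) else 0)"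

definition form_on :: "'v set \<Rightarrow> ('v \<Rightarrow> 'v \<Rightarrow> real) \<Rightarrow> 'v \<Rightarrow> 'v \<Rightarrow> real" where
  "form_on P B = (\<lambda>\<gamma> \<delta>. if \<gamma> \<in> P \<and> \<delta> \<in> P then B \<gamma> \<delta> else 0)"

text \<open>\<open>\<phi>\<^sub>\<infinity>\<close>, with values in the bilinear forms on \<open>P\<close> (extended by 0).\<close>

definition phi_inf :: "'m lpoly set \<Rightarrow> 'm \<Rightarrow> 'm lpoly tensor2 \<Rightarrow> 'm lpoly \<Rightarrow> 'm lpoly \<Rightarrow> real" where
  "phi_inf P z \<Theta> = form_on P (\<lambda>\<gamma> \<delta>. \<Theta> (\<lambda>\<alpha>. g_inf z \<alpha> \<gamma>) (\<lambda>\<alpha>. g_inf z \<alpha> \<delta>))"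

lemma linear_at_param: "linear (\<lambda>\<alpha>. at_param t \<alpha> z)"
  by (rule linearI) (simp_all add: at_param_def scaleR_fun_def plus_fun_def algebra_simps)

lemma linear_g_inf: "linear (\<lambda>\<alpha>. g_inf z \<alpha> \<gamma>)"
  by (rule linearI) (simp_all add: g_inf_def ip_def scaleR_fun_def plus_fun_def algebra_simps
      inner_add_left inner_add_right)

text \<open>The defining properties of \<open>\<phi>\<^sub>t\<close> and \<open>\<phi>\<^sub>\<infinity>\<close>; both maps are linear.\<close>

lemma phi_at_odot: "phi_at z t (\<alpha> \<odot> \<beta>) = at_param t \<alpha> z \<odot> at_param t \<beta> z"
proof -
  have "linear (\<lambda>\<alpha>. \<phi> (at_param t \<alpha> z))" if "linear \<phi>" for \<phi> :: "R42 \<Rightarrow> real"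
    using linear_compose[OF linear_at_param that] by (simp add: o_def)
  then show ?thesis
    by (auto simp: phi_at_def odot_def fun_eq_iff)
qed

lemma phi_inf_odot:
  assumes "\<gamma> \<in> P" "\<delta> \<in> P"
  shows "phi_inf P z (\<alpha> \<odot> \<beta>) \<gamma> \<delta> =
    (g_inf z \<alpha> \<gamma> * g_inf z \<beta> \<delta> + g_inf z \<alpha> \<delta> * g_inf z \<beta> \<gamma>) / 2"
  using assms by (simp add: phi_inf_def form_on_def odot_def linear_g_inf)

lemma linear_phi_at: "linear (phi_at z t)"
  by (rule linearI) (auto simp: phi_at_def scaleR_fun_def plus_fun_def fun_eq_iff)

lemma linear_phi_inf: "linear (phi_inf P z)"
  by (rule linearI) (auto simp: phi_inf_def form_on_def scaleR_fun_def plus_fun_def fun_eq_iff)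

text \<open>Equality of points \<open>[W] = [W']\<close> in a projective space.\<close>

definition proj_eq :: "'v::real_vector \<Rightarrow> 'v \<Rightarrow> bool"
  where "proj_eq W W' \<longleftrightarrow> W \<noteq> 0 \<and> W' \<noteq> 0 \<and> (\<exists>r. W = r *\<^sub>R W')"


section \<open>Projections to space forms\<close>

definition space_form :: "R42 \<Rightarrow> R42 \<Rightarrow> R42 set"
  where "space_form \<qq> \<pp> = {y \<in> lightcone. ip y \<qq> = -1 \<and> ip y \<pp> = 0}"

text \<open>\<open>\<ff>\<close> is the space form projection and \<open>\<tt>\<close> the tangent plane congruence of \<open>f\<close>.\<close>

definition space_form_projection ::
  "'m::topological_space chart set \<Rightarrow> ('m \<Rightarrow> R42 set) \<Rightarrow> R42 \<Rightarrow> R42 \<Rightarrow> ('m \<Rightarrow> R42) \<Rightarrow> bool" where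
  "space_form_projection A f \<qq> \<pp> \<ff> \<longleftrightarrow> local_section A f UNIV \<ff> \<and>
     (\<forall>x. \<ff> x \<in> space_form \<qq> \<pp>)"

definition tangent_plane_congruence ::
  "'m::topological_space chart set \<Rightarrow> ('m \<Rightarrow> R42 set) \<Rightarrow> R42 \<Rightarrow> R42 \<Rightarrow> ('m \<Rightarrow> R42) \<Rightarrow> bool" where
  "tangent_plane_congruence A f \<qq> \<pp> \<tt> \<longleftrightarrow> local_section A f UNIV \<tt> \<and>
     (\<forall>x. ip (\<tt> x) \<qq> = 0 \<and> ip (\<tt> x) \<pp> = -1)"

definition immerses_at :: "'m chart set \<Rightarrow> ('m \<Rightarrow> R42) \<Rightarrow> 'm \<Rightarrow> bool" where
  "immerses_at A \<ff> x \<longleftrightarrow> (\<forall>X\<in>tangent_space A x. tder A \<ff> x X = 0 \<longrightarrow> X = 0)"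

definition principal_curvature ::
  "'m chart set \<Rightarrow> ('m \<Rightarrow> 'm tvec set) \<Rightarrow> ('m \<Rightarrow> R42) \<Rightarrow> ('m \<Rightarrow> R42) \<Rightarrow> 'm \<Rightarrow> real \<Rightarrow> bool" where
  "principal_curvature A T \<ff> \<tt> x \<kappa> \<longleftrightarrow> (\<forall>X\<in>T x. tder A \<tt> x X + \<kappa> *\<^sub>R tder A \<ff> x X = 0)"

text \<open>
  \<open>a K + 2 b H + c = 0\<close> wherever \<open>\<ff>\<close> immerses. At such points the principal curvatures are unique.
\<close>

definition linear_weingarten ::
  "'m::topological_space chart set \<Rightarrow> ('m \<Rightarrow> 'm tvec set) \<Rightarrow> ('m \<Rightarrow> 'm tvec set) \<Rightarrow>
   ('m \<Rightarrow> R42) \<Rightarrow> ('m \<Rightarrow> R42) \<Rightarrow> real \<Rightarrow> real \<Rightarrow> real \<Rightarrow> bool" where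
  "linear_weingarten A T1 T2 \<ff> \<tt> a b c \<longleftrightarrow> (a, b, c) \<noteq> (0, 0, 0) \<and>
     (\<forall>x. immerses_at A \<ff> x \<longrightarrow>
        (\<exists>\<kappa>1 \<kappa>2. principal_curvature A T1 \<ff> \<tt> x \<kappa>1 \<and> principal_curvature A T2 \<ff> \<tt> x \<kappa>2 \<and>
           (let K = \<kappa>1 * \<kappa>2; H = (\<kappa>1 + \<kappa>2) / 2 in a * K + 2 * b * H + c = 0)))"

definition lw_condition :: "real \<Rightarrow> real \<Rightarrow> real \<Rightarrow> R42 \<Rightarrow> R42 \<Rightarrow> R42 tensor2" where
  "lw_condition a b c \<qq> \<pp> = a *\<^sub>R (\<qq> \<odot> \<qq>) + (2 * b) *\<^sub>R (\<qq> \<odot> \<pp>) + c *\<^sub>R (\<pp> \<odot> \<pp>)"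

definition tubular :: "real \<Rightarrow> real \<Rightarrow> real \<Rightarrow> bool"
  where "tubular a b c \<longleftrightarrow> b\<^sup>2 - a * c = 0"

end

theory Submission
  imports Defs
begin

text \<open>
  Let \<open>\<sigma>\<^sub>1, \<sigma>\<^sub>2\<close> be local sections spanning the curvature sphere bundles, \<open>X\<close> and \<open>Y\<close> fields spanning \<open>T\<^sub>1\<close> and
  \<open>T\<^sub>2\<close>, and put \<open>u\<^sub>1 = d\<^sub>Y \<sigma>\<^sub>1\<close>, \<open>u\<^sub>2 = d\<^sub>X \<sigma>\<^sub>2\<close>. The defining property of the middle potential \<open>\<omega>\<close> gives it the
  shape
    \<open>\<omega> = c \<sigma>\<^sub>1 \<and> \<sigma>\<^sub>2 + p \<sigma>\<^sub>1 \<and> u\<^sub>1 + q \<sigma>\<^sub>2 \<and> u\<^sub>2\<close>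
  with 1-forms \<open>c\<close>, \<open>p\<close>, \<open>q\<close> (\<open>middle_expansion\<close>, \<open>\<omega>_expansion\<close>). This rests on \<open>\<real>\<^sup>4\<^sup>,\<^sup>2 = S\<^sub>1 \<oplus> S\<^sub>2\<close>, which in turn
  follows from the inner products among \<open>\<sigma>\<^sub>i\<close>, \<open>u\<^sub>i\<close> and the second derivatives; the orthogonality of \<open>u\<^sub>1\<close> and
  \<open>u\<^sub>2\<close> comes from the symmetry of second derivatives (\<open>ip_tder_symmetric\<close>).

  A conserved quantity \<open>p\<^sub>0 + t p\<^sub>1\<close> satisfies \<open>dp\<^sub>0 = 0\<close>, \<open>dp\<^sub>1 = - \<omega> p\<^sub>0\<close> and \<open>\<omega> p\<^sub>1 = 0\<close>. Where the quadratic
  differential is non-degenerate, neither \<open>p\<close> nor \<open>q\<close> vanishes identically, and then \<open>\<omega> p\<^sub>1 = 0\<close> forces \<open>p\<^sub>1\<close> into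
  \<open>f\<close>; by density this holds everywhere (\<open>top_coefficient_in_f\<close>). Now compare \<open>dp\<^sub>1\<close> with \<open>- \<omega> p\<^sub>0\<close> modulo \<open>f\<close>
  along \<open>Y\<close> and \<open>X\<close>: this yields
    \<open>p\<^sub>1 = - p(Y) (\<sigma>\<^sub>1, p\<^sub>0) \<sigma>\<^sub>1 - q(X) (\<sigma>\<^sub>2, p\<^sub>0) \<sigma>\<^sub>2\<close>
  (\<open>top_coefficient_eq\<close>). Hence \<open>(\<alpha>\<^sub>0, \<beta>\<^sub>1)\<close> is symmetric in \<open>\<alpha>, \<beta> \<in> P\<close>, so it equals \<open>g\<^sub>\<infinity>(\<alpha>, \<beta>) / 2\<close>, which is
  constant because \<open>\<omega>\<close> is skew; and \<open>g\<^sub>\<infinity>\<close> is at each point a combination of the squares of the two functionals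
  \<open>(\<sigma>\<^sub>1, \<cdot>)\<close> and \<open>(\<sigma>\<^sub>2, \<cdot>)\<close>.

  Let \<open>\<alpha>, \<beta>\<close> be the elements of \<open>P\<close> with constant terms \<open>\<qq>\<close>, \<open>\<pp>\<close>. They form a basis of \<open>P\<close>. As \<open>g\<^sub>\<infinity>\<close> is
  non-degenerate, suitable constant combinations of the sections \<open>\<alpha>\<^sub>1, \<beta>\<^sub>1\<close> of \<open>f\<close> have the inner products with
  \<open>\<qq>\<close> and \<open>\<pp>\<close> that define \<open>\<ff>\<close> and \<open>\<tt>\<close>. Where \<open>\<ff>\<close> immerses, \<open>\<sigma>\<^sub>i\<close> is a multiple of \<open>\<tt> + \<kappa>\<^sub>i \<ff>\<close>, so that
  \<open>\<kappa>\<^sub>i = (\<sigma>\<^sub>i, \<qq>) / (\<sigma>\<^sub>i, \<pp>)\<close>. Since \<open>g\<^sub>\<infinity>\<close> is diagonal in the functionals \<open>(\<sigma>\<^sub>i, \<cdot>)\<close>, these two are conjugate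
  with respect to the inverse of \<open>g\<^sub>\<infinity>\<close> (\<open>weingarten_relation\<close>): that conjugacy is the equation
  \<open>a K + 2 b H + c = 0\<close>, whose coefficients are the entries of the inverse Gram matrix. The same inverse is
  \<open>\<phi>\<^sub>\<infinity>\<^sup>-\<^sup>1(g\<^sub>\<infinity>)\<close> (\<open>phi_inf_inverse\<close>), and \<open>b\<^sup>2 - a c\<close> is minus its determinant, hence non-zero.
\<close>


section \<open>Calculus of smooth functions on open sets\<close>

lemma ck_on_imp_continuous_on: "ck_on k S h \<Longrightarrow> continuous_on S h"
  by (cases k) (auto simp: continuous_on_eq_continuous_at differentiable_imp_continuous_within
      intro!: continuous_at_imp_continuous_on)

lemma ck_on_Suc_imp_ck_on: "ck_on (Suc k) S h \<Longrightarrow> ck_on k S h"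
proof (induction k arbitrary: h)
  case 0
  then show ?case using ck_on_imp_continuous_on by (simp only: ck_on.simps(1)) blast
qed simp

lemma ck_on_subset: "ck_on k S h \<Longrightarrow> T \<subseteq> S \<Longrightarrow> ck_on k T h"
  by (induction k arbitrary: h) (auto intro: continuous_on_subset)

lemma ck_on_cong:
  assumes "open S" "\<And>x. x \<in> S \<Longrightarrow> h x = h' x"
  shows "ck_on k S h \<longleftrightarrow> ck_on k S h'"
  using assms(2)
proof (induction k arbitrary: h h')
  case 0
  then show ?case by (simp cong: continuous_on_cong)
next
  case (Suc k)
  have d: "h differentiable at x \<longleftrightarrow> h' differentiable at x" if "x \<in> S" for x
    using that assms(1) Suc.prems
    by (metis (no_types, lifting) differentiable_def has_derivative_transform_within_open)
  show ?case
  proof (cases "\<forall>x\<in>S. h differentiable at x")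
    case True
    have "frechet_derivative h (at x) v = frechet_derivative h' (at x) v" if "x \<in> S" for x v
      using frechet_derivative_transform_within_open[of h x S h'] True that assms(1) Suc.prems by simp
    then have "ck_on k S (\<lambda>x. frechet_derivative h (at x) v) \<longleftrightarrow>
        ck_on k S (\<lambda>x. frechet_derivative h' (at x) v)" for v
      by (intro Suc.IH)
    then show ?thesis using d by simp
  qed (use d in auto)
qed

lemma ck_on_const [simp]: "ck_on k S (\<lambda>x. c)"
  by (induction k arbitrary: c) auto

lemma ck_on_add:
  assumes "open S" "ck_on k S g" "ck_on k S h"
  shows "ck_on k S (\<lambda>x. g x + h x)"
  using assms(2,3)
proof (induction k arbitrary: g h)
  case (Suc k)
  have d: "((\<lambda>x. g x + h x) has_derivative
      (\<lambda>v. frechet_derivative g (at x) v + frechet_derivative h (at x) v)) (at x)" if "x \<in> S" for x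
    using Suc.prems that
    by (intro has_derivative_add) (auto simp: frechet_derivative_works[symmetric])
  have "ck_on k S (\<lambda>x. frechet_derivative (\<lambda>x. g x + h x) (at x) v)" for v
  proof -
    have "ck_on k S (\<lambda>x. frechet_derivative g (at x) v + frechet_derivative h (at x) v)"
      using Suc.prems by (intro Suc.IH) auto
    then show ?thesis
      by (rule ck_on_cong[THEN iffD1, OF assms(1), rotated])
        (simp add: frechet_derivative_at[OF d, symmetric])
  qed
  then show ?case using d by (auto simp: differentiable_def)
qed (auto intro: continuous_on_add)

lemma ck_on_bilinear:
  assumes "open S" "bounded_bilinear B" "ck_on k S g" "ck_on k S h"
  shows "ck_on k S (\<lambda>x. B (g x) (h x))"
  using assms(3,4)
proof (induction k arbitrary: g h)
  case 0
  then show ?case using bounded_bilinear.continuous_on[OF assms(2)] by auto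
next
  case (Suc k)
  have d: "((\<lambda>x. B (g x) (h x)) has_derivative
      (\<lambda>v. B (g x) (frechet_derivative h (at x) v) + B (frechet_derivative g (at x) v) (h x))) (at x)"
    if "x \<in> S" for x
    using Suc.prems that
    by (intro bounded_bilinear.FDERIV[OF assms(2)]) (auto simp: frechet_derivative_works[symmetric])
  have "ck_on k S (\<lambda>x. frechet_derivative (\<lambda>x. B (g x) (h x)) (at x) v)" for v
  proof -
    have "ck_on k S (\<lambda>x. B (g x) (frechet_derivative h (at x) v)
        + B (frechet_derivative g (at x) v) (h x))"
      using Suc.prems ck_on_Suc_imp_ck_on[OF Suc.prems(1)] ck_on_Suc_imp_ck_on[OF Suc.prems(2)]
      by (intro ck_on_add[OF assms(1)] Suc.IH) auto
    then show ?thesis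
      by (rule ck_on_cong[THEN iffD1, OF assms(1), rotated])
        (simp add: frechet_derivative_at[OF d, symmetric])
  qed
  then show ?case using d by (auto simp: differentiable_def)
qed

lemma ck_on_linear:
  assumes "open S" "bounded_linear L" "ck_on k S h"
  shows "ck_on k S (\<lambda>x. L (h x))"
proof -
  have "bounded_bilinear (\<lambda>r x. r *\<^sub>R L x)"
    using bounded_bilinear.comp[OF bounded_bilinear_scaleR bounded_linear_ident assms(2)] .
  from ck_on_bilinear[OF assms(1) this, of k "\<lambda>_. 1" h] show ?thesis
    using assms(3) by simp
qed

lemma ck_on_sum:
  assumes "open S" "\<And>i. i \<in> I \<Longrightarrow> ck_on k S (g i)"
  shows "ck_on k S (\<lambda>x. \<Sum>i\<in>I. g i x)"
  using assms(2) by (induction I rule: infinite_finite_induct) (auto intro: ck_on_add[OF assms(1)])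

lemma ck_on_inverse:
  fixes h :: "'a::euclidean_space \<Rightarrow> real"
  assumes "open S" "ck_on k S h" "\<And>x. x \<in> S \<Longrightarrow> h x \<noteq> 0"
  shows "ck_on k S (\<lambda>x. inverse (h x))"
  using assms(2)
proof (induction k)
  case 0
  then show ?case using assms(3) by (auto intro: continuous_on_inverse)
next
  case (Suc k)
  have d: "((\<lambda>x. inverse (h x)) has_derivative
      (\<lambda>v. - (inverse (h x) * frechet_derivative h (at x) v * inverse (h x)))) (at x)"
    if "x \<in> S" for x
    using Suc.prems that assms(3)
    by (intro Deriv.has_derivative_inverse) (auto simp: frechet_derivative_works[symmetric])
  have IH: "ck_on k S (\<lambda>x. inverse (h x))"
    using Suc ck_on_Suc_imp_ck_on by blast
  have "ck_on k S (\<lambda>x. frechet_derivative (\<lambda>x. inverse (h x)) (at x) v)" for v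
  proof -
    have "ck_on k S (\<lambda>x. - (inverse (h x) * frechet_derivative h (at x) v * inverse (h x)))"
      using Suc.prems IH
      by (intro ck_on_linear[OF assms(1) bounded_linear_minus[OF bounded_linear_ident]]
          ck_on_bilinear[OF assms(1) bounded_bilinear_mult]) auto
    then show ?thesis
      by (rule ck_on_cong[THEN iffD1, OF assms(1), rotated])
        (simp add: frechet_derivative_at[OF d, symmetric])
  qed
  then show ?case using d by (auto simp: differentiable_def)
qed

lemma frechet_derivative_Basis_expansion:
  assumes "h differentiable (at x)"
  shows "frechet_derivative h (at x) v = (\<Sum>b\<in>Basis. (v \<bullet> b) *\<^sub>R frechet_derivative h (at x) b)"
  using linear_sum[OF linear_frechet_derivative[OF assms], of "\<lambda>b. (v \<bullet> b) *\<^sub>R b" Basis]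
  by (simp add: euclidean_representation linear_scale[OF linear_frechet_derivative[OF assms]])

lemma ck_on_compose:
  assumes "open S" "open T" "g ` S \<subseteq> T" "ck_on k S g" "ck_on k T h"
  shows "ck_on k S (\<lambda>x. h (g x))"
  using assms(4,5)
proof (induction k arbitrary: h)
  case 0
  then show ?case using assms(3) by (auto intro: continuous_on_compose2)
next
  case (Suc k)
  have gT: "g x \<in> T" if "x \<in> S" for x using that assms(3) by auto
  have d: "((\<lambda>x. h (g x)) has_derivative
      (\<lambda>v. frechet_derivative h (at (g x)) (frechet_derivative g (at x) v))) (at x)" if "x \<in> S" for x
    using diff_chain_at[of g "frechet_derivative g (at x)" x h "frechet_derivative h (at (g x))"]
      Suc.prems that gT by (auto simp: frechet_derivative_works[symmetric] o_def)
  have "ck_on k S (\<lambda>x. frechet_derivative (\<lambda>x. h (g x)) (at x) v)" for v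
  proof -
    have "ck_on k S (\<lambda>x. \<Sum>b\<in>Basis. (frechet_derivative g (at x) v \<bullet> b) *\<^sub>R
        frechet_derivative h (at (g x)) b)"
      using Suc.prems ck_on_Suc_imp_ck_on
      by (intro ck_on_sum[OF assms(1)] ck_on_bilinear[OF assms(1) bounded_bilinear_scaleR]
          ck_on_linear[OF assms(1) bounded_linear_inner_left] Suc.IH) auto
    then show ?thesis
      by (rule ck_on_cong[THEN iffD1, OF assms(1), rotated])
        (use Suc.prems gT in \<open>simp add: frechet_derivative_at[OF d, symmetric]
          frechet_derivative_Basis_expansion[symmetric]\<close>)
  qed
  then show ?case using d by (auto simp: differentiable_def)
qed

lemma smooth_on_subset: "smooth_on S h \<Longrightarrow> T \<subseteq> S \<Longrightarrow> smooth_on T h"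
  by (auto simp: smooth_on_def intro: ck_on_subset)

lemma smooth_on_cong:
  "open S \<Longrightarrow> (\<And>x. x \<in> S \<Longrightarrow> h x = h' x) \<Longrightarrow> smooth_on S h \<longleftrightarrow> smooth_on S h'"
  unfolding smooth_on_def using ck_on_cong[of S h h'] by blast

lemma smooth_on_imp_differentiable: "smooth_on S h \<Longrightarrow> x \<in> S \<Longrightarrow> h differentiable (at x)"
  unfolding smooth_on_def by (metis ck_on.simps(2))

lemma smooth_on_frechet_derivative:
  "smooth_on S h \<Longrightarrow> smooth_on S (\<lambda>x. frechet_derivative h (at x) v)"
  unfolding smooth_on_def by (metis ck_on.simps(2))

text \<open>
  Two applications of the mean value theorem express the second difference over a small parallelogram
  through \<open>D\<^sub>w D\<^sub>v h\<close> and through \<open>D\<^sub>v D\<^sub>w h\<close> at nearby points.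
\<close>

lemma second_difference:
  fixes h :: "'a::real_normed_vector \<Rightarrow> real"
  assumes e: "e > 0"
    and h: "\<And>r s. 0 \<le> r \<Longrightarrow> r \<le> e \<Longrightarrow> 0 \<le> s \<Longrightarrow> s \<le> e \<Longrightarrow>
      (h has_derivative h' (x + r *\<^sub>R v + s *\<^sub>R w)) (at (x + r *\<^sub>R v + s *\<^sub>R w))"
    and h': "\<And>r s. 0 \<le> r \<Longrightarrow> r \<le> e \<Longrightarrow> 0 \<le> s \<Longrightarrow> s \<le> e \<Longrightarrow>
      ((\<lambda>y. h' y v) has_derivative h'' (x + r *\<^sub>R v + s *\<^sub>R w)) (at (x + r *\<^sub>R v + s *\<^sub>R w))"
  shows "\<exists>r s. 0 < r \<and> r < e \<and> 0 < s \<and> s < e \<and>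
    h (x + e *\<^sub>R v + e *\<^sub>R w) - h (x + e *\<^sub>R v) - h (x + e *\<^sub>R w) + h x =
      e\<^sup>2 * h'' (x + r *\<^sub>R v + s *\<^sub>R w) w"
proof -
  have scale: "D (c *\<^sub>R u) = c * D u" if "(g has_derivative D) F" for g :: "'a \<Rightarrow> real" and D F c u
    using that has_derivative_linear linear_scale by fastforce
  define F where "F r = h (x + r *\<^sub>R v + e *\<^sub>R w) - h (x + r *\<^sub>R v)" for r
  have F: "(F has_real_derivative (h' (x + r *\<^sub>R v + e *\<^sub>R w) v - h' (x + r *\<^sub>R v) v)) (at r)"
    if "0 \<le> r" "r \<le> e" for r
  proof -
    have 1: "((\<lambda>r. h (x + r *\<^sub>R v + e *\<^sub>R w)) has_derivative
        (\<lambda>t. h' (x + r *\<^sub>R v + e *\<^sub>R w) (t *\<^sub>R v))) (at r)"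
      using h[of r e] that e
      by (intro diff_chain_at[where f = "\<lambda>r. x + r *\<^sub>R v + e *\<^sub>R w" and g = h, unfolded o_def])
        (auto intro!: derivative_eq_intros)
    have 2: "((\<lambda>r. h (x + r *\<^sub>R v)) has_derivative (\<lambda>t. h' (x + r *\<^sub>R v) (t *\<^sub>R v))) (at r)"
      using h[of r 0] that e
      by (intro diff_chain_at[where f = "\<lambda>r. x + r *\<^sub>R v" and g = h, unfolded o_def])
        (auto intro!: derivative_eq_intros)
    show ?thesis
      unfolding F_def has_field_derivative_def
      by (rule has_derivative_eq_rhs[OF has_derivative_diff[OF 1 2]])
        (use scale[OF h[of r e]] scale[OF h[of r 0]] that e in \<open>auto simp: algebra_simps\<close>)
  qed
  obtain r where r: "0 < r" "r < e"
    "F e - F 0 = (e - 0) * (h' (x + r *\<^sub>R v + e *\<^sub>R w) v - h' (x + r *\<^sub>R v) v)"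
    using MVT2[OF e F] by metis
  have G: "((\<lambda>s. h' (x + r *\<^sub>R v + s *\<^sub>R w) v) has_real_derivative
      (h'' (x + r *\<^sub>R v + s *\<^sub>R w) w)) (at s)" if "0 \<le> s" "s \<le> e" for s
  proof -
    have 1: "((\<lambda>s. h' (x + r *\<^sub>R v + s *\<^sub>R w) v) has_derivative
        (\<lambda>t. h'' (x + r *\<^sub>R v + s *\<^sub>R w) (t *\<^sub>R w))) (at s)"
      using h'[of r s] that r
      by (intro diff_chain_at[where f = "\<lambda>s. x + r *\<^sub>R v + s *\<^sub>R w" and g = "\<lambda>y. h' y v", unfolded o_def])
        (auto intro!: derivative_eq_intros)
    show ?thesis
      unfolding has_field_derivative_def
      by (rule has_derivative_eq_rhs[OF 1])
        (use scale[OF h'[of r s]] that r in \<open>auto simp: algebra_simps\<close>)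
  qed
  obtain s where s: "0 < s" "s < e"
    "h' (x + r *\<^sub>R v + e *\<^sub>R w) v - h' (x + r *\<^sub>R v + 0 *\<^sub>R w) v =
      (e - 0) * h'' (x + r *\<^sub>R v + s *\<^sub>R w) w"
    using MVT2[OF e G] by metis
  show ?thesis
    by (intro exI[of _ r] exI[of _ s]) (use r s in \<open>auto simp: F_def power2_eq_square\<close>)
qed

lemma second_derivative_symmetric_real:
  fixes h :: "'a::euclidean_space \<Rightarrow> real"
  assumes "open S" "x \<in> S" "smooth_on S h"
  shows "frechet_derivative (\<lambda>y. frechet_derivative h (at y) v) (at x) w =
    frechet_derivative (\<lambda>y. frechet_derivative h (at y) w) (at x) v"
proof (rule ccontr)
  define D where "D v w y = frechet_derivative (\<lambda>y. frechet_derivative h (at y) v) (at y) w" for v w y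
  assume "\<not> ?thesis"
  then have ne: "\<bar>D v w x - D w v x\<bar> > 0" by (simp add: D_def)
  define d where "d = \<bar>D v w x - D w v x\<bar> / 2"
  have d: "d > 0" using ne by (simp add: d_def)
  have cont: "continuous_on S (D v w)" for v w
    using smooth_on_frechet_derivative[OF smooth_on_frechet_derivative[OF assms(3)], of v w]
    unfolding D_def smooth_on_def by (metis ck_on.simps(1))
  have "\<exists>\<delta>>0. \<forall>y. dist y x < \<delta> \<longrightarrow> dist (D v w y) (D v w x) < d" for v w
    using cont[of v w] assms(1,2) d
    by (metis continuous_at_eps_delta continuous_on_eq_continuous_at)
  then obtain \<delta>1 \<delta>2 where \<delta>: "\<delta>1 > 0" "\<delta>2 > 0"
    "\<And>y. dist y x < \<delta>1 \<Longrightarrow> dist (D v w y) (D v w x) < d"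
    "\<And>y. dist y x < \<delta>2 \<Longrightarrow> dist (D w v y) (D w v x) < d"
    by metis
  obtain \<delta>3 where \<delta>3: "\<delta>3 > 0" "ball x \<delta>3 \<subseteq> S" using assms(1,2) openE by blast
  define \<delta> where "\<delta> = min \<delta>1 (min \<delta>2 \<delta>3)"
  have \<delta>0: "\<delta> > 0" using \<delta> \<delta>3 by (simp add: \<delta>_def)
  define e where "e = \<delta> / (2 * (norm v + norm w + 1))"
  have e: "e > 0" using \<delta>0 by (simp add: e_def add_nonneg_pos)
  have near: "dist (x + r *\<^sub>R v + s *\<^sub>R w) x < \<delta>" if "0 \<le> r" "r \<le> e" "0 \<le> s" "s \<le> e" for r s
  proof -
    have "dist (x + r *\<^sub>R v + s *\<^sub>R w) x \<le> r * norm v + s * norm w"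
      using that norm_triangle_ineq[of "r *\<^sub>R v" "s *\<^sub>R w"] by (simp add: dist_norm)
    also have "\<dots> \<le> e * norm v + e * norm w"
      using that by (intro add_mono mult_right_mono) auto
    also have "\<dots> = e * (norm v + norm w)" by (simp add: distrib_left)
    also have "\<dots> < e * (2 * (norm v + norm w + 1))"
      by (rule mult_strict_left_mono[OF _ e]) (smt (verit) norm_ge_zero)
    also have "\<dots> = \<delta>"
    proof -
      have "norm v + norm w + 1 \<noteq> 0" by (smt (verit) norm_ge_zero)
      then show ?thesis by (simp add: e_def)
    qed
    finally show ?thesis .
  qed
  have inS: "x + r *\<^sub>R v + s *\<^sub>R w \<in> S" if "0 \<le> r" "r \<le> e" "0 \<le> s" "s \<le> e" for r s
    using near[OF that] \<delta>3 by (auto simp: \<delta>_def dist_commute)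
  have der: "(h has_derivative frechet_derivative h (at y)) (at y)"
    "((\<lambda>z. frechet_derivative h (at z) u) has_derivative (\<lambda>u'. D u u' y)) (at y)" if "y \<in> S" for y u
    using smooth_on_imp_differentiable[OF assms(3) that]
      smooth_on_imp_differentiable[OF smooth_on_frechet_derivative[OF assms(3)] that, of u]
    by (auto simp: frechet_derivative_works D_def)
  note diff = second_difference[OF e, where h = h and h' = "\<lambda>y. frechet_derivative h (at y)" and x = x,
      OF der(1) der(2)]
  have swap: "x + r *\<^sub>R w + s *\<^sub>R v = x + s *\<^sub>R v + r *\<^sub>R w" for r s by simp
  obtain r s where 1: "0 < r" "r < e" "0 < s" "s < e"
    "h (x + e *\<^sub>R v + e *\<^sub>R w) - h (x + e *\<^sub>R v) - h (x + e *\<^sub>R w) + h x =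
      e\<^sup>2 * D v w (x + r *\<^sub>R v + s *\<^sub>R w)"
    using diff[OF inS inS] by blast
  have inS': "x + r *\<^sub>R w + s *\<^sub>R v \<in> S" if "0 \<le> r" "r \<le> e" "0 \<le> s" "s \<le> e" for r s
    using inS[OF that(3,4,1,2)] by (simp only: swap)
  obtain r' s' where 2: "0 < r'" "r' < e" "0 < s'" "s' < e"
    "h (x + e *\<^sub>R w + e *\<^sub>R v) - h (x + e *\<^sub>R w) - h (x + e *\<^sub>R v) + h x =
      e\<^sup>2 * D w v (x + r' *\<^sub>R w + s' *\<^sub>R v)"
    using diff[OF inS' inS'] by blast
  have "e\<^sup>2 * D v w (x + r *\<^sub>R v + s *\<^sub>R w) = e\<^sup>2 * D w v (x + r' *\<^sub>R w + s' *\<^sub>R v)"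
    using 1(5) 2(5) unfolding swap by linarith
  then have "D v w (x + r *\<^sub>R v + s *\<^sub>R w) = D w v (x + s' *\<^sub>R v + r' *\<^sub>R w)"
    using e by (simp add: swap)
  moreover have "dist (D v w (x + r *\<^sub>R v + s *\<^sub>R w)) (D v w x) < d"
    using near[of r s] 1 by (intro \<delta>) (auto simp: \<delta>_def)
  moreover have "dist (D w v (x + s' *\<^sub>R v + r' *\<^sub>R w)) (D w v x) < d"
    using near[of s' r'] 2 by (intro \<delta>) (auto simp: \<delta>_def)
  ultimately show False
    unfolding dist_real_def using d_def by (smt (verit) field_sum_of_halves)
qed

lemma frechet_derivative_inner_left:
  assumes "g differentiable (at y)"
  shows "frechet_derivative (\<lambda>y. g y \<bullet> b) (at y) v = frechet_derivative g (at y) v \<bullet> b"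
  using assms
  by (subst frechet_derivative_at[symmetric, OF has_derivative_inner_left])
    (auto simp: frechet_derivative_works[symmetric])

lemma second_derivative_symmetric:
  fixes h :: "'a::euclidean_space \<Rightarrow> 'b::euclidean_space"
  assumes S: "open S" "x \<in> S" and h: "smooth_on S h"
  shows "frechet_derivative (\<lambda>y. frechet_derivative h (at y) v) (at x) w =
    frechet_derivative (\<lambda>y. frechet_derivative h (at y) w) (at x) v"
proof (rule euclidean_eqI)
  fix b :: 'b
  have hb: "smooth_on S (\<lambda>y. h y \<bullet> b)"
    using ck_on_linear[OF S(1) bounded_linear_inner_left] h unfolding smooth_on_def by blast
  have "frechet_derivative (\<lambda>y. frechet_derivative h (at y) v) (at x) w \<bullet> b =
      frechet_derivative (\<lambda>y. frechet_derivative (\<lambda>y. h y \<bullet> b) (at y) v) (at x) w" for v w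
  proof -
    have "frechet_derivative (\<lambda>y. frechet_derivative h (at y) v) (at x) w \<bullet> b =
      frechet_derivative (\<lambda>y. frechet_derivative h (at y) v \<bullet> b) (at x) w"
      using smooth_on_imp_differentiable[OF smooth_on_frechet_derivative[OF h] S(2)]
      by (simp add: frechet_derivative_inner_left)
    also have "\<dots> = frechet_derivative (\<lambda>y. frechet_derivative (\<lambda>y. h y \<bullet> b) (at y) v) (at x) w"
      using smooth_on_imp_differentiable[OF smooth_on_frechet_derivative[OF h] S(2), of v]
      by (intro fun_cong[OF frechet_derivative_transform_within_open[OF _ S]])
        (auto simp: frechet_derivative_inner_left smooth_on_imp_differentiable[OF h])
    finally show ?thesis .
  qed
  then show "frechet_derivative (\<lambda>y. frechet_derivative h (at y) v) (at x) w \<bullet> b =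
      frechet_derivative (\<lambda>y. frechet_derivative h (at y) w) (at x) v \<bullet> b"
    using second_derivative_symmetric_real[OF S hb] by simp
qed

section \<open>Calculus on a smooth surface\<close>

text \<open>
  Everything below is pointwise, so smoothness, vector fields and sections are used in the form of germs:
  a map or field given on all of \<open>\<Sigma>\<close> that is smooth on some neighbourhood of the point.
\<close>

definition smooth_near ::
  "'m::topological_space chart set \<Rightarrow> 'm \<Rightarrow> ('m \<Rightarrow> 'b::real_normed_vector) \<Rightarrow> bool" where
  "smooth_near A x h \<longleftrightarrow> (\<exists>U. open U \<and> x \<in> U \<and> smooth_map_on A U h)"

definition vector_field_near ::
  "'m::topological_space chart set \<Rightarrow> 'm \<Rightarrow> ('m \<Rightarrow> 'm tvec) \<Rightarrow> bool" where
  "vector_field_near A x Y \<longleftrightarrow> (\<exists>U. x \<in> U \<and> local_vector_field A (tangent_space A) U Y)"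

locale surface =
  fixes A :: "'m::{t2_space,second_countable_topology} chart set"
  assumes smooth_surface: "smooth_surface A"
begin

lemma obtain_chart: obtains c where "c \<in> A" "x \<in> fst c"
  using smooth_surface unfolding smooth_surface_def by blast

lemma some_chart:
  "(SOME c. c \<in> A \<and> x \<in> fst c) \<in> A" "x \<in> fst (SOME c. c \<in> A \<and> x \<in> fst c)"
  using obtain_chart[of x] someI_ex[of "\<lambda>c. c \<in> A \<and> x \<in> fst c"] by blast+

context
  fixes c assumes c: "c \<in> A"
begin

lemma open_chart: "open (fst c)"
  using smooth_surface c unfolding smooth_surface_def by blast

lemma chart_homeomorphism: "homeomorphism (fst c) (snd c ` fst c) (snd c) (chart_inv c)"
  and open_chart_image: "open (snd c ` fst c)"
  using smooth_surface c unfolding smooth_surface_def by blast+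

lemma chart_inv_chart [simp]: "x \<in> fst c \<Longrightarrow> chart_inv c (snd c x) = x"
  using chart_homeomorphism unfolding homeomorphism_def by blast

lemma open_image:
  assumes "open U"
  shows "open (snd c ` (U \<inter> fst c))"
proof -
  have "openin (top_of_set (fst c)) (U \<inter> fst c)"
    using assms unfolding openin_open by blast
  then have "openin (top_of_set (snd c ` fst c)) (snd c ` (U \<inter> fst c))"
    using homeomorphism_imp_open_map chart_homeomorphism by blast
  then show ?thesis using openin_open_trans open_chart_image by blast
qed

lemma continuous_on_chart: "continuous_on (fst c) (snd c)"
  using chart_homeomorphism unfolding homeomorphism_def by blast

lemma smooth_map_on_chart:
  assumes "smooth_map_on A U h"
  shows "smooth_on (snd c ` (U \<inter> fst c)) (h \<circ> chart_inv c)"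
  using assms c unfolding smooth_map_on_def by blast

lemma smooth_transition:
  assumes "c' \<in> A"
  shows "smooth_on (snd c ` (fst c \<inter> fst c')) (snd c' \<circ> chart_inv c)"
  using smooth_surface c assms unfolding smooth_surface_def by blast

lemma differentiable_chart:
  assumes "smooth_near A x h" "x \<in> fst c"
  shows "(h \<circ> chart_inv c) differentiable (at (snd c x))"
proof -
  obtain U where "open U" "x \<in> U" "smooth_map_on A U h"
    using assms unfolding smooth_near_def by blast
  then show ?thesis
    using smooth_on_imp_differentiable[OF smooth_map_on_chart[of U h], of "snd c x"] assms(2) by blast
qed

lemma differentiable_transition:
  assumes "c' \<in> A" "x \<in> fst c" "x \<in> fst c'"
  shows "(snd c' \<circ> chart_inv c) differentiable (at (snd c x))"
  using smooth_on_imp_differentiable[OF smooth_transition[OF assms(1)]] assms by blast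

end

subsection \<open>Smooth maps\<close>

lemma smooth_map_on_continuous_on:
  fixes h :: "'m \<Rightarrow> 'b::real_normed_vector"
  assumes "open U" "smooth_map_on A U h"
  shows "continuous_on U h"
proof (rule continuous_at_imp_continuous_on, rule ballI)
  fix x assume x: "x \<in> U"
  obtain c where c: "c \<in> A" "x \<in> fst c" using obtain_chart .
  have "continuous_on (snd c ` (U \<inter> fst c)) (h \<circ> chart_inv c)"
    using smooth_map_on_chart[OF c(1) assms(2)] unfolding smooth_on_def by (metis ck_on.simps(1))
  then have "continuous_on (U \<inter> fst c) (\<lambda>x. (h \<circ> chart_inv c) (snd c x))"
    using continuous_on_compose2 continuous_on_subset[OF continuous_on_chart[OF c(1)]]
    by (metis inf_le2 order_refl)
  then have "continuous_on (U \<inter> fst c) h"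
    by (rule continuous_on_cong[THEN iffD1, rotated 2]) (simp_all add: c)
  then show "continuous (at x) h"
    using x c assms(1) open_chart by (simp add: continuous_on_eq_continuous_at open_Int)
qed

lemma smooth_map_on_subset: "smooth_map_on A U h \<Longrightarrow> V \<subseteq> U \<Longrightarrow> smooth_map_on A V h"
  unfolding smooth_map_on_def by (meson Int_mono image_mono order_refl smooth_on_subset)

lemma smooth_map_on_cong:
  assumes "open U" "\<And>x. x \<in> U \<Longrightarrow> h x = k x" "smooth_map_on A U h"
  shows "smooth_map_on A U k"
  unfolding smooth_map_on_def
proof
  fix c assume c: "c \<in> A"
  show "smooth_on (snd c ` (U \<inter> fst c)) (k \<circ> chart_inv c)"
    using smooth_map_on_chart[OF c assms(3)]
    by (rule smooth_on_cong[THEN iffD1, OF open_image[OF c assms(1)], rotated]) (auto simp: assms(2) c)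
qed

lemma smooth_map_on_const: "smooth_map_on A U (\<lambda>_. k)"
  by (simp add: smooth_map_on_def smooth_on_def o_def)

lemma smooth_map_on_add:
  assumes "open U" "smooth_map_on A U g" "smooth_map_on A U h"
  shows "smooth_map_on A U (\<lambda>x. g x + h x)"
  using ck_on_add[OF open_image[OF _ assms(1)]] assms(2,3)
  unfolding smooth_map_on_def smooth_on_def o_def by blast

lemma smooth_map_on_bilinear:
  assumes "bounded_bilinear B" "open U" "smooth_map_on A U g" "smooth_map_on A U h"
  shows "smooth_map_on A U (\<lambda>x. B (g x) (h x))"
  using ck_on_bilinear[OF open_image[OF _ assms(2)] assms(1)] assms(3,4)
  unfolding smooth_map_on_def smooth_on_def o_def by blast

lemma smooth_map_on_linear:
  assumes "bounded_linear L" "open U" "smooth_map_on A U h"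
  shows "smooth_map_on A U (\<lambda>x. L (h x))"
  using ck_on_linear[OF open_image[OF _ assms(2)] assms(1)] assms(3)
  unfolding smooth_map_on_def smooth_on_def o_def by blast

lemma smooth_map_on_inverse:
  fixes h :: "'m \<Rightarrow> real"
  assumes "open U" "smooth_map_on A U h" "\<And>x. x \<in> U \<Longrightarrow> h x \<noteq> 0"
  shows "smooth_map_on A U (\<lambda>x. inverse (h x))"
  unfolding smooth_map_on_def smooth_on_def o_def
proof (intro ballI allI)
  fix c k assume c: "c \<in> A"
  show "ck_on k (snd c ` (U \<inter> fst c)) (\<lambda>u. inverse (h (chart_inv c u)))"
    using smooth_map_on_chart[OF c assms(2)]
    by (intro ck_on_inverse open_image[OF c assms(1)]) (auto simp: assms(3) smooth_on_def o_def c)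
qed

lemma smooth_nearI: "smooth_map_on A U h \<Longrightarrow> open U \<Longrightarrow> x \<in> U \<Longrightarrow> smooth_near A x h"
  unfolding smooth_near_def by blast

lemma smooth_near_common:
  assumes "smooth_near A x g" "smooth_near A x h"
  obtains U where "open U" "x \<in> U" "smooth_map_on A U g" "smooth_map_on A U h"
proof -
  obtain U V where UV: "open U" "x \<in> U" "smooth_map_on A U g" "open V" "x \<in> V" "smooth_map_on A V h"
    using assms unfolding smooth_near_def by blast
  show ?thesis
    by (rule that[of "U \<inter> V"])
      (use UV smooth_map_on_subset[OF UV(3)] smooth_map_on_subset[OF UV(6)] in auto)
qed

lemma smooth_near_add:
  "smooth_near A x g \<Longrightarrow> smooth_near A x h \<Longrightarrow> smooth_near A x (\<lambda>y. g y + h y)"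
  by (erule smooth_near_common, assumption) (blast intro: smooth_nearI smooth_map_on_add)

lemma smooth_near_bilinear:
  "bounded_bilinear B \<Longrightarrow> smooth_near A x g \<Longrightarrow> smooth_near A x h \<Longrightarrow>
    smooth_near A x (\<lambda>y. B (g y) (h y))"
  by (rule smooth_near_common[of x g h]) (blast intro: smooth_nearI smooth_map_on_bilinear)+

lemma smooth_near_linear:
  "bounded_linear L \<Longrightarrow> smooth_near A x h \<Longrightarrow> smooth_near A x (\<lambda>y. L (h y))"
  unfolding smooth_near_def using smooth_map_on_linear by blast

lemma smooth_near_inverse:
  fixes h :: "'m \<Rightarrow> real"
  assumes "smooth_near A x h" "h x \<noteq> 0"
  shows "smooth_near A x (\<lambda>y. inverse (h y))"
proof -
  obtain U where U: "open U" "x \<in> U" "smooth_map_on A U h"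
    using assms unfolding smooth_near_def by blast
  have "open {y \<in> U. h y \<noteq> 0}"
    using continuous_open_preimage[OF smooth_map_on_continuous_on[OF U(1,3)] U(1), of "- {0}"]
    by (simp add: vimage_def Int_def open_Compl)
  then show ?thesis
    using U assms(2) smooth_map_on_subset[OF U(3)]
    by (intro smooth_nearI[of "{y \<in> U. h y \<noteq> 0}"] smooth_map_on_inverse) auto
qed

lemma smooth_near_eventually: "smooth_near A x h \<Longrightarrow> \<forall>\<^sub>F y in nhds x. smooth_near A y h"
  unfolding smooth_near_def eventually_nhds by blast

lemma smooth_near_isCont: "smooth_near A x h \<Longrightarrow> isCont h x"
  unfolding smooth_near_def using smooth_map_on_continuous_on
  by (metis continuous_on_eq_continuous_at)

lemma smooth_near_eventually_nonzero:
  fixes h :: "'m \<Rightarrow> real"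
  shows "smooth_near A x h \<Longrightarrow> h x \<noteq> 0 \<Longrightarrow> \<forall>\<^sub>F y in nhds x. h y \<noteq> 0"
  using smooth_near_isCont tendsto_imp_eventually_ne
  unfolding isCont_def tendsto_at_iff_tendsto_nhds by blast

lemma eventually_chart: "c \<in> A \<Longrightarrow> x \<in> fst c \<Longrightarrow> \<forall>\<^sub>F y in nhds x. y \<in> fst c"
  unfolding eventually_nhds using open_chart by blast

subsection \<open>Tangent vectors\<close>

lemma tangent_space_transition:
  assumes "X \<in> tangent_space A x" "c \<in> A" "x \<in> fst c" "c' \<in> A" "x \<in> fst c'"
  shows "X c' = frechet_derivative (snd c' \<circ> chart_inv c) (at (snd c x)) (X c)"
  using assms unfolding tangent_space_def by blast

text \<open>The chain rule for a change of charts; it makes \<^const>\<open>tder\<close> independent of the chart.\<close>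

lemma frechet_derivative_transition:
  fixes h :: "'m \<Rightarrow> 'b::real_normed_vector"
  assumes c: "c \<in> A" "x \<in> fst c" and c': "c' \<in> A" "x \<in> fst c'"
    and h: "(h \<circ> chart_inv c') differentiable (at (snd c' x))"
  shows "frechet_derivative (h \<circ> chart_inv c) (at (snd c x)) v =
    frechet_derivative (h \<circ> chart_inv c') (at (snd c' x))
      (frechet_derivative (snd c' \<circ> chart_inv c) (at (snd c x)) v)"
proof -
  let ?g = "snd c' \<circ> chart_inv c" and ?S = "snd c ` (fst c' \<inter> fst c)"
  have S: "open ?S" "snd c x \<in> ?S" using open_image open_chart c c' by auto
  have g: "(?g has_derivative frechet_derivative ?g (at (snd c x))) (at (snd c x))"
    using differentiable_transition c c' frechet_derivative_works by blast
  have gx: "?g (snd c x) = snd c' x" using c by simp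
  have "((h \<circ> chart_inv c') \<circ> ?g has_derivative
      frechet_derivative (h \<circ> chart_inv c') (at (snd c' x)) \<circ> frechet_derivative ?g (at (snd c x)))
      (at (snd c x))"
    using h by (intro diff_chain_at[OF g]) (simp only: gx frechet_derivative_works)
  then have "(h \<circ> chart_inv c has_derivative
      frechet_derivative (h \<circ> chart_inv c') (at (snd c' x)) \<circ> frechet_derivative ?g (at (snd c x)))
      (at (snd c x))"
    by (rule has_derivative_transform_within_open[OF _ S]) (use c c' in auto)
  from frechet_derivative_at[OF this, symmetric] show ?thesis by simp
qed

lemma tder_chart:
  assumes "smooth_near A x h" "X \<in> tangent_space A x" "c \<in> A" "x \<in> fst c"
  shows "tder A h x X = frechet_derivative (h \<circ> chart_inv c) (at (snd c x)) (X c)"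
proof -
  define c' where "c' = (SOME c. c \<in> A \<and> x \<in> fst c)"
  have c': "c' \<in> A" "x \<in> fst c'" unfolding c'_def by (fact some_chart)+
  show ?thesis
    unfolding tder_def c'_def[symmetric] Let_def
      frechet_derivative_transition[OF c' assms(3,4) differentiable_chart[OF assms(3,1,4)]]
      tangent_space_transition[OF assms(2) c' assms(3,4)] ..
qed

lemma coord_tvec_in_tangent_space:
  assumes c: "c \<in> A" "x \<in> fst c"
  shows "coord_tvec A c v x \<in> tangent_space A x"
proof -
  have "coord_tvec A c v x c'' = frechet_derivative (snd c'' \<circ> chart_inv c') (at (snd c' x)) (coord_tvec A c v x c')"
    if c': "c' \<in> A" "x \<in> fst c'" and c'': "c'' \<in> A" "x \<in> fst c''" for c' c''
    using frechet_derivative_transition[OF c c' differentiable_transition[OF c'(1) c''(1) c'(2) c''(2)]]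
    by (simp add: coord_tvec_def c' c'')
  moreover have "coord_tvec A c v x c' = 0" if "\<not> (c' \<in> A \<and> x \<in> fst c')" for c'
    using that unfolding coord_tvec_def by (rule if_not_P)
  ultimately show ?thesis unfolding tangent_space_def by blast
qed

lemma coord_tvec_self [simp]:
  assumes c: "c \<in> A" "x \<in> fst c"
  shows "coord_tvec A c v x c = v"
proof -
  have "((\<lambda>u. u) has_derivative (\<lambda>u. u)) (at (snd c x))" by (rule has_derivative_ident)
  then have "(snd c \<circ> chart_inv c has_derivative (\<lambda>u. u)) (at (snd c x))"
    by (rule has_derivative_transform_within_open[where s = "snd c ` fst c"])
      (use c open_chart_image in auto)
  from frechet_derivative_at[OF this, symmetric] show ?thesis using c by (simp add: coord_tvec_def)
qed

lemma tangent_space_eq_coord_tvec: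
  assumes X: "X \<in> tangent_space A x" and c: "c \<in> A" "x \<in> fst c"
  shows "X = coord_tvec A c (X c) x"
proof
  fix c'
  show "X c' = coord_tvec A c (X c) x c'"
  proof (cases "c' \<in> A \<and> x \<in> fst c'")
    case True
    then show ?thesis
      using tangent_space_transition[OF X c, of c'] by (simp add: coord_tvec_def)
  next
    case False
    then have "X c' = 0" using X unfolding tangent_space_def by blast
    then show ?thesis unfolding coord_tvec_def if_not_P[OF False] .
  qed
qed

lemma tangent_space_eqI:
  assumes "X \<in> tangent_space A x" "Y \<in> tangent_space A x" "c \<in> A" "x \<in> fst c" "X c = Y c"
  shows "X = Y"
  using tangent_space_eq_coord_tvec assms by metis

lemma subspace_tangent_space: "subspace (tangent_space A x)"
proof -
  have L: "linear (frechet_derivative (snd c' \<circ> chart_inv c) (at (snd c x)))"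
    if "c \<in> A" "c' \<in> A" "x \<in> fst c" "x \<in> fst c'" for c c'
    using linear_frechet_derivative differentiable_transition that by blast
  have off: "X c = 0" if "X \<in> tangent_space A x" "\<not> (c \<in> A \<and> x \<in> fst c)" for X c
    using that unfolding tangent_space_def by blast
  show ?thesis
  proof (rule subspaceI)
    show "0 \<in> tangent_space A x"
      unfolding tangent_space_def by (simp add: linear_0[OF L])
  next
    fix X Y assume X: "X \<in> tangent_space A x" and Y: "Y \<in> tangent_space A x"
    have "(X + Y) c' = frechet_derivative (snd c' \<circ> chart_inv c) (at (snd c x)) ((X + Y) c)"
      if c: "c \<in> A" "x \<in> fst c" and c': "c' \<in> A" "x \<in> fst c'" for c c'
      unfolding plus_fun_apply linear_add[OF L[OF c(1) c'(1) c(2) c'(2)]]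
        tangent_space_transition[OF X c c', symmetric] tangent_space_transition[OF Y c c', symmetric] ..
    moreover have "(X + Y) c = 0" if "\<not> (c \<in> A \<and> x \<in> fst c)" for c
      using off[OF X that] off[OF Y that] by (simp add: plus_fun_apply)
    ultimately show "X + Y \<in> tangent_space A x"
      unfolding tangent_space_def by blast
  next
    fix r X assume X: "X \<in> tangent_space A x"
    have "(r *\<^sub>R X) c' = frechet_derivative (snd c' \<circ> chart_inv c) (at (snd c x)) ((r *\<^sub>R X) c)"
      if c: "c \<in> A" "x \<in> fst c" and c': "c' \<in> A" "x \<in> fst c'" for c c'
      unfolding scaleR_fun_def linear_scale[OF L[OF c(1) c'(1) c(2) c'(2)]]
        tangent_space_transition[OF X c c', symmetric] ..
    moreover have "(r *\<^sub>R X) c = 0" if "\<not> (c \<in> A \<and> x \<in> fst c)" for c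
      using off[OF X that] by (simp add: scaleR_fun_def)
    ultimately show "r *\<^sub>R X \<in> tangent_space A x"
      unfolding tangent_space_def by blast
  qed
qed

text \<open>
  The component of a coordinate field in another chart is a derivative of the transition map, read in a third
  chart; this is the place where compositions of smooth maps enter.
\<close>

lemma local_vector_field_coord:
  assumes c: "c \<in> A"
  shows "local_vector_field A (tangent_space A) (fst c) (coord_tvec A c v)"
  unfolding local_vector_field_def
proof (intro conjI ballI)
  show "open (fst c)" using open_chart[OF c] .
  fix y assume y: "y \<in> fst c"
  show "coord_tvec A c v y \<in> tangent_space A y" using coord_tvec_in_tangent_space c y by blast
  then show "coord_tvec A c v y \<in> tangent_space A y" .
next
  fix c' assume c': "c' \<in> A"
  show "smooth_map_on A (fst c \<inter> fst c') (\<lambda>y. coord_tvec A c v y c')"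
    unfolding smooth_map_on_def
  proof
    fix c'' assume c'': "c'' \<in> A"
    let ?S = "snd c'' ` (fst c \<inter> fst c' \<inter> fst c'')" and ?T = "snd c ` (fst c \<inter> fst c')"
    have S: "open ?S" using open_image[OF c''] open_chart c c' by blast
    have T: "open ?T" using open_image[OF c open_chart[OF c']] by (simp add: Int_commute)
    have g: "smooth_on ?S (snd c \<circ> chart_inv c'')"
      by (rule smooth_on_subset[OF smooth_transition[OF c'' c]]) auto
    have gST: "(snd c \<circ> chart_inv c'') ` ?S \<subseteq> ?T" using c'' by auto
    have h: "smooth_on ?T (\<lambda>w. frechet_derivative (snd c' \<circ> chart_inv c) (at w) v)"
      by (rule smooth_on_frechet_derivative[OF smooth_transition[OF c c']])
    have "smooth_on ?S (\<lambda>u. frechet_derivative (snd c' \<circ> chart_inv c)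
        (at ((snd c \<circ> chart_inv c'') u)) v)"
      using g h ck_on_compose[OF S T gST] unfolding smooth_on_def by blast
    then show "smooth_on ?S ((\<lambda>y. coord_tvec A c v y c') \<circ> chart_inv c'')"
      by (rule smooth_on_cong[THEN iffD1, OF S, rotated]) (auto simp: coord_tvec_def c' c'')
  qed
qed

lemma vector_field_near_coord: "c \<in> A \<Longrightarrow> x \<in> fst c \<Longrightarrow> vector_field_near A x (coord_tvec A c v)"
  unfolding vector_field_near_def using local_vector_field_coord by blast

lemma vector_field_near_combination:
  assumes "vector_field_near A x Y" "vector_field_near A x Z" "smooth_near A x a" "smooth_near A x b"
  shows "vector_field_near A x (\<lambda>y. a y *\<^sub>R Y y + b y *\<^sub>R Z y)"
proof -
  obtain U where U: "open U" "x \<in> U" "smooth_map_on A U a" "smooth_map_on A U b"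
    using smooth_near_common[OF assms(3,4)] .
  obtain V W where VW: "x \<in> V" "x \<in> W"
    "local_vector_field A (tangent_space A) V Y" "local_vector_field A (tangent_space A) W Z"
    using assms unfolding vector_field_near_def by blast
  let ?N = "U \<inter> V \<inter> W"
  have o: "open ?N" using U VW unfolding local_vector_field_def by blast
  have "smooth_map_on A (?N \<inter> fst c) (\<lambda>y. (a y *\<^sub>R Y y + b y *\<^sub>R Z y) c)" if c: "c \<in> A" for c
  proof -
    have "smooth_map_on A (?N \<inter> fst c) (\<lambda>y. Y y c)" "smooth_map_on A (?N \<inter> fst c) (\<lambda>y. Z y c)"
      "smooth_map_on A (?N \<inter> fst c) a" "smooth_map_on A (?N \<inter> fst c) b"
      using VW(3,4) c U by (auto simp: local_vector_field_def intro: smooth_map_on_subset)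
    then have "smooth_map_on A (?N \<inter> fst c) (\<lambda>y. a y *\<^sub>R Y y c + b y *\<^sub>R Z y c)"
      using open_Int[OF o open_chart[OF c]]
      by (intro smooth_map_on_add smooth_map_on_bilinear[OF bounded_bilinear_scaleR])
    then show ?thesis by (simp add: scaleR_fun_def plus_fun_def)
  qed
  moreover have "a y *\<^sub>R Y y + b y *\<^sub>R Z y \<in> tangent_space A y" if "y \<in> ?N" for y
    using that VW(3,4) subspace_tangent_space[of y]
    by (auto simp: local_vector_field_def intro!: subspace_add subspace_scale)
  ultimately have "local_vector_field A (tangent_space A) ?N (\<lambda>y. a y *\<^sub>R Y y + b y *\<^sub>R Z y)"
    using o unfolding local_vector_field_def by simp
  then show ?thesis
    using U(2) VW(1,2) unfolding vector_field_near_def by (intro exI[of _ ?N]) simp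
qed

lemma vector_field_near_tangent:
  "vector_field_near A x Y \<Longrightarrow> \<forall>\<^sub>F y in nhds x. Y y \<in> tangent_space A y"
  unfolding vector_field_near_def local_vector_field_def eventually_nhds by blast

lemma vector_field_near_component:
  assumes "vector_field_near A x Y" "c \<in> A" "x \<in> fst c"
  shows "smooth_near A x (\<lambda>y. Y y c)"
proof -
  obtain U where "x \<in> U" "local_vector_field A (tangent_space A) U Y"
    using assms unfolding vector_field_near_def by blast
  then show ?thesis
    using assms open_chart[OF assms(2)]
    by (intro smooth_nearI[of "U \<inter> fst c"]) (auto simp: local_vector_field_def)
qed

subsection \<open>Directional derivatives\<close>

text \<open>Derivatives depend only on germs, even where the map is not differentiable.\<close>

lemma tder_transform:
  assumes "\<forall>\<^sub>F y in nhds x. h y = k y"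
  shows "tder A h x X = tder A k x X"
proof -
  define c where "c = (SOME c. c \<in> A \<and> x \<in> fst c)"
  have c: "c \<in> A" "x \<in> fst c" unfolding c_def by (fact some_chart)+
  obtain U where U: "open U" "x \<in> U" "\<And>y. y \<in> U \<Longrightarrow> h y = k y"
    using assms unfolding eventually_nhds by blast
  let ?S = "snd c ` (U \<inter> fst c)"
  have S: "open ?S" "snd c x \<in> ?S" using open_image c U by auto
  have eq: "(h \<circ> chart_inv c) u = (k \<circ> chart_inv c) u" if "u \<in> ?S" for u
    using that c U by auto
  have "(h \<circ> chart_inv c has_derivative D) (at (snd c x)) \<longleftrightarrow>
      (k \<circ> chart_inv c has_derivative D) (at (snd c x))" for D
    using has_derivative_transform_within_open[OF _ S] eq by metis
  then have "frechet_derivative (h \<circ> chart_inv c) (at (snd c x)) =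
      frechet_derivative (k \<circ> chart_inv c) (at (snd c x))"
    unfolding frechet_derivative_def by simp
  then show ?thesis unfolding tder_def c_def Let_def by simp
qed

context
  fixes x :: 'm and X :: "'m tvec"
begin

lemma has_derivative_tder:
  assumes "smooth_near A x h"
  defines "c \<equiv> SOME c. c \<in> A \<and> x \<in> fst c"
  shows "(h \<circ> chart_inv c has_derivative (\<lambda>v. frechet_derivative (h \<circ> chart_inv c) (at (snd c x)) v))
    (at (snd c x))"
  using differentiable_chart[OF some_chart(1) assms(1) some_chart(2)]
  unfolding c_def by (simp add: frechet_derivative_works)

lemma tder_eqI:
  assumes "(h \<circ> chart_inv (SOME c. c \<in> A \<and> x \<in> fst c) has_derivative D)
    (at (snd (SOME c. c \<in> A \<and> x \<in> fst c) x))"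
  shows "tder A h x X = D (X (SOME c. c \<in> A \<and> x \<in> fst c))"
  unfolding tder_def Let_def frechet_derivative_at[OF assms, symmetric] ..

lemma tder_const [simp]: "tder A (\<lambda>_. k) x X = 0"
  by (rule tder_eqI[where D = "\<lambda>_. 0"]) (simp add: o_def)

lemma tder_add:
  assumes "smooth_near A x g" "smooth_near A x h"
  shows "tder A (\<lambda>y. g y + h y) x X = tder A g x X + tder A h x X"
  using tder_eqI[of "\<lambda>y. g y + h y"] has_derivative_add[OF has_derivative_tder[OF assms(1)]
      has_derivative_tder[OF assms(2)]]
  by (simp add: o_def tder_def Let_def)

lemma tder_bilinear:
  assumes B: "bounded_bilinear B" and "smooth_near A x g" "smooth_near A x h"
  shows "tder A (\<lambda>y. B (g y) (h y)) x X = B (g x) (tder A h x X) + B (tder A g x X) (h x)"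
proof -
  let ?c = "SOME c. c \<in> A \<and> x \<in> fst c"
  have "chart_inv ?c (snd ?c x) = x" by (simp add: some_chart)
  then show ?thesis
    using tder_eqI[of "\<lambda>y. B (g y) (h y)"] bounded_bilinear.FDERIV[OF B has_derivative_tder[OF assms(2)]
      has_derivative_tder[OF assms(3)]]
    by (simp add: o_def tder_def Let_def)
qed

lemma tder_linear:
  assumes L: "bounded_linear L" and "smooth_near A x h"
  shows "tder A (\<lambda>y. L (h y)) x X = L (tder A h x X)"
  using tder_eqI[of "\<lambda>y. L (h y)"] bounded_linear.has_derivative[OF L has_derivative_tder[OF assms(2)]]
  by (simp add: o_def tder_def Let_def)

end

lemma linear_tder:
  assumes "smooth_near A x h"
  shows "linear (tder A h x)"
proof -
  have "linear (frechet_derivative (h \<circ> chart_inv (SOME c. c \<in> A \<and> x \<in> fst c))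
      (at (snd (SOME c. c \<in> A \<and> x \<in> fst c) x)))"
    using has_derivative_tder[OF assms] has_derivative_linear by blast
  from linear_add[OF this] linear_scale[OF this] show ?thesis
    by (intro linearI) (simp_all add: tder_def Let_def scaleR_fun_def plus_fun_def)
qed

lemma smooth_map_on_tder:
  assumes h: "smooth_map_on A U h" and Y: "local_vector_field A (tangent_space A) U Y"
  shows "smooth_map_on A U (\<lambda>y. tder A h y (Y y))"
  unfolding smooth_map_on_def
proof
  fix c assume c: "c \<in> A"
  let ?S = "snd c ` (U \<inter> fst c)" and ?D = "\<lambda>b u. frechet_derivative (h \<circ> chart_inv c) (at u) b"
  have U: "open U" using Y by (simp add: local_vector_field_def)
  have S: "open ?S" by (rule open_image[OF c U])
  have hc: "smooth_on ?S (h \<circ> chart_inv c)" by (rule smooth_map_on_chart[OF c h])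
  have "smooth_map_on A (U \<inter> fst c) (\<lambda>y. Y y c)"
    using Y c by (simp add: local_vector_field_def)
  from smooth_map_on_chart[OF c this] have Yc: "smooth_on ?S ((\<lambda>y. Y y c) \<circ> chart_inv c)"
    by (simp add: Int_assoc)
  have "smooth_on ?S (\<lambda>u. \<Sum>b\<in>Basis. (((\<lambda>y. Y y c) \<circ> chart_inv c) u \<bullet> b) *\<^sub>R ?D b u)"
    using Yc smooth_on_frechet_derivative[OF hc] unfolding smooth_on_def
    by (intro allI ck_on_sum[OF S] ck_on_bilinear[OF S bounded_bilinear_scaleR]
        ck_on_linear[OF S bounded_linear_inner_left]) blast+
  then show "smooth_on ?S ((\<lambda>y. tder A h y (Y y)) \<circ> chart_inv c)"
  proof (rule smooth_on_cong[THEN iffD1, OF S, rotated])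
    fix u assume "u \<in> ?S"
    then obtain y where y: "y \<in> U" "y \<in> fst c" "u = snd c y" by blast
    have hy: "smooth_near A y h" using h U y by (blast intro: smooth_nearI)
    have "tder A h y (Y y) = ?D (Y y c) u"
      using tder_chart[OF hy _ c y(2)] Y y by (simp add: local_vector_field_def)
    also have "\<dots> = (\<Sum>b\<in>Basis. (Y y c \<bullet> b) *\<^sub>R ?D b u)"
      using differentiable_chart[OF c hy y(2)] y(3)
      by (subst frechet_derivative_Basis_expansion) auto
    finally show "(\<Sum>b\<in>Basis. (((\<lambda>y. Y y c) \<circ> chart_inv c) u \<bullet> b) *\<^sub>R ?D b u) =
        ((\<lambda>y. tder A h y (Y y)) \<circ> chart_inv c) u"
      using y c by simp
  qed
qed

lemma smooth_near_tder:
  assumes "smooth_near A x h" "vector_field_near A x Y"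
  shows "smooth_near A x (\<lambda>y. tder A h y (Y y))"
proof -
  obtain U V where UV: "open U" "x \<in> U" "smooth_map_on A U h" "x \<in> V"
    "local_vector_field A (tangent_space A) V Y"
    using assms unfolding smooth_near_def vector_field_near_def by blast
  have "local_vector_field A (tangent_space A) (U \<inter> V) Y"
    using UV by (auto simp: local_vector_field_def intro: smooth_map_on_subset)
  then have "smooth_map_on A (U \<inter> V) (\<lambda>y. tder A h y (Y y))"
    using UV by (intro smooth_map_on_tder smooth_map_on_subset[OF UV(3)]) auto
  then show ?thesis
    using UV by (intro smooth_nearI[of "U \<inter> V"]) (auto simp: local_vector_field_def)
qed

lemma tder_coord_symmetric:
  fixes h :: "'m \<Rightarrow> 'b::euclidean_space"
  assumes h: "smooth_near A x h" and c: "c \<in> A" "x \<in> fst c"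
  shows "tder A (\<lambda>y. tder A h y (coord_tvec A c v y)) x (coord_tvec A c w x) =
    tder A (\<lambda>y. tder A h y (coord_tvec A c w y)) x (coord_tvec A c v x)"
proof -
  obtain U where U: "open U" "x \<in> U" "smooth_map_on A U h"
    using h unfolding smooth_near_def by blast
  let ?S = "snd c ` (U \<inter> fst c)"
  have S: "open ?S" "snd c x \<in> ?S" using open_image[OF c(1) U(1)] U c by auto
  have "tder A (\<lambda>y. tder A h y (coord_tvec A c v y)) x (coord_tvec A c w x) =
      frechet_derivative (\<lambda>u. frechet_derivative (h \<circ> chart_inv c) (at u) v) (at (snd c x)) w" for v w
  proof -
    have "tder A (\<lambda>y. tder A h y (coord_tvec A c v y)) x (coord_tvec A c w x) =
      frechet_derivative ((\<lambda>y. tder A h y (coord_tvec A c v y)) \<circ> chart_inv c) (at (snd c x)) w"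
      using tder_chart[OF smooth_near_tder[OF h vector_field_near_coord[OF c]]
          coord_tvec_in_tangent_space[OF c] c] c by simp
    also have "\<dots> = frechet_derivative (\<lambda>u. frechet_derivative (h \<circ> chart_inv c) (at u) v) (at (snd c x)) w"
    proof (rule fun_cong[OF frechet_derivative_transform_within_open[OF _ S]])
      show "((\<lambda>y. tder A h y (coord_tvec A c v y)) \<circ> chart_inv c) differentiable (at (snd c x))"
        using differentiable_chart[OF c(1) smooth_near_tder[OF h vector_field_near_coord[OF c]] c(2)] .
      fix u assume "u \<in> ?S"
      then obtain y where y: "y \<in> U" "y \<in> fst c" "u = snd c y" by blast
      have "smooth_near A y h" using U y by (blast intro: smooth_nearI)
      from tder_chart[OF this coord_tvec_in_tangent_space[OF c(1) y(2)] c(1) y(2)]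
      show "((\<lambda>y. tder A h y (coord_tvec A c v y)) \<circ> chart_inv c) u =
          frechet_derivative (h \<circ> chart_inv c) (at u) v"
        using y c(1) by simp
    qed
    finally show ?thesis .
  qed
  then show ?thesis
    using second_derivative_symmetric[OF S smooth_map_on_chart[OF c(1) U(3)]] by simp
qed

text \<open>The level sets are closed, and open as \<open>h\<close> is constant on balls in charts.\<close>

lemma constant_if_tder_zero:
  fixes h :: "'m \<Rightarrow> real"
  assumes conn: "connected (UNIV :: 'm set)" and h: "smooth_map_on A UNIV h"
    and zero: "\<And>y Y. Y \<in> tangent_space A y \<Longrightarrow> tder A h y Y = 0"
  shows "h x = h z"
proof -
  let ?E = "{y. h y = h z}"
  have "continuous_on UNIV h" using smooth_map_on_continuous_on[OF open_UNIV h] .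
  then have "closed ?E" by (intro closed_Collect_eq continuous_on_const)
  moreover have "open ?E"
  proof (subst open_subopen, rule ballI)
    fix y assume y: "y \<in> ?E"
    obtain c where c: "c \<in> A" "y \<in> fst c" using obtain_chart .
    obtain e where e: "e > 0" "ball (snd c y) e \<subseteq> snd c ` fst c"
      using openE[OF open_chart_image[OF c(1)]] c(2) by blast
    have der: "(h \<circ> chart_inv c has_derivative (\<lambda>_. 0)) (at u within ball (snd c y) e)"
      if u: "u \<in> ball (snd c y) e" for u
    proof -
      obtain y' where y': "y' \<in> fst c" "u = snd c y'" using u e by blast
      have sm: "smooth_near A y' h" using h by (blast intro: smooth_nearI)
      have "frechet_derivative (h \<circ> chart_inv c) (at u) v = 0" for v
        using tder_chart[OF sm coord_tvec_in_tangent_space c(1) y'(1), of c v] c y' zero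
          coord_tvec_in_tangent_space[OF c(1) y'(1)] by simp
      then have "frechet_derivative (h \<circ> chart_inv c) (at u) = (\<lambda>_. 0)" by blast
      then show ?thesis
        using differentiable_chart[OF c(1) sm y'(1)] unfolding y'(2)[symmetric] frechet_derivative_works
        by (simp add: has_derivative_at_withinI)
    qed
    obtain k where k: "\<And>u. u \<in> ball (snd c y) e \<Longrightarrow> (h \<circ> chart_inv c) u = k"
      using has_derivative_zero_constant[OF convex_ball der] by blast
    let ?V = "fst c \<inter> snd c -` ball (snd c y) e"
    have "open ?V"
      using continuous_open_preimage[OF continuous_on_chart[OF c(1)] open_chart[OF c(1)] open_ball] .
    moreover have "?V \<subseteq> ?E"
    proof
      fix y' assume y': "y' \<in> ?V"
      have "h y' = k" using k[of "snd c y'"] y' c(1) by simp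
      moreover have "h y = k" using k[of "snd c y"] c e(1) by simp
      ultimately show "y' \<in> ?E" using y by simp
    qed
    moreover have "y \<in> ?V" using c e(1) by simp
    ultimately show "\<exists>T. open T \<and> y \<in> T \<and> T \<subseteq> ?E" by blast
  qed
  ultimately have "?E = {} \<or> ?E = UNIV" using conn[unfolded connected_clopen] by (metis open_openin closed_closedin subtopology_UNIV)
  then show ?thesis by blast
qed

end

section \<open>Linear algebra\<close>

lemma in_span_2: "x \<in> span {b1, b2} \<longleftrightarrow> (\<exists>r s. x = r *\<^sub>R b1 + s *\<^sub>R b2)"
  by (simp add: span_breakdown_eq diff_eq_eq) (simp add: add.commute)

lemma in_span_3: "x \<in> span {b1, b2, b3} \<longleftrightarrow> (\<exists>r s t. x = r *\<^sub>R b1 + s *\<^sub>R b2 + t *\<^sub>R b3)"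
  by (simp add: span_breakdown_eq[of x b1] in_span_2 diff_eq_eq) (simp add: ac_simps)

subsection \<open>Traces\<close>

text \<open>
  \<^const>\<open>trace_on\<close> refers to an unspecified basis. That choice is immaterial: writing each basis in the other one
  expresses both traces as the same double sum.
\<close>

lemma trace_on_eq:
  fixes V :: "'b::euclidean_space set"
  assumes C: "independent C" "span C = V"
    and L: "linear L" and LV: "\<And>v. v \<in> V \<Longrightarrow> L v \<in> V" and l: "\<And>v. v \<in> V \<Longrightarrow> l v = L v"
  shows "trace_on V l = (\<Sum>c\<in>C. representation C (L c) c)"
proof -
  define B where "B = (SOME B. independent B \<and> span B = V)"
  have B: "independent B" "span B = V"
    using someI_ex[of "\<lambda>B. independent B \<and> span B = V"] C unfolding B_def by blast+
  have fin: "finite B" "finite C" using B(1) C(1) independent_imp_finite by blast+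
  have inV: "b \<in> V" if "b \<in> B \<or> b \<in> C" for b using that B(2) C(2) span_base by blast
  have "trace_on V l = (\<Sum>b\<in>B. representation B (L b) b)"
    unfolding trace_on_def B_def[symmetric] Let_def using l inV by (intro sum.cong) auto
  also have "\<dots> = (\<Sum>b\<in>B. \<Sum>c\<in>C. representation C b c * representation B (L c) b)"
  proof (rule sum.cong[OF refl])
    fix b assume b: "b \<in> B"
    have "L b = L (\<Sum>c\<in>C. representation C b c *\<^sub>R c)"
      using sum_representation_eq[OF C(1) _ fin(2)] inV b C(2) by simp
    also have "\<dots> = (\<Sum>c\<in>C. representation C b c *\<^sub>R L c)"
      by (simp add: linear_sum[OF L] linear_scale[OF L])
    also have "representation B \<dots> b = (\<Sum>c\<in>C. representation B (representation C b c *\<^sub>R L c) b)"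
      using B inV LV by (subst representation_sum) (auto simp: span_scale)
    also have "\<dots> = (\<Sum>c\<in>C. representation C b c * representation B (L c) b)"
      using B inV LV by (intro sum.cong) (auto simp: representation_scale)
    finally show "representation B (L b) b = \<dots>" .
  qed
  also have "\<dots> = (\<Sum>c\<in>C. \<Sum>b\<in>B. representation B (L c) b * representation C b c)"
    by (subst sum.swap) (simp add: mult.commute)
  also have "\<dots> = (\<Sum>c\<in>C. representation C (L c) c)"
  proof (rule sum.cong[OF refl])
    fix c assume c: "c \<in> C"
    have "L c = (\<Sum>b\<in>B. representation B (L c) b *\<^sub>R b)"
      using sum_representation_eq[OF B(1) _ fin(1)] inV LV c B(2) by simp
    then have "representation C (L c) c = representation C (\<Sum>b\<in>B. representation B (L c) b *\<^sub>R b) c"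
      by simp
    also have "\<dots> = (\<Sum>b\<in>B. representation C (representation B (L c) b *\<^sub>R b) c)"
      using C inV by (subst representation_sum) (auto simp: span_scale)
    also have "\<dots> = (\<Sum>b\<in>B. representation B (L c) b * representation C b c)"
      using C inV by (intro sum.cong) (auto simp: representation_scale)
    finally show "(\<Sum>b\<in>B. representation B (L c) b * representation C b c) = representation C (L c) c" by simp
  qed
  finally show ?thesis .
qed

lemma trace_on_offdiagonal:
  fixes V :: "'b::euclidean_space set"
  assumes V: "V = span {v, w}" "\<And>x y. x *\<^sub>R v + y *\<^sub>R w = 0 \<Longrightarrow> x = 0 \<and> y = 0"
    and l: "\<And>x y. l (x *\<^sub>R v + y *\<^sub>R w) = x *\<^sub>R r *\<^sub>R w + y *\<^sub>R s *\<^sub>R v"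
  shows "trace_on V l = 0"
proof -
  have vw: "v \<noteq> w" using V(2)[of 1 "-1"] by auto
  have "v \<noteq> k *\<^sub>R w" for k using V(2)[of 1 "- k"] by auto
  then have "v \<notin> span {w}" by (auto simp: span_singleton)
  moreover have "w \<noteq> 0" using V(2)[of 0 1] by auto
  ultimately have ind: "independent {v, w}" by (simp add: independent_insert vw)
  obtain L where L: "linear L" "L v = r *\<^sub>R w" "L w = s *\<^sub>R v"
    using linear_independent_extend[OF ind, of "\<lambda>u. if u = v then r *\<^sub>R w else s *\<^sub>R v"] vw by auto
  have mem: "\<exists>x y. u = x *\<^sub>R v + y *\<^sub>R w" if "u \<in> V" for u
    using that unfolding V(1) in_span_2 .
  have lL: "l u = L u" if "u \<in> V" for u
    using mem[OF that] l L by (auto simp: linear_add linear_scale)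
  have LV: "L u \<in> V" if "u \<in> V" for u
    using mem[OF that] L V(1) by (auto simp: linear_add linear_scale span_add span_scale span_base)
  have "representation {v, w} (r *\<^sub>R w) v = 0" "representation {v, w} (s *\<^sub>R v) w = 0"
    using ind vw by (auto simp: representation_scale span_base representation_basis)
  then show ?thesis
    using trace_on_eq[OF ind V(1)[symmetric] L(1) LV lL] vw L by simp
qed

subsection \<open>The inner product and the exterior square\<close>

lemma bounded_bilinear_ip: "bounded_bilinear ip"
  using bilinear_ip bilinear_conv_bounded_bilinear by blast

interpretation ip: bounded_bilinear ip by (rule bounded_bilinear_ip)

lemma ip_commute: "ip x y = ip y x"
  by (simp add: ip_def inner_commute)

lemmas ip_simps = ip.add_left ip.add_right ip.diff_left ip.diff_right ip.scaleR_left ip.scaleR_right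
  ip.minus_left ip.minus_right ip.zero_left ip.zero_right

lemma ip_nondegenerate:
  assumes "\<And>y. ip x y = 0"
  shows "x = 0"
proof -
  have "ip x (fst x, - snd x) = 0" by (rule assms)
  then have "fst x \<bullet> fst x + snd x \<bullet> snd x = 0" by (simp add: ip_def)
  then show ?thesis by (simp add: add_nonneg_eq_0_iff prod_eq_iff)
qed

lemma wedge_apply: "blinfun_apply (wedge a b) c = ip a c *\<^sub>R b - ip b c *\<^sub>R a"
  by (simp add: wedge.rep_eq)

lemma wedge_self [simp]: "wedge a a = 0"
  by (rule blinfun_eqI) (simp add: wedge_apply)

lemma wedge_swap: "wedge a b = - wedge b a"
  by (rule blinfun_eqI) (simp add: wedge_apply blinfun.minus_left)

lemma bounded_bilinear_wedge: "bounded_bilinear wedge"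
proof -
  have "bilinear wedge"
    unfolding bilinear_def
    by (intro conjI allI linearI blinfun_eqI)
      (simp_all add: wedge_apply ip_simps blinfun.add_left blinfun.scaleR_left scaleR_add_left
        scaleR_add_right scaleR_diff_right del: scaleR_Pair)
  then show ?thesis using bilinear_conv_bounded_bilinear by blast
qed

interpretation wedge: bounded_bilinear wedge by (rule bounded_bilinear_wedge)

lemma wedge_skew: "ip (blinfun_apply (wedge a b) c) d = - ip c (blinfun_apply (wedge a b) d)"
  by (simp add: wedge_apply ip_simps ip_commute)

lemma wedge_span_skew:
  assumes "B \<in> wedge_span V W"
  shows "ip (blinfun_apply B c) d = - ip c (blinfun_apply B d)"
  using assms unfolding wedge_span_def
  by (induction rule: span_induct_alt)
    (auto simp: ip_simps blinfun.add_left blinfun.scaleR_left wedge_skew algebra_simps)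

lemma wedge_in_wedge_span: "a \<in> V \<Longrightarrow> b \<in> W \<Longrightarrow> wedge a b \<in> wedge_span V W"
  unfolding wedge_span_def by (intro span_base) blast

lemma subspace_wedge_span: "subspace (wedge_span V W)"
  unfolding wedge_span_def by (rule subspace_span)

lemma wedge_span_eq_0:
  assumes "B \<in> wedge_span V W"
    and "\<And>a b. a \<in> V \<Longrightarrow> b \<in> W \<Longrightarrow> ip a c * ip b d = 0 \<and> ip b c * ip a d = 0"
  shows "ip (blinfun_apply B c) d = 0"
  using assms(1) unfolding wedge_span_def
proof (induction rule: span_induct_alt)
  case (step r B D)
  then obtain a b where "a \<in> V" "b \<in> W" "B = wedge a b" by blast
  then have "ip (blinfun_apply B c) d = 0"
    using assms(2)[of a b] by (simp only: wedge_apply ip_simps) auto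
  then show ?case using step by (simp add: blinfun.add_left blinfun.scaleR_left ip_simps)
qed (simp add: ip_simps)

lemma perp_span: "perp (span V) = perp V"
proof -
  have "ip x y = 0" if "y \<in> perp V" "x \<in> span V" for x y
    using that(2,1) by (induction rule: span_induct_alt) (auto simp: ip_simps perp_def)
  then show ?thesis by (auto simp: perp_def span_base)
qed

text \<open>
  A subspace of null vectors has dimension at most 2: the projection to the negative definite factor
  \<open>\<real>\<^sup>2\<close> is injective on it. So isotropic planes are maximal among the spaces of null vectors.
\<close>

lemma null_perp_isotropic:
  assumes f: "subspace f" "dim f = 2" "isotropic f" and v: "v \<in> perp f" "ip v v = 0"
  shows "v \<in> f"
proof (rule ccontr)
  assume vf: "v \<notin> f"
  have spanf: "span f = f" using f(1) by (simp add: span_eq_iff)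
  have null: "ip w w = 0" if w: "w \<in> span (insert v f)" for w
  proof -
    obtain k where "w - k *\<^sub>R v \<in> f"
      using w unfolding span_breakdown_eq spanf by blast
    then obtain u where u: "u \<in> f" "w = u + k *\<^sub>R v" by (metis diff_add_cancel)
    have "ip u u = 0" "ip u v = 0" using u f(3) v by (auto simp: isotropic_def perp_def)
    then show ?thesis using v(2) u(2) ip_commute[of v u] by (simp add: ip_simps)
  qed
  have "v \<notin> span f" using vf spanf by blast
  then have "dim (span (insert v f)) = 3"
    using f(2) by (simp add: dim_insert)
  moreover have "dim (snd ` span (insert v f) :: (real^2) set) \<le> 2"
    using dim_subset_UNIV[of "snd ` span (insert v f) :: (real^2) set"] by simp
  moreover have "inj_on snd (span (insert v f))"
  proof (rule inj_onI)
    fix w w' assume w: "w \<in> span (insert v f)" "w' \<in> span (insert v f)" "snd w = snd w'"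
    then have "ip (w - w') (w - w') = 0" using null span_diff by blast
    then have "fst w = fst w'" using w(3) by (simp add: ip_def)
    then show "w = w'" using w(3) by (simp add: prod_eq_iff)
  qed
  then have "dim (snd ` span (insert v f) :: (real^2) set) = dim (span (insert v f))"
    by (intro dim_image_eq) (simp_all only: span_span linear_snd)
  ultimately show False by simp
qed

subsection \<open>Splittings of the exterior square\<close>

text \<open>
  \<^const>\<open>mixed_component\<close> is a definite description; the aim here is that it denotes, for complementary \<open>S\<close> and \<open>T\<close>.
\<close>

lemma complement_projection:
  assumes S: "subspace S" "subspace T" and disj: "\<And>v. v \<in> S \<Longrightarrow> v \<in> T \<Longrightarrow> v = 0"
    and cover: "\<And>v. \<exists>x\<in>S. \<exists>y\<in>T. v = x + y"
  obtains \<pi> where "linear \<pi>" "\<And>x. x \<in> S \<Longrightarrow> \<pi> x = x" "\<And>y. y \<in> T \<Longrightarrow> \<pi> y = 0"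
proof -
  have "\<exists>x. x \<in> S \<and> v - x \<in> T" for v using cover[of v] by auto
  then obtain \<pi> where \<pi>: "\<And>v. \<pi> v \<in> S" "\<And>v. v - \<pi> v \<in> T" by metis
  have uniq: "\<pi> v = x" if "x \<in> S" "v - x \<in> T" for v x
  proof -
    have "\<pi> v - x = (v - x) - (v - \<pi> v)" by simp
    then have "\<pi> v - x \<in> T" using \<pi>(2)[of v] that(2) subspace_diff[OF S(2)] by metis
    then show ?thesis using disj[of "\<pi> v - x"] subspace_diff[OF S(1) \<pi>(1) that(1)] by simp
  qed
  have "linear \<pi>"
  proof (rule linearI)
    fix v w
    have "(v + w) - (\<pi> v + \<pi> w) = (v - \<pi> v) + (w - \<pi> w)" by simp
    then show "\<pi> (v + w) = \<pi> v + \<pi> w"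
      using \<pi> S by (intro uniq) (simp_all only: subspace_add)
  next
    fix r v
    have "r *\<^sub>R v - r *\<^sub>R \<pi> v = r *\<^sub>R (v - \<pi> v)" by (simp add: scaleR_diff_right)
    then show "\<pi> (r *\<^sub>R v) = r *\<^sub>R \<pi> v"
      using \<pi> by (intro uniq) (auto intro: subspace_scale S)
  qed
  moreover have "\<pi> x = x" if "x \<in> S" for x using that subspace_0[OF S(2)] by (intro uniq) auto
  moreover have "\<pi> y = 0" if "y \<in> T" for y using that subspace_0[OF S(1)] by (intro uniq) auto
  ultimately show ?thesis using that by blast
qed

context
  fixes S T :: "R42 set"
  assumes subsp: "subspace S" "subspace T" and disjoint: "\<And>v. v \<in> S \<Longrightarrow> v \<in> T \<Longrightarrow> v = 0"
    and cover: "\<And>v. \<exists>x\<in>S. \<exists>y\<in>T. v = x + y"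
begin

text \<open>The dual splitting; it is the transpose of the projections onto \<open>S\<close> and \<open>T\<close>.\<close>

lemma perp_splitting: "\<exists>x\<in>perp T. \<exists>y\<in>perp S. v = x + y"
proof -
  obtain \<pi> where \<pi>: "linear \<pi>" "\<And>x. x \<in> S \<Longrightarrow> \<pi> x = x" "\<And>y. y \<in> T \<Longrightarrow> \<pi> y = 0"
    using complement_projection[OF subsp disjoint cover] by metis
  define J :: "R42 \<Rightarrow> R42" where "J w = (fst w, - snd w)" for w
  have J: "ip w x = J w \<bullet> x" "J (J w) = w" for w x
    by (simp_all add: J_def ip_def inner_prod_def)
  define x where "x = J (adjoint \<pi> (J v))"
  have x: "ip x w = ip v (\<pi> w)" for w
    using adjoint_works[OF \<pi>(1), of w "J v"] by (simp add: J x_def inner_commute)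
  have "x \<in> perp T" using \<pi>(3) x by (simp add: perp_def ip_commute[of _ x] ip_simps)
  moreover have "v - x \<in> perp S"
    using \<pi>(2) x by (simp add: perp_def ip_commute[of _ v] ip_commute[of _ x] ip_simps)
  ultimately show ?thesis by (intro bexI[of _ x] bexI[of _ "v - x"]) auto
qed

text \<open>
  As bilinear forms, elements of \<open>S \<and> T\<close> vanish on \<open>S\<^sup>\<bottom> \<times> S\<^sup>\<bottom>\<close> and \<open>T\<^sup>\<bottom> \<times> T\<^sup>\<bottom>\<close>, whereas those of \<open>\<and>\<^sup>2S + \<and>\<^sup>2T\<close>
  vanish on \<open>S\<^sup>\<bottom> \<times> T\<^sup>\<bottom>\<close>. By the dual splitting these blocks exhaust everything.
\<close>

lemma wedge_span_splitting_disjoint: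
  assumes C: "C \<in> wedge_span S T" "C \<in> span (wedge_span S S \<union> wedge_span T T)"
  shows "C = 0"
proof (rule blinfun_eqI)
  fix c
  have mixed: "ip (blinfun_apply C x) y = 0"
    if "(x \<in> perp S \<and> y \<in> perp S) \<or> (x \<in> perp T \<and> y \<in> perp T)" for x y
    using that by (intro wedge_span_eq_0[OF C(1)]) (auto simp: perp_def)
  have pure: "ip (blinfun_apply C x) y = 0"
    if xy: "(x \<in> perp S \<and> y \<in> perp T) \<or> (x \<in> perp T \<and> y \<in> perp S)" for x y
    using C(2)
  proof (induction rule: span_induct_alt)
    case (step r B D)
    have "ip (blinfun_apply B x) y = 0"
      using step(1) xy by (auto simp: perp_def elim!: wedge_span_eq_0)
    then show ?case using step by (simp add: blinfun.add_left blinfun.scaleR_left ip_simps)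
  qed (simp add: ip_simps)
  have "ip (blinfun_apply C c) d = 0" for d
  proof -
    obtain c1 c2 d1 d2 where "c1 \<in> perp T" "c2 \<in> perp S" "c = c1 + c2"
      "d1 \<in> perp T" "d2 \<in> perp S" "d = d1 + d2"
      using perp_splitting[of c] perp_splitting[of d] by blast
    then show ?thesis
      using mixed[of c1 d1] mixed[of c2 d2] pure[of c1 d2] pure[of c2 d1]
      by (simp add: ip_simps blinfun.add_right)
  qed
  then show "blinfun_apply C c = blinfun_apply 0 c"
    using ip_nondegenerate by (simp add: ip_commute)
qed

lemma mixed_component_eq:
  assumes "C \<in> wedge_span S T" "B - C \<in> span (wedge_span S S \<union> wedge_span T T)"
  shows "mixed_component S T B = C"
  unfolding mixed_component_def
proof (rule the_equality)
  fix D assume D: "D \<in> wedge_span S T \<and> B - D \<in> span (wedge_span S S \<union> wedge_span T T)"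
  have "D - C = (B - C) - (B - D)" by simp
  then have "D - C \<in> span (wedge_span S S \<union> wedge_span T T)"
    using assms D span_diff by metis
  moreover have "D - C \<in> wedge_span S T"
    using assms D subspace_diff subspace_wedge_span by blast
  ultimately show "D = C" using wedge_span_splitting_disjoint by force
qed (use assms in blast)

end

subsection \<open>Frames adapted to a pair of complementary three-dimensional subspaces\<close>

text \<open>
  The model case is \<open>a\<^sub>i = \<sigma>\<^sub>i\<close>, \<open>u\<^sub>1 = d\<^sub>Y \<sigma>\<^sub>1\<close>, \<open>w\<^sub>1 = d\<^sub>Y d\<^sub>Y \<sigma>\<^sub>1\<close>, \<open>u\<^sub>2 = d\<^sub>X \<sigma>\<^sub>2\<close>, \<open>w\<^sub>2 = d\<^sub>X d\<^sub>X \<sigma>\<^sub>2\<close>. Of the inner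
  products involving \<open>w\<^sub>1\<close> and \<open>w\<^sub>2\<close> only those with \<open>a\<^sub>1\<close> and \<open>a\<^sub>2\<close> are prescribed: they suffice for the six
  vectors to form a basis.
\<close>

locale adapted_frame =
  fixes a1 a2 u1 u2 w1 w2 :: R42
  assumes ip_a: "ip a1 a1 = 0" "ip a1 a2 = 0" "ip a2 a2 = 0"
    and ip_au: "ip a1 u1 = 0" "ip a1 u2 = 0" "ip a2 u1 = 0" "ip a2 u2 = 0"
    and ip_u: "ip u1 u1 \<noteq> 0" "ip u2 u2 \<noteq> 0" "ip u1 u2 = 0"
    and ip_aw: "ip a1 w1 \<noteq> 0" "ip a2 w2 \<noteq> 0" "ip a1 w2 = 0" "ip a2 w1 = 0"
    and independent_a: "\<And>x y. x *\<^sub>R a1 + y *\<^sub>R a2 = 0 \<Longrightarrow> x = 0 \<and> y = 0"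
begin

lemmas ip_frame = ip_a ip_au ip_u ip_aw
  ip_a[unfolded ip_commute[of a1 a2]] ip_au[unfolded ip_commute[of _ u1] ip_commute[of _ u2]]
  ip_u(3)[unfolded ip_commute[of u1]] ip_aw[unfolded ip_commute[of _ w1] ip_commute[of _ w2]]

text \<open>
  Pairing a linear relation with \<open>a\<^sub>1, a\<^sub>2\<close> removes the \<open>w\<^sub>i\<close>; pairing what is left with \<open>u\<^sub>1, u\<^sub>2\<close> removes the \<open>u\<^sub>i\<close>.
\<close>

lemma independent_frame:
  assumes zero: "x1 *\<^sub>R a1 + y1 *\<^sub>R u1 + z1 *\<^sub>R w1 + (x2 *\<^sub>R a2 + y2 *\<^sub>R u2 + z2 *\<^sub>R w2) = 0" (is "?v = 0")
  shows "x1 = 0" "y1 = 0" "z1 = 0" "x2 = 0" "y2 = 0" "z2 = 0"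
proof -
  have ip0: "ip b ?v = 0" for b unfolding zero by (simp add: ip_simps)
  from ip0[of a1] ip0[of a2] show z: "z1 = 0" "z2 = 0" by (simp_all add: ip_simps ip_frame)
  from ip0[of u1] ip0[of u2] show y: "y1 = 0" "y2 = 0" by (simp_all add: ip_simps ip_frame z)
  show "x1 = 0" "x2 = 0" using independent_a[of x1 x2] zero by (simp_all add: y z)
qed

lemma frame_expansion:
  obtains x1 y1 z1 x2 y2 z2 where
    "v = x1 *\<^sub>R a1 + y1 *\<^sub>R u1 + z1 *\<^sub>R w1 + (x2 *\<^sub>R a2 + y2 *\<^sub>R u2 + z2 *\<^sub>R w2)"
proof -
  \<comment> \<open>The frame has six members, so the space of its coefficients may be taken to be \<open>\<real>\<^sup>4\<^sup>,\<^sup>2\<close> itself.\<close>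
  define T :: "R42 \<Rightarrow> R42" where "T c = (fst c $ 1) *\<^sub>R a1 + (fst c $ 2) *\<^sub>R u1 + (fst c $ 3) *\<^sub>R w1 +
    ((fst c $ 4) *\<^sub>R a2 + (snd c $ 1) *\<^sub>R u2 + (snd c $ 2) *\<^sub>R w2)" for c
  have lin: "linear T"
    by (rule linearI) (simp_all add: T_def scaleR_add_right scaleR_add_left)
  have "c = 0" if "T c = 0" for c
    using independent_frame[OF that[unfolded T_def]] by (simp add: prod_eq_iff vec_eq_iff forall_2 forall_4)
  then have "inj T" using linear_injective_0[OF lin] by blast
  then have "surj T" using linear_injective_imp_surjective lin by blast
  then obtain c where "v = T c" by blast
  then show ?thesis using that unfolding T_def by blast
qed

abbreviation "S1 \<equiv> span {a1, u1, w1}"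
abbreviation "S2 \<equiv> span {a2, u2, w2}"

lemma S1_S2_disjoint:
  assumes "v \<in> S1" "v \<in> S2"
  shows "v = 0"
proof -
  obtain r s t r' s' t' where v: "v = r *\<^sub>R a1 + s *\<^sub>R u1 + t *\<^sub>R w1"
    "v = r' *\<^sub>R a2 + s' *\<^sub>R u2 + t' *\<^sub>R w2"
    using assms unfolding in_span_3 by blast
  have "r *\<^sub>R a1 + s *\<^sub>R u1 + t *\<^sub>R w1 + ((- r') *\<^sub>R a2 + (- s') *\<^sub>R u2 + (- t') *\<^sub>R w2) = v - v"
    by (subst (1) v(1), subst v(2)) simp
  then have "r = 0" "s = 0" "t = 0"
    using independent_frame[of r s t "- r'" "- s'" "- t'"] by simp_all
  then show ?thesis using v(1) by simp
qed

lemma S1_S2_cover: "\<exists>x\<in>S1. \<exists>y\<in>S2. v = x + y"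
proof (rule frame_expansion[of v])
  fix x1 y1 z1 x2 y2 z2
  assume v: "v = x1 *\<^sub>R a1 + y1 *\<^sub>R u1 + z1 *\<^sub>R w1 + (x2 *\<^sub>R a2 + y2 *\<^sub>R u2 + z2 *\<^sub>R w2)"
  then show ?thesis unfolding v by (intro bexI) (auto simp: in_span_3)
qed

lemma perp_a_expansion:
  assumes "ip v a1 = 0" "ip v a2 = 0"
  obtains x1 y1 x2 y2 where "v = x1 *\<^sub>R a1 + y1 *\<^sub>R u1 + x2 *\<^sub>R a2 + y2 *\<^sub>R u2"
proof -
  obtain x1 y1 z1 x2 y2 z2 where v:
    "v = x1 *\<^sub>R a1 + y1 *\<^sub>R u1 + z1 *\<^sub>R w1 + (x2 *\<^sub>R a2 + y2 *\<^sub>R u2 + z2 *\<^sub>R w2)"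
    by (rule frame_expansion)
  have "z1 = 0" "z2 = 0"
    using assms ip_frame unfolding v by (simp_all add: ip_simps)
  then show ?thesis using that v by (simp add: algebra_simps)
qed

lemma perp_a_u_imp_in_span_a:
  assumes "ip v a1 = 0" "ip v a2 = 0" "ip v u1 = 0" "ip v u2 = 0"
  obtains x y where "v = x *\<^sub>R a1 + y *\<^sub>R a2"
proof -
  obtain x1 y1 x2 y2 where v: "v = x1 *\<^sub>R a1 + y1 *\<^sub>R u1 + x2 *\<^sub>R a2 + y2 *\<^sub>R u2"
    using perp_a_expansion[OF assms(1,2)] .
  have "y1 = 0" "y2 = 0"
    using assms(3,4) ip_frame unfolding v by (simp_all add: ip_simps)
  then show ?thesis using that v by simp
qed

lemma in_perp_a: "x \<in> perp (span {a1, a2}) \<longleftrightarrow> ip x a1 = 0 \<and> ip x a2 = 0"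
  unfolding perp_span by (auto simp: perp_def ip_commute)

lemma wedge_span_a_expansion:
  assumes "B \<in> wedge_span (span {a1, a2}) (perp (span {a1, a2}))"
  obtains c p1 p2 q1 q2 where "B = c *\<^sub>R wedge a1 a2 + p1 *\<^sub>R wedge a1 u1 + p2 *\<^sub>R wedge a1 u2 +
    q1 *\<^sub>R wedge a2 u1 + q2 *\<^sub>R wedge a2 u2"
proof -
  define Q where "Q B \<longleftrightarrow> (\<exists>c p1 p2 q1 q2. B = c *\<^sub>R wedge a1 a2 + p1 *\<^sub>R wedge a1 u1 +
    p2 *\<^sub>R wedge a1 u2 + q1 *\<^sub>R wedge a2 u1 + q2 *\<^sub>R wedge a2 u2)" for B
  have QI: "Q (c *\<^sub>R wedge a1 a2 + p1 *\<^sub>R wedge a1 u1 + p2 *\<^sub>R wedge a1 u2 +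
      q1 *\<^sub>R wedge a2 u1 + q2 *\<^sub>R wedge a2 u2)" for c p1 p2 q1 q2
    unfolding Q_def by blast
  have "Q B"
    using assms unfolding wedge_span_def
  proof (induction rule: span_induct_alt)
    case base
    show ?case using QI[of 0 0 0 0 0] by simp
  next
    case (step r B D)
    then obtain a b where ab: "a \<in> span {a1, a2}" "b \<in> perp (span {a1, a2})" "B = wedge a b" by blast
    obtain s t where a: "a = s *\<^sub>R a1 + t *\<^sub>R a2" using ab(1) in_span_2 by blast
    obtain x1 y1 x2 y2 where b: "b = x1 *\<^sub>R a1 + y1 *\<^sub>R u1 + x2 *\<^sub>R a2 + y2 *\<^sub>R u2"
      using perp_a_expansion ab(2) in_perp_a by metis
    obtain c p1 p2 q1 q2 where D: "D = c *\<^sub>R wedge a1 a2 + p1 *\<^sub>R wedge a1 u1 +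
      p2 *\<^sub>R wedge a1 u2 + q1 *\<^sub>R wedge a2 u1 + q2 *\<^sub>R wedge a2 u2"
      using step.IH unfolding Q_def by blast
    have "r *\<^sub>R B + D = (c + r * (s * x2 - t * x1)) *\<^sub>R wedge a1 a2 + (p1 + r * s * y1) *\<^sub>R wedge a1 u1 +
        (p2 + r * s * y2) *\<^sub>R wedge a1 u2 + (q1 + r * t * y1) *\<^sub>R wedge a2 u1 +
        (q2 + r * t * y2) *\<^sub>R wedge a2 u2"
      unfolding ab(3) a b D
      by (simp add: wedge.add_left wedge.add_right wedge.scaleR_left wedge.scaleR_right
          wedge_swap[of a2 a1] algebra_simps)
    then show ?case using QI by metis
  qed
  then show ?thesis using that unfolding Q_def by blast
qed

text \<open>
  An element of \<open>f \<and> f\<^sup>\<bottom>\<close>, for \<open>f = \<langle>a\<^sub>1, a\<^sub>2\<rangle>\<close>, whose mixed component lies in \<open>\<and>\<^sup>2f\<close> involves only the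
  products \<open>a\<^sub>1 \<and> u\<^sub>1\<close> and \<open>a\<^sub>2 \<and> u\<^sub>2\<close> modulo \<open>\<and>\<^sup>2f\<close>: the products \<open>a\<^sub>1 \<and> u\<^sub>2\<close> and \<open>a\<^sub>2 \<and> u\<^sub>1\<close> are mixed.
\<close>

lemma middle_expansion:
  assumes B: "B \<in> wedge_span (span {a1, a2}) (perp (span {a1, a2}))"
    and mid: "mixed_component S1 S2 B \<in> wedge_span (span {a1, a2}) (span {a1, a2})"
  obtains c p q where "B = c *\<^sub>R wedge a1 a2 + p *\<^sub>R wedge a1 u1 + q *\<^sub>R wedge a2 u2"
proof -
  obtain c p1 p2 q1 q2 where Beq: "B = c *\<^sub>R wedge a1 a2 + p1 *\<^sub>R wedge a1 u1 + p2 *\<^sub>R wedge a1 u2 +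
    q1 *\<^sub>R wedge a2 u1 + q2 *\<^sub>R wedge a2 u2"
    using wedge_span_a_expansion[OF B] .
  define C where "C = c *\<^sub>R wedge a1 a2 + p2 *\<^sub>R wedge a1 u2 - q1 *\<^sub>R wedge u1 a2"
  have in12: "a1 \<in> S1" "u1 \<in> S1" "a2 \<in> S2" "u2 \<in> S2" by (auto intro: span_base)
  have "C \<in> wedge_span S1 S2"
    unfolding C_def
    by (intro subspace_diff subspace_add subspace_scale subspace_wedge_span wedge_in_wedge_span in12)
  moreover have "B - C = p1 *\<^sub>R wedge a1 u1 + q2 *\<^sub>R wedge a2 u2"
    unfolding Beq C_def by (simp add: wedge_swap[of u1 a2])
  then have "B - C \<in> span (wedge_span S1 S1 \<union> wedge_span S2 S2)"
    using in12 by (auto intro!: span_add span_scale intro: span_base wedge_in_wedge_span)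
  ultimately have "mixed_component S1 S2 B = C"
    using S1_S2_disjoint S1_S2_cover by (intro mixed_component_eq) auto
  then have Cf: "C \<in> wedge_span (span {a1, a2}) (span {a1, a2})" using mid by simp
  have "ip (blinfun_apply C x) y = 0" if "ip x a1 = 0" "ip x a2 = 0" for x y
    by (rule wedge_span_eq_0[OF Cf]) (use that in \<open>auto simp: in_span_2 ip_simps ip_commute[of _ x]\<close>)
  then have "ip (blinfun_apply C u1) w2 = 0" "ip (blinfun_apply C u2) w1 = 0"
    using ip_frame by auto
  then have "q1 = 0" "p2 = 0"
    using ip_frame unfolding C_def
    by (simp_all add: blinfun.add_left blinfun.diff_left blinfun.scaleR_left wedge_apply ip_simps)
  then show ?thesis using that Beq by simp
qed

end

section \<open>Legendre maps and their curvature spheres\<close>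

definition section_near ::
  "'m::topological_space chart set \<Rightarrow> ('m \<Rightarrow> 'b::real_normed_vector set) \<Rightarrow> 'm \<Rightarrow> ('m \<Rightarrow> 'b) \<Rightarrow> bool" where
  "section_near A W x \<sigma> \<longleftrightarrow> (\<exists>U. x \<in> U \<and> local_section A W U \<sigma>)"

context surface
begin

lemma section_near_iff:
  "section_near A W x \<sigma> \<longleftrightarrow> smooth_near A x \<sigma> \<and> (\<forall>\<^sub>F y in nhds x. \<sigma> y \<in> W y)"
proof
  assume "section_near A W x \<sigma>"
  then show "smooth_near A x \<sigma> \<and> (\<forall>\<^sub>F y in nhds x. \<sigma> y \<in> W y)"
    unfolding section_near_def local_section_def smooth_near_def eventually_nhds by blast
next
  assume "smooth_near A x \<sigma> \<and> (\<forall>\<^sub>F y in nhds x. \<sigma> y \<in> W y)"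
  then obtain U V where UV: "open U" "x \<in> U" "smooth_map_on A U \<sigma>" "open V" "x \<in> V" "\<forall>y\<in>V. \<sigma> y \<in> W y"
    unfolding smooth_near_def eventually_nhds by blast
  then have "local_section A W (U \<inter> V) \<sigma>"
    using smooth_map_on_subset[OF UV(3)] by (auto simp: local_section_def)
  then show "section_near A W x \<sigma>" using UV unfolding section_near_def by blast
qed

lemma section_near_eventually: "section_near A W x \<sigma> \<Longrightarrow> \<forall>\<^sub>F y in nhds x. section_near A W y \<sigma>"
  unfolding section_near_def local_section_def eventually_nhds by blast

lemma section_near_smooth: "section_near A W x \<sigma> \<Longrightarrow> smooth_near A x \<sigma>"
  and section_near_mem: "section_near A W x \<sigma> \<Longrightarrow> \<sigma> x \<in> W x"
  by (auto simp: section_near_iff dest: eventually_nhds_x_imp_x)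

lemma smooth_near_scaleR_const: "smooth_near A x \<sigma> \<Longrightarrow> smooth_near A x (\<lambda>y. r *\<^sub>R \<sigma> y)"
  by (rule smooth_near_linear[OF bounded_linear_scaleR_right])

lemma tder_combination:
  assumes "smooth_near A x \<sigma>" "smooth_near A x \<tau>"
  shows "tder A (\<lambda>y. r *\<^sub>R \<sigma> y + s *\<^sub>R \<tau> y) x X = r *\<^sub>R tder A \<sigma> x X + s *\<^sub>R tder A \<tau> x X"
  using assms by (simp add: tder_add smooth_near_scaleR_const tder_linear[OF bounded_linear_scaleR_right])

lemma section_near_combination:
  assumes "section_near A W x \<sigma>" "section_near A W x \<tau>" "\<And>y. subspace (W y)"
  shows "section_near A W x (\<lambda>y. r *\<^sub>R \<sigma> y + s *\<^sub>R \<tau> y)"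
proof -
  have "\<forall>\<^sub>F y in nhds x. \<sigma> y \<in> W y \<and> \<tau> y \<in> W y"
    using assms(1,2) by (simp add: section_near_iff eventually_conj)
  then have "\<forall>\<^sub>F y in nhds x. r *\<^sub>R \<sigma> y + s *\<^sub>R \<tau> y \<in> W y"
    by eventually_elim (use assms(3) in \<open>auto intro: subspace_add subspace_scale\<close>)
  then show ?thesis
    using assms by (simp add: section_near_iff smooth_near_add smooth_near_scaleR_const)
qed

lemma derivative_of_ip:
  fixes g h :: "'m \<Rightarrow> R42"
  assumes "smooth_near A x g" "smooth_near A x h" "\<forall>\<^sub>F y in nhds x. ip (g y) (h y) = 0"
  shows "ip (g x) (tder A h x X) + ip (tder A g x X) (h x) = 0"
  using tder_bilinear[OF bounded_bilinear_ip assms(1,2), of X] tder_transform[OF assms(3), of X] by simp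

text \<open>In a chart, \<open>r\<close> and \<open>s\<close> are given by Cramer's rule.\<close>

lemma tangent_space_basis:
  assumes Z: "Z \<in> tangent_space A x" and W: "W \<in> tangent_space A x"
    and ind: "Z \<noteq> 0" "\<And>k. W \<noteq> k *\<^sub>R Z" and Y: "Y \<in> tangent_space A x"
  obtains r s where "Y = r *\<^sub>R Z + s *\<^sub>R W"
proof -
  obtain c where c: "c \<in> A" "x \<in> fst c" using obtain_chart .
  let ?z = "Z c" and ?w = "W c" and ?y = "Y c"
  note sub = subspace_tangent_space[of x]
  have z0: "?z \<noteq> 0"
    using tangent_space_eqI[OF Z subspace_0[OF sub] c] ind(1) by auto
  have wk: "?w \<noteq> k *\<^sub>R ?z" for k
    using tangent_space_eqI[OF W subspace_scale[OF sub Z] c, of k] ind(2)[of k] by (auto simp: scaleR_fun_def)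
  define D where "D = ?z $ 1 * ?w $ 2 - ?z $ 2 * ?w $ 1"
  have "D \<noteq> 0"
  proof
    assume D: "D = 0"
    show False
    proof (cases "?z $ 1 = 0")
      case True
      then have "?z $ 2 \<noteq> 0" using z0 by (auto simp: vec_eq_iff forall_2)
      then have "?w = (?w $ 2 / ?z $ 2) *\<^sub>R ?z"
        using D True by (auto simp: D_def vec_eq_iff forall_2)
      then show False using wk by blast
    next
      case False
      then have "?w = (?w $ 1 / ?z $ 1) *\<^sub>R ?z"
        using D by (auto simp: D_def vec_eq_iff forall_2 field_simps)
      then show False using wk by blast
    qed
  qed
  define r s where "r = (?y $ 1 * ?w $ 2 - ?y $ 2 * ?w $ 1) / D"
    and "s = (?z $ 1 * ?y $ 2 - ?z $ 2 * ?y $ 1) / D"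
  have "D * (?y $ i) = D * (r * ?z $ i + s * ?w $ i)" if "i = 1 \<or> i = 2" for i
  proof -
    have "D * r = ?y $ 1 * ?w $ 2 - ?y $ 2 * ?w $ 1" "D * s = ?z $ 1 * ?y $ 2 - ?z $ 2 * ?y $ 1"
      using \<open>D \<noteq> 0\<close> by (simp_all add: r_def s_def)
    then have "D * (r * ?z $ i + s * ?w $ i) =
        (?y $ 1 * ?w $ 2 - ?y $ 2 * ?w $ 1) * ?z $ i + (?z $ 1 * ?y $ 2 - ?z $ 2 * ?y $ 1) * ?w $ i"
      by (simp only: distrib_left mult.assoc[symmetric])
    then show ?thesis using that unfolding D_def by (auto simp: algebra_simps)
  qed
  then have "?y = r *\<^sub>R ?z + s *\<^sub>R ?w"
    using \<open>D \<noteq> 0\<close> by (simp add: vec_eq_iff forall_2)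
  then have "Y c = (r *\<^sub>R Z + s *\<^sub>R W) c"
    by (simp only: scaleR_fun_def plus_fun_def)
  moreover have "r *\<^sub>R Z + s *\<^sub>R W \<in> tangent_space A x"
    using subspace_add[OF sub subspace_scale[OF sub Z] subspace_scale[OF sub W]] .
  ultimately have "Y = r *\<^sub>R Z + s *\<^sub>R W"
    using tangent_space_eqI[OF Y _ c] by blast
  then show ?thesis using that by blast
qed

end

locale legendre = surface A
  for A :: "'m::{t2_space,second_countable_topology} chart set" +
  fixes f :: "'m \<Rightarrow> R42 set"
  assumes legendre_map: "legendre_map A f"
begin

lemma subbundle_f: "smooth_subbundle A 2 f"
  and isotropic_f: "isotropic (f x)"
  and derived_bundle_f: "derived_bundle A f x \<subseteq> perp (f x)"
  using legendre_map by (simp_all add: legendre_map_def)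

lemma subspace_f: "subspace (f x)" and dim_f: "dim (f x) = 2"
  using subbundle_f by (simp_all add: smooth_subbundle_def)

lemma ip_f: "v \<in> f x \<Longrightarrow> w \<in> f x \<Longrightarrow> ip v w = 0"
  using isotropic_f unfolding isotropic_def by blast

lemma tder_perp_f:
  assumes "section_near A f x \<sigma>" "X \<in> tangent_space A x"
  shows "tder A \<sigma> x X \<in> perp (f x)"
proof -
  have "tder A \<sigma> x X \<in> derived_bundle A f x"
    using assms unfolding section_near_def derived_bundle_def by (intro span_base) blast
  then show ?thesis using derived_bundle_f by blast
qed

lemma ip_f_tder:
  assumes "section_near A f x \<sigma>" "X \<in> tangent_space A x" "v \<in> f x"
  shows "ip v (tder A \<sigma> x X) = 0"
  using tder_perp_f[OF assms(1,2)] assms(3) by (simp add: perp_def)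

lemma null_tder_in_f:
  assumes "section_near A f x \<sigma>" "X \<in> tangent_space A x" "ip (tder A \<sigma> x X) (tder A \<sigma> x X) = 0"
  shows "tder A \<sigma> x X \<in> f x"
  using null_perp_isotropic[OF subspace_f dim_f isotropic_f tder_perp_f[OF assms(1,2)] assms(3)] .

lemma eventually_ip_tder:
  assumes "section_near A f x \<sigma>" "section_near A f x \<tau>" "vector_field_near A x Y"
  shows "\<forall>\<^sub>F y in nhds x. ip (\<sigma> y) (tder A \<tau> y (Y y)) = 0"
  using section_near_eventually[OF assms(1)] section_near_eventually[OF assms(2)]
    vector_field_near_tangent[OF assms(3)]
  by eventually_elim (blast intro: ip_f_tder section_near_mem)

text \<open>
  Hence the derivatives of sections modulo \<open>f\<close> are tensorial: differentiating \<open>(\<sigma>, d\<^sub>X \<sigma>) = 0\<close> at a zero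
  of \<open>\<sigma>\<close> shows that \<open>d\<^sub>X \<sigma>\<close> is a null vector of \<open>f\<^sup>\<bottom>\<close>.
\<close>

lemma tder_vanishing_section:
  assumes \<sigma>: "section_near A f x \<sigma>" and X: "X \<in> tangent_space A x" and zero: "\<sigma> x = 0"
  shows "tder A \<sigma> x X \<in> f x"
proof (rule null_tder_in_f[OF \<sigma> X])
  obtain c where c: "c \<in> A" "x \<in> fst c" using obtain_chart .
  define E where "E = coord_tvec A c (X c)"
  have E: "vector_field_near A x E" "E x = X"
    using vector_field_near_coord[OF c] tangent_space_eq_coord_tvec[OF X c] by (auto simp: E_def)
  have sm: "smooth_near A x \<sigma>" using section_near_smooth[OF \<sigma>] .
  show "ip (tder A \<sigma> x X) (tder A \<sigma> x X) = 0"
    using derivative_of_ip[OF sm smooth_near_tder[OF sm E(1)] eventually_ip_tder[OF \<sigma> \<sigma> E(1)], of X]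
    by (simp add: zero E(2) ip.zero_left)
qed

lemma tder_tensorial:
  assumes "section_near A f x \<sigma>" "section_near A f x \<sigma>1" "section_near A f x \<sigma>2"
    and X: "X \<in> tangent_space A x" and eq: "\<sigma> x = r *\<^sub>R \<sigma>1 x + s *\<^sub>R \<sigma>2 x"
  shows "tder A \<sigma> x X - (r *\<^sub>R tder A \<sigma>1 x X + s *\<^sub>R tder A \<sigma>2 x X) \<in> f x"
proof -
  let ?\<tau> = "\<lambda>y. r *\<^sub>R \<sigma>1 y + s *\<^sub>R \<sigma>2 y"
  let ?\<rho> = "\<lambda>y. 1 *\<^sub>R \<sigma> y + (- 1) *\<^sub>R ?\<tau> y"
  have \<tau>: "section_near A f x ?\<tau>" using assms subspace_f by (intro section_near_combination)
  have "tder A ?\<rho> x X \<in> f x"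
    using eq by (intro tder_vanishing_section[OF _ X] section_near_combination[OF assms(1) \<tau> subspace_f]) simp
  moreover have "tder A ?\<rho> x X = tder A \<sigma> x X - (r *\<^sub>R tder A \<sigma>1 x X + s *\<^sub>R tder A \<sigma>2 x X)"
    using assms(1-3) \<tau> unfolding tder_combination[OF section_near_smooth[OF assms(1)] section_near_smooth[OF \<tau>]]
    by (simp add: tder_combination section_near_smooth)
  ultimately show ?thesis by simp
qed

lemma immersion:
  assumes X: "X \<in> tangent_space A x" and "\<And>\<sigma>. section_near A f x \<sigma> \<Longrightarrow> tder A \<sigma> x X \<in> f x"
  shows "X = 0"
proof -
  have "\<forall>x. \<forall>X\<in>tangent_space A x.
      (\<forall>U \<sigma>. x \<in> U \<longrightarrow> local_section A f U \<sigma> \<longrightarrow> tder A \<sigma> x X \<in> f x) \<longrightarrow> X = 0"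
    using legendre_map unfolding legendre_map_def by (elim conjE)
  from this[rule_format, OF X] show ?thesis using assms(2) unfolding section_near_def by blast
qed

text \<open>
  For sections of \<open>f\<close> the pairing \<open>(d\<^sub>V \<sigma>, d\<^sub>W \<tau>) = - (\<sigma>, d\<^sub>V d\<^sub>W \<tau>)\<close> is symmetric in \<open>V\<close> and \<open>W\<close>, as second
  derivatives along coordinate fields commute.
\<close>

lemma ip_tder_symmetric:
  assumes \<sigma>: "section_near A f x \<sigma>" and \<tau>: "section_near A f x \<tau>"
    and V: "V \<in> tangent_space A x" and W: "W \<in> tangent_space A x"
  shows "ip (tder A \<sigma> x V) (tder A \<tau> x W) = ip (tder A \<sigma> x W) (tder A \<tau> x V)"
proof -
  obtain c where c: "c \<in> A" "x \<in> fst c" using obtain_chart .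
  define E where "E v = coord_tvec A c v" for v
  have E: "vector_field_near A x (E v)" for v
    using vector_field_near_coord[OF c] by (simp add: E_def)
  have sm: "smooth_near A x \<sigma>" "smooth_near A x \<tau>"
    using \<sigma> \<tau> by (auto intro: section_near_smooth)
  have *: "ip (\<sigma> x) (tder A (\<lambda>y. tder A \<tau> y (E w y)) x (E v x)) +
      ip (tder A \<sigma> x (E v x)) (tder A \<tau> x (E w x)) = 0" for v w
    using derivative_of_ip[OF sm(1) smooth_near_tder[OF sm(2) E] eventually_ip_tder[OF \<sigma> \<tau> E]] .
  have "E (V c) x = V" "E (W c) x = W"
    using tangent_space_eq_coord_tvec[OF V c] tangent_space_eq_coord_tvec[OF W c] by (auto simp: E_def)
  then show ?thesis
    using *[of "V c" "W c"] *[of "W c" "V c"] tder_coord_symmetric[OF sm(2) c, of "V c" "W c"]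
    unfolding E_def by simp
qed

text \<open>
  Where the kernel of \<open>X \<mapsto> d\<^sub>X \<sigma>\<close> modulo \<open>f\<close> is a line, it is spanned by a smooth vector field: for a constant
  coordinate direction \<open>w\<close> outside the kernel, \<open>h(v) = (d\<^sub>v \<sigma>, d\<^sub>w \<sigma>)\<close> is a linear form with that kernel, and
  \<open>h(e\<^sub>2) e\<^sub>1 - h(e\<^sub>1) e\<^sub>2\<close> spans the kernel of a non-zero linear form \<open>h\<close> on a plane.
\<close>

lemma kernel_vector_field:
  assumes \<sigma>: "section_near A f x \<sigma>"
    and W: "W \<in> tangent_space A x" "tder A \<sigma> x W \<notin> f x"
    and Z: "\<forall>\<^sub>F y in nhds x. \<exists>Z\<in>tangent_space A y. Z \<noteq> 0 \<and> tder A \<sigma> y Z \<in> f y"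
  obtains Y where "vector_field_near A x Y" "\<forall>\<^sub>F y in nhds x. Y y \<noteq> 0 \<and> tder A \<sigma> y (Y y) \<in> f y"
proof -
  obtain c where c: "c \<in> A" "x \<in> fst c" using obtain_chart .
  define E where "E v = coord_tvec A c v" for v
  define w where "w = W c"
  define e :: "2 \<Rightarrow> real^2" where "e i = axis i 1" for i
  define D where "D v y = tder A \<sigma> y (E v y)" for v y
  define h where "h v y = ip (D v y) (D w y)" for v y
  define Y where "Y y = h (e 2) y *\<^sub>R E (e 1) y + (- h (e 1) y) *\<^sub>R E (e 2) y" for y
  have sm: "smooth_near A x \<sigma>" using section_near_smooth[OF \<sigma>] .
  have E: "vector_field_near A x (E v)" for v
    using vector_field_near_coord[OF c] by (simp add: E_def)
  have D: "smooth_near A x (D v)" for v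
    unfolding D_def by (rule smooth_near_tder[OF sm E])
  have h: "smooth_near A x (h v)" for v
    unfolding h_def by (rule smooth_near_bilinear[OF bounded_bilinear_ip D D])
  have Y: "vector_field_near A x Y"
    unfolding Y_def using h
    by (intro vector_field_near_combination E smooth_near_linear[OF bounded_linear_minus[OF bounded_linear_ident]])
  have "E w x = W" using tangent_space_eq_coord_tvec[OF W(1) c] by (simp add: E_def w_def)
  then have "h w x \<noteq> 0"
    using null_tder_in_f[OF \<sigma> W(1)] W(2) by (auto simp: h_def D_def)
  then have hw: "\<forall>\<^sub>F y in nhds x. h w y \<noteq> 0"
    by (rule smooth_near_eventually_nonzero[OF h])
  have "\<forall>\<^sub>F y in nhds x. Y y \<noteq> 0 \<and> tder A \<sigma> y (Y y) \<in> f y"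
    using Z hw eventually_chart[OF c] section_near_eventually[OF \<sigma>] vector_field_near_tangent[OF Y]
  proof eventually_elim
    case (elim y)
    then obtain Z where Z: "Z \<in> tangent_space A y" "Z \<noteq> 0" "tder A \<sigma> y Z \<in> f y" by blast
    have cy: "y \<in> fst c" using elim by blast
    have Etan: "E v y \<in> tangent_space A y" for v
      using coord_tvec_in_tangent_space[OF c(1) cy] by (simp add: E_def)
    have Ec: "E v y c = v" for v using c(1) cy by (simp add: E_def)
    have lin: "linear (tder A \<sigma> y)" using linear_tder section_near_smooth elim by blast
    have Dlin: "D (r *\<^sub>R u + s *\<^sub>R v) y = r *\<^sub>R D u y + s *\<^sub>R D v y" for r s u v
    proof -
      have "E (r *\<^sub>R u + s *\<^sub>R v) y = r *\<^sub>R E u y + s *\<^sub>R E v y"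
      proof (rule tangent_space_eqI[OF Etan _ c(1) cy])
        show "r *\<^sub>R E u y + s *\<^sub>R E v y \<in> tangent_space A y"
          using subspace_tangent_space[of y] Etan by (intro subspace_add subspace_scale)
      qed (simp add: Ec scaleR_fun_def plus_fun_def)
      then show ?thesis by (simp add: D_def linear_add[OF lin] linear_scale[OF lin])
    qed
    have hwy: "h w y = w $ 1 * h (e 1) y + w $ 2 * h (e 2) y"
    proof -
      have "w = w $ 1 *\<^sub>R e 1 + w $ 2 *\<^sub>R e 2" by (simp add: vec_eq_iff forall_2 e_def axis_def)
      moreover have "h (r *\<^sub>R u + s *\<^sub>R v) y = r * h u y + s * h v y" for r s u v
        by (simp only: h_def Dlin ip_simps) simp
      ultimately show ?thesis by metis
    qed
    have "Y y c = h (e 2) y *\<^sub>R e 1 + (- h (e 1) y) *\<^sub>R e 2"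
      unfolding Y_def by (simp add: scaleR_fun_def plus_fun_def Ec)
    then have "Y y c $ 1 = h (e 2) y" "Y y c $ 2 = - h (e 1) y"
      by (simp_all add: e_def axis_def)
    then have Y0: "Y y \<noteq> 0" using hwy elim by auto
    have DY: "tder A \<sigma> y (Y y) = h (e 2) y *\<^sub>R D (e 1) y + (- h (e 1) y) *\<^sub>R D (e 2) y"
      unfolding Y_def linear_add[OF lin] linear_scale[OF lin] D_def ..
    have ipDY: "ip (tder A \<sigma> y (Y y)) (D w y) = 0"
      unfolding DY using h_def by (simp add: ip_simps mult.commute)
    have DZ: "ip (tder A \<sigma> y Z) (D w y) = 0"
      unfolding D_def using ip_f_tder[OF _ Etan Z(3)] elim by blast
    have "E w y \<noteq> k *\<^sub>R Z" for k
    proof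
      assume "E w y = k *\<^sub>R Z"
      then have "D w y = k *\<^sub>R tder A \<sigma> y Z" by (simp add: D_def linear_scale[OF lin])
      then show False using DZ elim(2) by (simp add: h_def ip_simps)
    qed
    then obtain r s where rs: "Y y = r *\<^sub>R Z + s *\<^sub>R E w y"
      using tangent_space_basis[OF Z(1) Etan Z(2)] elim by blast
    have tY: "tder A \<sigma> y (Y y) = r *\<^sub>R tder A \<sigma> y Z + s *\<^sub>R D w y"
      unfolding rs linear_add[OF lin] linear_scale[OF lin] D_def ..
    then have "s * h w y = 0" using ipDY DZ by (simp add: ip_simps h_def)
    then have "s = 0" using elim by simp
    then show ?case using Y0 tY Z(3) subspace_scale[OF subspace_f] by simp
  qed
  then show ?thesis using that Y by blast
qed

end

section \<open>Curvature frames\<close>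

text \<open>
  The two curvature spheres play symmetric roles. Statements are proved for \<open>s\<^sub>1\<close>, and transferred to \<open>s\<^sub>2\<close> by
  interpreting the locales with the roles exchanged.
\<close>

locale umbilic_free_legendre = legendre A f
  for A :: "'m::{t2_space,second_countable_topology} chart set" and f +
  fixes s1 s2 :: "'m \<Rightarrow> R42 set"
  assumes umbilic_free: "umbilic_free A f s1 s2"
begin

lemma swapped: "umbilic_free_legendre A f s2 s1"
proof
  show "umbilic_free A f s2 s1"
    using umbilic_free unfolding umbilic_free_def by (metis insert_commute)
qed

abbreviation "T1 \<equiv> curvature_subbundle A f s1"
abbreviation "T2 \<equiv> curvature_subbundle A f s2"

lemma curvature_sphere_s1: "curvature_sphere A f x (s1 x)"
  using umbilic_free unfolding umbilic_free_def by blast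

lemma curvature_sphere_s2: "curvature_sphere A f x (s2 x)"
  using umbilic_free unfolding umbilic_free_def by blast

lemma s1_subset: "s1 x \<subseteq> f x" and subspace_s1: "subspace (s1 x)" and dim_s1: "dim (s1 x) = 1"
  using curvature_sphere_s1 unfolding curvature_sphere_def by auto

lemma subspace_s2: "subspace (s2 x)" and dim_s2: "dim (s2 x) = 1"
  using curvature_sphere_s2 unfolding curvature_sphere_def by auto

lemma s1_neq_s2: "s1 x \<noteq> s2 x"
  using umbilic_free unfolding umbilic_free_def by blast

lemma section_s1: "section_near A s1 x \<sigma> \<Longrightarrow> section_near A f x \<sigma>"
  using s1_subset unfolding section_near_def local_section_def by blast

lemma T1_iff:
  "X \<in> T1 x \<longleftrightarrow> X \<in> tangent_space A x \<and>
    (\<forall>\<sigma>. section_near A f x \<sigma> \<longrightarrow> \<sigma> x \<in> s1 x \<longrightarrow> tder A \<sigma> x X \<in> f x)"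
  unfolding curvature_subbundle_def curvature_space_def section_near_def by blast

lemma T1_nonzero: obtains X where "X \<in> T1 x" "X \<noteq> 0"
proof -
  have "0 \<in> T1 x"
    unfolding T1_iff
    using subspace_0[OF subspace_tangent_space] subspace_0[OF subspace_f]
      linear_0[OF linear_tder[OF section_near_smooth]] by metis
  moreover have "T1 x \<noteq> {0}"
    using curvature_sphere_s1 unfolding curvature_sphere_def curvature_subbundle_def by blast
  ultimately show ?thesis using that by blast
qed

definition spanning_section :: "'m \<Rightarrow> ('m \<Rightarrow> R42) \<Rightarrow> bool" where
  "spanning_section x \<sigma> \<longleftrightarrow> section_near A s1 x \<sigma> \<and> (\<forall>\<^sub>F y in nhds x. s1 y = span {\<sigma> y})"

lemma obtain_spanning_section: obtains \<sigma> where "spanning_section x \<sigma>"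
proof -
  have "smooth_subbundle A 1 s1" using umbilic_free unfolding umbilic_free_def by blast
  then have "\<exists>U \<sigma>. x \<in> U \<and> (\<forall>i<1. local_section A s1 U (\<sigma> i)) \<and>
      (\<forall>y\<in>U. s1 y = span {\<sigma> i y |i. i < (1::nat)})"
    unfolding smooth_subbundle_def by (elim conjE) (erule spec)
  then obtain U \<sigma> where U: "x \<in> U" "\<forall>i<1. local_section A s1 U (\<sigma> i)"
    "\<forall>y\<in>U. s1 y = span {\<sigma> i y |i. i < (1::nat)}"
    by (elim exE conjE)
  have "{\<sigma> i y |i. i < (1::nat)} = {\<sigma> 0 y}" for y by auto
  then have "\<forall>y\<in>U. s1 y = span {\<sigma> 0 y}" using U(3) by simp
  moreover have l: "local_section A s1 U (\<sigma> 0)" using U(2) by simp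
  then have "open U" by (simp add: local_section_def)
  ultimately have "\<forall>\<^sub>F y in nhds x. s1 y = span {\<sigma> 0 y}"
    using U(1) unfolding eventually_nhds by blast
  then have "spanning_section x (\<sigma> 0)"
    using U(1) l unfolding spanning_section_def section_near_def by blast
  then show ?thesis using that by blast
qed

lemma spanning_section_eventually:
  "spanning_section x \<sigma> \<Longrightarrow> \<forall>\<^sub>F y in nhds x. spanning_section y \<sigma>"
  unfolding spanning_section_def
  by (simp add: eventually_conj section_near_eventually eventually_eventually)

lemma spanning_section_span: "spanning_section x \<sigma> \<Longrightarrow> s1 x = span {\<sigma> x}"
  unfolding spanning_section_def by (auto dest: eventually_nhds_x_imp_x)

lemma spanning_section_nonzero:
  assumes "spanning_section x \<sigma>"
  shows "\<sigma> x \<noteq> 0"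
  using dim_s1[of x] unfolding spanning_section_span[OF assms] by auto

lemma spanning_section_f: "spanning_section x \<sigma> \<Longrightarrow> section_near A f x \<sigma>"
  unfolding spanning_section_def using section_s1 by blast

text \<open>By tensoriality a single spanning section decides membership in \<open>T\<^sub>1\<close>.\<close>

lemma T1_iff_spanning:
  assumes \<sigma>: "spanning_section x \<sigma>"
  shows "X \<in> T1 x \<longleftrightarrow> X \<in> tangent_space A x \<and> tder A \<sigma> x X \<in> f x"
proof
  assume "X \<in> T1 x"
  then show "X \<in> tangent_space A x \<and> tder A \<sigma> x X \<in> f x"
    using \<sigma> section_near_mem section_s1 unfolding T1_iff spanning_section_def by blast
next
  assume X: "X \<in> tangent_space A x \<and> tder A \<sigma> x X \<in> f x"
  have "tder A \<tau> x X \<in> f x" if \<tau>: "section_near A f x \<tau>" "\<tau> x \<in> s1 x" for \<tau>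
  proof -
    obtain r where "\<tau> x = r *\<^sub>R \<sigma> x"
      using \<tau>(2) unfolding spanning_section_span[OF \<sigma>] span_singleton by blast
    then have eq: "\<tau> x = r *\<^sub>R \<sigma> x + 0 *\<^sub>R \<sigma> x" by simp
    have "tder A \<tau> x X - (r *\<^sub>R tder A \<sigma> x X + 0 *\<^sub>R tder A \<sigma> x X) \<in> f x"
      using X by (intro tder_tensorial[OF \<tau>(1) spanning_section_f[OF \<sigma>] spanning_section_f[OF \<sigma>] _ eq]) blast
    then have d: "tder A \<tau> x X - r *\<^sub>R tder A \<sigma> x X \<in> f x" by simp
    have "r *\<^sub>R tder A \<sigma> x X \<in> f x" using X subspace_scale[OF subspace_f] by blast
    from subspace_add[OF subspace_f d this] show ?thesis by simp
  qed
  then show "X \<in> T1 x" unfolding T1_iff using X by blast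
qed

end

locale two_sections = umbilic_free_legendre A f s1 s2
  for A :: "'m::{t2_space,second_countable_topology} chart set" and f s1 s2 +
  fixes x :: 'm and \<sigma>1 \<sigma>2 :: "'m \<Rightarrow> R42"
  assumes \<sigma>1: "spanning_section x \<sigma>1"
    and \<sigma>2: "umbilic_free_legendre.spanning_section A s2 x \<sigma>2"
begin

sublocale swap: umbilic_free_legendre A f s2 s1 by (rule swapped)

lemma swapped_sections: "two_sections A f s2 s1 x \<sigma>2 \<sigma>1"
  by unfold_locales (rule \<sigma>1 \<sigma>2)+

lemma independent_sections:
  assumes "r *\<^sub>R \<sigma>1 x + s *\<^sub>R \<sigma>2 x = 0"
  shows "r = 0 \<and> s = 0"
proof (rule ccontr)
  have n: "\<sigma>1 x \<noteq> 0" "\<sigma>2 x \<noteq> 0"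
    using spanning_section_nonzero[OF \<sigma>1] swap.spanning_section_nonzero[OF \<sigma>2] .
  assume "\<not> ?thesis"
  then have "r \<noteq> 0" using assms n by auto
  have "r *\<^sub>R \<sigma>1 x = (- s) *\<^sub>R \<sigma>2 x" using assms by (simp add: eq_neg_iff_add_eq_0)
  then have "inverse r *\<^sub>R r *\<^sub>R \<sigma>1 x = inverse r *\<^sub>R (- s) *\<^sub>R \<sigma>2 x" by (rule arg_cong)
  then have "\<sigma>1 x = inverse r *\<^sub>R (- s) *\<^sub>R \<sigma>2 x" using \<open>r \<noteq> 0\<close> by simp
  moreover have "\<sigma>2 x \<in> s2 x"
    unfolding swap.spanning_section_span[OF \<sigma>2] by (simp add: span_base)
  ultimately have "\<sigma>1 x \<in> s2 x" using subspace_scale[OF subspace_s2] by metis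
  then have "s1 x \<subseteq> s2 x"
    unfolding spanning_section_span[OF \<sigma>1] using subspace_s2 by (intro span_minimal) auto
  then show False
    using subspace_dim_equal[OF subspace_s1 subspace_s2, of x x] dim_s1[of x] dim_s2[of x] s1_neq_s2 by simp
qed

lemma f_eq_span: "f x = span {\<sigma>1 x, \<sigma>2 x}"
proof -
  have mem: "\<sigma>1 x \<in> f x" "\<sigma>2 x \<in> f x"
    using section_near_mem spanning_section_f[OF \<sigma>1] swap.spanning_section_f[OF \<sigma>2] by blast+
  have "\<sigma>1 x \<noteq> r *\<^sub>R \<sigma>2 x" for r using independent_sections[of 1 "- r"] by auto
  then have "\<sigma>1 x \<notin> span {\<sigma>2 x}" by (auto simp: span_singleton)
  moreover have "\<sigma>2 x \<noteq> 0" using swap.spanning_section_nonzero[OF \<sigma>2] .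
  ultimately have "dim {\<sigma>1 x, \<sigma>2 x} = 2" by (simp add: dim_insert)
  moreover have "span {\<sigma>1 x, \<sigma>2 x} \<subseteq> f x" using mem subspace_f by (intro span_minimal) auto
  ultimately show ?thesis
    using subspace_dim_equal[OF subspace_span subspace_f, of "{\<sigma>1 x, \<sigma>2 x}" x] dim_f[of x] by simp
qed

lemma section_near_sections: "section_near A f x \<sigma>1" "section_near A f x \<sigma>2"
  using spanning_section_f[OF \<sigma>1] swap.spanning_section_f[OF \<sigma>2] .

text \<open>A common element would be annihilated by \<open>\<sigma> \<mapsto> d\<^sub>X \<sigma>\<close> modulo \<open>f\<close> on all of \<open>f\<close>.\<close>

lemma T1_inter_T2:
  assumes "X \<in> T1 x" "X \<in> T2 x"
  shows "X = 0"
proof (rule immersion)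
  show X: "X \<in> tangent_space A x" using assms T1_iff by blast
  have d: "tder A \<sigma>1 x X \<in> f x" "tder A \<sigma>2 x X \<in> f x"
    using assms T1_iff_spanning[OF \<sigma>1] swap.T1_iff_spanning[OF \<sigma>2] by blast+
  fix \<sigma> assume \<sigma>: "section_near A f x \<sigma>"
  obtain r s where rs: "\<sigma> x = r *\<^sub>R \<sigma>1 x + s *\<^sub>R \<sigma>2 x"
    using section_near_mem[OF \<sigma>] unfolding f_eq_span in_span_2 by blast
  have "r *\<^sub>R tder A \<sigma>1 x X + s *\<^sub>R tder A \<sigma>2 x X \<in> f x"
    using d subspace_f by (auto intro: subspace_add subspace_scale)
  from subspace_add[OF subspace_f tder_tensorial[OF \<sigma> section_near_sections X rs] this]
  show "tder A \<sigma> x X \<in> f x" by simp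
qed

lemma obtain_field_T1:
  obtains X where "vector_field_near A x X" "\<forall>\<^sub>F y in nhds x. X y \<in> T1 y \<and> X y \<noteq> 0"
proof -
  obtain W where W: "W \<in> T2 x" "W \<noteq> 0" using swap.T1_nonzero .
  then have Wx: "W \<in> tangent_space A x" "tder A \<sigma>1 x W \<notin> f x"
    using T1_inter_T2 T1_iff_spanning[OF \<sigma>1] swap.T1_iff by blast+
  have "\<forall>\<^sub>F y in nhds x. \<exists>Z\<in>tangent_space A y. Z \<noteq> 0 \<and> tder A \<sigma>1 y Z \<in> f y"
    using spanning_section_eventually[OF \<sigma>1]
    by eventually_elim (metis T1_nonzero T1_iff_spanning)
  from kernel_vector_field[OF section_near_sections(1) Wx this]
  obtain X where X: "vector_field_near A x X" "\<forall>\<^sub>F y in nhds x. X y \<noteq> 0 \<and> tder A \<sigma>1 y (X y) \<in> f y" .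
  have "\<forall>\<^sub>F y in nhds x. X y \<in> T1 y \<and> X y \<noteq> 0"
    using spanning_section_eventually[OF \<sigma>1] X(2) vector_field_near_tangent[OF X(1)]
    by eventually_elim (simp add: T1_iff_spanning)
  then show ?thesis using that X(1) by blast
qed

end

locale curvature_frame = two_sections A f s1 s2 x \<sigma>1 \<sigma>2
  for A :: "'m::{t2_space,second_countable_topology} chart set" and f s1 s2 x \<sigma>1 \<sigma>2 +
  fixes X Y :: "'m \<Rightarrow> 'm tvec"
  assumes X: "vector_field_near A x X" "\<forall>\<^sub>F y in nhds x. X y \<in> T1 y \<and> X y \<noteq> 0"
    and Y: "vector_field_near A x Y" "\<forall>\<^sub>F y in nhds x. Y y \<in> T2 y \<and> Y y \<noteq> 0"
begin

lemma swapped_frame: "curvature_frame A f s2 s1 x \<sigma>2 \<sigma>1 Y X"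
proof -
  interpret s: two_sections A f s2 s1 x \<sigma>2 \<sigma>1 by (rule swapped_sections)
  show ?thesis by unfold_locales (use X Y in auto)
qed

lemma frame_eventually: "\<forall>\<^sub>F y in nhds x. curvature_frame A f s1 s2 y \<sigma>1 \<sigma>2 X Y"
proof -
  have v: "\<forall>\<^sub>F y in nhds x. vector_field_near A y X" "\<forall>\<^sub>F y in nhds x. vector_field_near A y Y"
    using X(1) Y(1) unfolding vector_field_near_def local_vector_field_def eventually_nhds by blast+
  show ?thesis
    using spanning_section_eventually[OF \<sigma>1] swap.spanning_section_eventually[OF \<sigma>2] v
      eventually_eventually[THEN iffD2, OF X(2)] eventually_eventually[THEN iffD2, OF Y(2)]
    by eventually_elim (unfold_locales, auto)
qed

lemma X_at: "X x \<in> T1 x" "X x \<noteq> 0" "X x \<in> tangent_space A x"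
  and Y_at: "Y x \<in> T2 x" "Y x \<noteq> 0" "Y x \<in> tangent_space A x"
  using eventually_nhds_x_imp_x[OF X(2)] eventually_nhds_x_imp_x[OF Y(2)] T1_iff swap.T1_iff by blast+

lemma smooth_sections: "smooth_near A x \<sigma>1" "smooth_near A x \<sigma>2"
  using section_near_sections section_near_smooth by blast+

lemma sections_mem: "\<sigma>1 x \<in> f x" "\<sigma>2 x \<in> f x"
  using section_near_sections section_near_mem by blast+

lemma tangent_expansion:
  assumes "Z \<in> tangent_space A x"
  obtains r s where "Z = r *\<^sub>R X x + s *\<^sub>R Y x"
proof -
  have "Y x \<noteq> k *\<^sub>R X x" for k
  proof
    assume k: "Y x = k *\<^sub>R X x"
    have lin: "linear (tder A \<sigma>1 x)" by (rule linear_tder[OF smooth_sections(1)])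
    have "tder A \<sigma>1 x (X x) \<in> f x" using X_at(1) T1_iff_spanning[OF \<sigma>1] by blast
    then have "tder A \<sigma>1 x (Y x) \<in> f x"
      unfolding k linear_scale[OF lin] by (rule subspace_scale[OF subspace_f])
    then have "Y x \<in> T1 x" using T1_iff_spanning[OF \<sigma>1] Y_at(3) by blast
    then show False using T1_inter_T2 Y_at by blast
  qed
  then show ?thesis using tangent_space_basis[OF X_at(3) Y_at(3) X_at(2) _ assms] that by blast
qed

abbreviation "u1 \<equiv> tder A \<sigma>1 x (Y x)"
abbreviation "u2 \<equiv> tder A \<sigma>2 x (X x)"
abbreviation "w1 \<equiv> tder A (\<lambda>y. tder A \<sigma>1 y (Y y)) x (Y x)"
abbreviation "w2 \<equiv> tder A (\<lambda>y. tder A \<sigma>2 y (X y)) x (X x)"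

lemma tder_\<sigma>1_X: "tder A \<sigma>1 x (X x) \<in> f x"
  using X_at(1) T1_iff_spanning[OF \<sigma>1] by blast

lemma u1_notin: "u1 \<notin> f x"
  using Y_at T1_iff_spanning[OF \<sigma>1] T1_inter_T2 by blast

lemma ip_u1_u1: "ip u1 u1 \<noteq> 0"
  using null_tder_in_f[OF section_near_sections(1) Y_at(3)] u1_notin by blast

lemma ip_f_u1: "v \<in> f x \<Longrightarrow> ip v u1 = 0"
  using ip_f_tder[OF section_near_sections(1) Y_at(3)] .

lemma ip_\<sigma>1_w1: "ip (\<sigma>1 x) w1 = - ip u1 u1"
  using derivative_of_ip[OF smooth_sections(1) smooth_near_tder[OF smooth_sections(1) Y(1)]
      eventually_ip_tder[OF section_near_sections(1,1) Y(1)], of "Y x"] by simp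

lemma ip_\<sigma>2_w1: "ip (\<sigma>2 x) w1 = 0"
proof -
  have "ip (\<sigma>2 x) w1 + ip (tder A \<sigma>2 x (Y x)) u1 = 0"
    using derivative_of_ip[OF smooth_sections(2) smooth_near_tder[OF smooth_sections(1) Y(1)]
        eventually_ip_tder[OF section_near_sections(2,1) Y(1)]] .
  moreover have "tder A \<sigma>2 x (Y x) \<in> f x"
    using Y_at(1) swap.T1_iff_spanning[OF \<sigma>2] by blast
  ultimately show ?thesis using ip_f_u1 by simp
qed

end

context curvature_frame
begin

interpretation sw: curvature_frame A f s2 s1 x \<sigma>2 \<sigma>1 Y X by (rule swapped_frame)

text \<open>By symmetry \<open>(d\<^sub>Y \<sigma>\<^sub>1, d\<^sub>X \<sigma>\<^sub>2) = (d\<^sub>X \<sigma>\<^sub>1, d\<^sub>Y \<sigma>\<^sub>2)\<close>, and \<open>d\<^sub>X \<sigma>\<^sub>1\<close> is in \<open>f\<close>.\<close>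

lemma ip_u1_u2: "ip u1 u2 = 0"
  using ip_tder_symmetric[OF section_near_sections Y_at(3) X_at(3)]
    ip_f_tder[OF section_near_sections(2) Y_at(3) tder_\<sigma>1_X] by simp

text \<open>
  Modulo \<open>f\<close>, the images of \<open>d\<sigma>\<^sub>1\<close> and \<open>d\<sigma>\<^sub>2\<close> are spanned by \<open>u\<^sub>1\<close> and \<open>u\<^sub>2\<close>, and both lie in \<open>f\<^sup>\<bottom>\<close>.
\<close>

lemma ip_tder_\<sigma>1_tder_\<sigma>2:
  assumes V: "V \<in> tangent_space A x" and W: "W \<in> tangent_space A x"
  shows "ip (tder A \<sigma>1 x V) (tder A \<sigma>2 x W) = 0"
proof -
  obtain r s r' s' where "V = r *\<^sub>R X x + s *\<^sub>R Y x" "W = r' *\<^sub>R X x + s' *\<^sub>R Y x"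
    using tangent_expansion V W by metis
  then have e: "tder A \<sigma>1 x V = r *\<^sub>R tder A \<sigma>1 x (X x) + s *\<^sub>R u1"
    "tder A \<sigma>2 x W = r' *\<^sub>R u2 + s' *\<^sub>R tder A \<sigma>2 x (Y x)"
    using linear_tder[OF smooth_sections(1)] linear_tder[OF smooth_sections(2)]
    by (simp_all add: linear_add linear_scale)
  have "ip u1 (tder A \<sigma>2 x (Y x)) = 0"
    using ip_f_u1[OF sw.tder_\<sigma>1_X] ip_commute by simp
  then show ?thesis
    using ip_u1_u2 sw.ip_f_u1[OF tder_\<sigma>1_X] ip_f[OF tder_\<sigma>1_X sw.tder_\<sigma>1_X]
    unfolding e by (simp add: ip_simps)
qed

sublocale adapted_frame "\<sigma>1 x" "\<sigma>2 x" u1 u2 w1 w2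
  using sections_mem ip_f_u1 sw.ip_f_u1 ip_f ip_u1_u1 sw.ip_u1_u1 ip_u1_u2 ip_\<sigma>1_w1 sw.ip_\<sigma>1_w1
    ip_\<sigma>2_w1 sw.ip_\<sigma>2_w1 independent_sections
  by unfold_locales simp_all

end

section \<open>The middle potential\<close>

context two_sections
begin

lemma obtain_frame: obtains X Y where "curvature_frame A f s1 s2 x \<sigma>1 \<sigma>2 X Y"
proof -
  interpret s: two_sections A f s2 s1 x \<sigma>2 \<sigma>1 by (rule swapped_sections)
  obtain X where X: "vector_field_near A x X" "\<forall>\<^sub>F y in nhds x. X y \<in> T1 y \<and> X y \<noteq> 0"
    using obtain_field_T1 .
  obtain Y where Y: "vector_field_near A x Y" "\<forall>\<^sub>F y in nhds x. Y y \<in> T2 y \<and> Y y \<noteq> 0"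
    using s.obtain_field_T1 .
  show ?thesis by (rule that[of X Y]) (unfold_locales, fact X Y)+
qed

lemma wedge_span_f_f:
  assumes "B \<in> wedge_span (f x) (f x)"
  obtains k where "B = k *\<^sub>R wedge (\<sigma>1 x) (\<sigma>2 x)"
proof -
  have "\<exists>k. B = k *\<^sub>R wedge (\<sigma>1 x) (\<sigma>2 x)"
    using assms unfolding wedge_span_def
  proof (induction rule: span_induct_alt)
    case base
    show ?case by (intro exI[of _ 0]) simp
  next
    case (step r B D)
    then obtain a b k where ab: "a \<in> f x" "b \<in> f x" "B = wedge a b" and D: "D = k *\<^sub>R wedge (\<sigma>1 x) (\<sigma>2 x)"
      by blast
    obtain s t s' t' where "a = s *\<^sub>R \<sigma>1 x + t *\<^sub>R \<sigma>2 x" "b = s' *\<^sub>R \<sigma>1 x + t' *\<^sub>R \<sigma>2 x"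
      using ab unfolding f_eq_span in_span_2 by blast
    then have "r *\<^sub>R B + D = (r * (s * t' - t * s') + k) *\<^sub>R wedge (\<sigma>1 x) (\<sigma>2 x)"
      unfolding ab(3) D
      by (simp add: wedge.add_left wedge.add_right wedge.scaleR_left wedge.scaleR_right
          wedge_swap[of "\<sigma>2 x" "\<sigma>1 x"] algebra_simps)
    then show ?case by blast
  qed
  then show ?thesis using that by blast
qed

end

lemma (in umbilic_free_legendre) obtain_curvature_frame:
  obtains \<sigma>1 \<sigma>2 X Y where "curvature_frame A f s1 s2 x \<sigma>1 \<sigma>2 X Y"
proof -
  interpret sw: umbilic_free_legendre A f s2 s1 by (rule swapped)
  obtain \<sigma>1 where \<sigma>1: "spanning_section x \<sigma>1" using obtain_spanning_section .
  obtain \<sigma>2 where \<sigma>2: "sw.spanning_section x \<sigma>2" using sw.obtain_spanning_section .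
  interpret two_sections A f s1 s2 x \<sigma>1 \<sigma>2 by unfold_locales (fact \<sigma>1 \<sigma>2)+
  obtain X Y where "curvature_frame A f s1 s2 x \<sigma>1 \<sigma>2 X Y" using obtain_frame .
  then show ?thesis by (rule that)
qed

context curvature_frame
begin

interpretation sw: curvature_frame A f s2 s1 x \<sigma>2 \<sigma>1 Y X by (rule swapped_frame)

lemma T2_line:
  assumes "Z \<in> T2 x"
  obtains k where "Z = k *\<^sub>R Y x"
proof -
  have Z: "Z \<in> tangent_space A x" "tder A \<sigma>2 x Z \<in> f x"
    using assms swap.T1_iff_spanning[OF \<sigma>2] by blast+
  obtain r s where rs: "Z = r *\<^sub>R X x + s *\<^sub>R Y x" using tangent_expansion[OF Z(1)] .
  have "tder A \<sigma>2 x Z = r *\<^sub>R u2 + s *\<^sub>R tder A \<sigma>2 x (Y x)"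
    using linear_tder[OF smooth_sections(2)] unfolding rs by (simp add: linear_add linear_scale)
  moreover have "ip (tder A \<sigma>2 x Z) u2 = 0" "ip (tder A \<sigma>2 x (Y x)) u2 = 0"
    using sw.ip_f_u1 Z(2) sw.tder_\<sigma>1_X by blast+
  ultimately have "r = 0" using sw.ip_u1_u1 by (simp add: ip_simps)
  then have "Z = s *\<^sub>R Y x" using rs by simp
  then show ?thesis by (rule that)
qed

subsection \<open>The cyclide bundles\<close>

text \<open>
  Rescaling the section of \<open>s\<^sub>1\<close> and the field in \<open>T\<^sub>2\<close> by functions changes the derivatives of order up to 2
  by a triangular matrix.
\<close>

lemma cyclide_generators:
  assumes \<sigma>: "section_near A s1 x \<sigma>" and Z: "vector_field_near A x Z" "\<forall>\<^sub>F y in nhds x. Z y \<in> T2 y"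
  shows "{\<sigma> x, tder A \<sigma> x (Z x), tder A (\<lambda>y. tder A \<sigma> y (Z y)) x (Z x)} \<subseteq> S1"
proof -
  obtain c where c: "c \<in> A" "x \<in> fst c" using obtain_chart .
  define l where "l y = inverse (\<sigma>1 y \<bullet> \<sigma>1 y) * (\<sigma> y \<bullet> \<sigma>1 y)" for y
  define k where "k y = inverse (Y y c \<bullet> Y y c) * (Z y c \<bullet> Y y c)" for y
  define D where "D y = tder A \<sigma>1 y (Y y)" for y
  define p where "p y = k y * tder A l y (Y y)" for y
  define q where "q y = k y * l y" for y
  have sm\<sigma>: "smooth_near A x \<sigma>" using section_near_smooth[OF \<sigma>] .
  have l: "smooth_near A x l"
    unfolding l_def using spanning_section_nonzero[OF \<sigma>1]
    by (intro smooth_near_bilinear[OF bounded_bilinear_mult] smooth_near_inverse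
        smooth_near_bilinear[OF bounded_bilinear_inner] smooth_sections sm\<sigma>) simp
  have Yc0: "Y y c \<noteq> 0" if "y \<in> fst c" "Y y \<in> tangent_space A y" "Y y \<noteq> 0" for y
    using tangent_space_eqI[OF that(2) subspace_0[OF subspace_tangent_space] c(1) that(1)] that(3) by auto
  have k: "smooth_near A x k"
    unfolding k_def using Yc0[OF c(2) Y_at(3,2)]
    by (intro smooth_near_bilinear[OF bounded_bilinear_mult] smooth_near_inverse
        smooth_near_bilinear[OF bounded_bilinear_inner] vector_field_near_component[OF _ c] Y Z) simp
  have D: "smooth_near A x D" unfolding D_def by (rule smooth_near_tder[OF smooth_sections(1) Y(1)])
  have p: "smooth_near A x p"
    unfolding p_def by (intro smooth_near_bilinear[OF bounded_bilinear_mult] k smooth_near_tder[OF l Y(1)])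
  have q: "smooth_near A x q"
    unfolding q_def by (intro smooth_near_bilinear[OF bounded_bilinear_mult] k l)
  have \<sigma>l: "\<forall>\<^sub>F y in nhds x. \<sigma> y = l y *\<^sub>R \<sigma>1 y"
    using section_near_eventually[OF \<sigma>] spanning_section_eventually[OF \<sigma>1]
  proof eventually_elim
    case (elim y)
    then obtain r where "\<sigma> y = r *\<^sub>R \<sigma>1 y"
      using section_near_mem[of s1 y \<sigma>] spanning_section_span[of y \<sigma>1] by (auto simp: span_singleton)
    then show ?case using spanning_section_nonzero[of y \<sigma>1] elim by (simp add: l_def)
  qed
  have Zk: "\<forall>\<^sub>F y in nhds x. Z y = k y *\<^sub>R Y y"
    using frame_eventually Z(2) eventually_chart[OF c]
  proof eventually_elim
    case (elim y)
    interpret y: curvature_frame A f s1 s2 y \<sigma>1 \<sigma>2 X Y using elim by blast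
    obtain r where r: "Z y = r *\<^sub>R Y y" using y.T2_line elim by blast
    then have "k y = r" using Yc0[of y] y.Y_at elim by (simp add: k_def scaleR_fun_def)
    then show ?case using r by simp
  qed
  have first: "\<forall>\<^sub>F y in nhds x. tder A \<sigma> y (Z y) = p y *\<^sub>R \<sigma>1 y + q y *\<^sub>R D y"
    using eventually_eventually[THEN iffD2, OF \<sigma>l] Zk smooth_near_eventually[OF l]
      smooth_near_eventually[OF smooth_sections(1)]
  proof eventually_elim
    case (elim y)
    have "tder A \<sigma> y (Z y) = l y *\<^sub>R tder A \<sigma>1 y (Z y) + tder A l y (Z y) *\<^sub>R \<sigma>1 y"
      using elim by (simp add: tder_transform tder_bilinear[OF bounded_bilinear_scaleR])
    then show ?case
      using elim linear_scale[OF linear_tder[of y l]] linear_scale[OF linear_tder[of y \<sigma>1]]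
      by (simp add: p_def q_def D_def mult.commute)
  qed
  have \<sigma>x: "\<sigma> x = l x *\<^sub>R \<sigma>1 x" and Zx: "Z x = k x *\<^sub>R Y x"
    and firstx: "tder A \<sigma> x (Z x) = p x *\<^sub>R \<sigma>1 x + q x *\<^sub>R u1"
    using eventually_nhds_x_imp_x[OF \<sigma>l] eventually_nhds_x_imp_x[OF Zk]
      eventually_nhds_x_imp_x[OF first] by (simp_all add: D_def)
  have "tder A (\<lambda>y. tder A \<sigma> y (Z y)) x (Z x) = tder A (\<lambda>y. p y *\<^sub>R \<sigma>1 y + q y *\<^sub>R D y) x (Z x)"
    by (rule tder_transform[OF first])
  also have "\<dots> = (p x *\<^sub>R tder A \<sigma>1 x (Z x) + tder A p x (Z x) *\<^sub>R \<sigma>1 x) +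
      (q x *\<^sub>R tder A D x (Z x) + tder A q x (Z x) *\<^sub>R D x)"
    by (simp add: tder_add tder_bilinear[OF bounded_bilinear_scaleR]
        smooth_near_bilinear[OF bounded_bilinear_scaleR] p q D smooth_sections)
  also have "tder A \<sigma>1 x (Z x) = k x *\<^sub>R u1"
    unfolding Zx by (rule linear_scale[OF linear_tder[OF smooth_sections(1)]])
  also have "tder A D x (Z x) = k x *\<^sub>R w1"
    unfolding Zx linear_scale[OF linear_tder[OF D]] by (simp add: D_def[abs_def])
  also have "D x = u1" by (simp add: D_def)
  finally have second: "tder A (\<lambda>y. tder A \<sigma> y (Z y)) x (Z x) = (p x *\<^sub>R k x *\<^sub>R u1 + tder A p x (Z x) *\<^sub>R \<sigma>1 x) +
      (q x *\<^sub>R k x *\<^sub>R w1 + tder A q x (Z x) *\<^sub>R u1)" .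
  have base: "\<sigma>1 x \<in> S1" "u1 \<in> S1" "w1 \<in> S1" by (auto intro: span_base)
  then have "\<sigma> x \<in> S1" "tder A \<sigma> x (Z x) \<in> S1" "tder A (\<lambda>y. tder A \<sigma> y (Z y)) x (Z x) \<in> S1"
    unfolding second firstx \<sigma>x by (simp_all only: span_add span_scale)
  then show ?thesis by simp
qed

lemma cyclide_bundle_eq: "cyclide_bundle A s1 T2 x = S1"
proof
  let ?F = "{{\<sigma> x, tder A \<sigma> x (Y x), tder A (\<lambda>y. tder A \<sigma> y (Y y)) x (Y x)} |\<sigma> Y U.
    x \<in> U \<and> local_section A s1 U \<sigma> \<and> local_vector_field A T2 U Y}"
  have "\<Union>?F \<subseteq> S1"
  proof (rule Union_least)
    fix B assume "B \<in> ?F"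
    then obtain \<sigma> Z U where B: "B = {\<sigma> x, tder A \<sigma> x (Z x), tder A (\<lambda>y. tder A \<sigma> y (Z y)) x (Z x)}"
      and U: "x \<in> U" "local_section A s1 U \<sigma>" "local_vector_field A T2 U Z" by blast
    have "section_near A s1 x \<sigma>" using U unfolding section_near_def by blast
    moreover have "vector_field_near A x Z" "\<forall>\<^sub>F y in nhds x. Z y \<in> T2 y"
      using U unfolding vector_field_near_def local_vector_field_def eventually_nhds by blast+
    ultimately show "B \<subseteq> S1" unfolding B by (rule cyclide_generators)
  qed
  then show "cyclide_bundle A s1 T2 x \<subseteq> S1"
    unfolding cyclide_bundle_def by (rule span_minimal) simp
  obtain U where U: "x \<in> U" "local_section A s1 U \<sigma>1"
    using \<sigma>1 unfolding spanning_section_def section_near_def by blast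
  obtain V where V: "x \<in> V" "local_vector_field A (tangent_space A) V Y"
    using Y(1) unfolding vector_field_near_def by blast
  obtain W where W: "open W" "x \<in> W" "\<forall>y\<in>W. Y y \<in> T2 y"
    using Y(2) unfolding eventually_nhds by blast
  let ?N = "U \<inter> V \<inter> W"
  have "local_section A s1 ?N \<sigma>1"
    using U V W smooth_map_on_subset[of U \<sigma>1 ?N] by (auto simp: local_section_def local_vector_field_def)
  moreover have "local_vector_field A T2 ?N Y"
  proof -
    have "smooth_map_on A (?N \<inter> fst c) (\<lambda>y. Y y c)" if "c \<in> A" for c
      using V(2) that by (auto simp: local_vector_field_def elim!: smooth_map_on_subset)
    then show ?thesis
      using U V W by (auto simp: local_section_def local_vector_field_def)
  qed
  ultimately have "{\<sigma>1 x, u1, w1} \<in> ?F"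
    using U(1) V(1) W(2) by (intro CollectI exI[of _ \<sigma>1] exI[of _ Y] exI[of _ ?N] conjI) simp_all
  then have "{\<sigma>1 x, u1, w1} \<subseteq> \<Union>?F" by (rule Union_upper)
  then show "S1 \<subseteq> cyclide_bundle A s1 T2 x"
    unfolding cyclide_bundle_def by (rule span_mono)
qed

subsection \<open>Gauge transformations\<close>

text \<open>
  The coefficient of \<open>\<tau>\<close> along \<open>\<sigma>\<^sub>1 \<and> \<sigma>\<^sub>2\<close> is smooth, as it is a quotient of values of a fixed linear functional that
  does not vanish on \<open>\<sigma>\<^sub>1 \<and> \<sigma>\<^sub>2\<close> near \<open>x\<close>.
\<close>

lemma gauge_function:
  assumes \<tau>: "local_section A (\<lambda>y. wedge_span (f y) (f y)) UNIV \<tau>"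
  obtains h where "smooth_near A x h" "\<forall>\<^sub>F y in nhds x. \<tau> y = h y *\<^sub>R wedge (\<sigma>1 y) (\<sigma>2 y)"
proof -
  define ev where "ev B = ip (blinfun_apply B w1) w2" for B :: o42
  define N where "N y = ev (wedge (\<sigma>1 y) (\<sigma>2 y))" for y
  define h where "h y = inverse (N y) * ev (\<tau> y)" for y
  have ev: "bounded_linear ev"
    unfolding ev_def
    by (rule bounded_linear_compose[OF bounded_bilinear.bounded_linear_left[OF bounded_bilinear_ip]
          bounded_bilinear.bounded_linear_left[OF bounded_bilinear_blinfun_apply]])
  have N: "smooth_near A x N"
    unfolding N_def using smooth_sections
    by (intro smooth_near_linear[OF ev] smooth_near_bilinear[OF bounded_bilinear_wedge])
  have N0: "N x \<noteq> 0"
    using ip_frame by (simp add: N_def ev_def wedge_apply ip_simps)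
  have "smooth_near A x \<tau>" using \<tau> unfolding local_section_def by (blast intro: smooth_nearI)
  then have h: "smooth_near A x h"
    unfolding h_def
    by (intro smooth_near_bilinear[OF bounded_bilinear_mult] smooth_near_inverse[OF N N0] smooth_near_linear[OF ev])
  have "\<forall>\<^sub>F y in nhds x. N y \<noteq> 0"
    by (rule smooth_near_eventually_nonzero[OF N N0])
  then have "\<forall>\<^sub>F y in nhds x. \<tau> y = h y *\<^sub>R wedge (\<sigma>1 y) (\<sigma>2 y)"
    using frame_eventually
  proof eventually_elim
    case (elim y)
    interpret y: curvature_frame A f s1 s2 y \<sigma>1 \<sigma>2 X Y using elim by blast
    have "\<tau> y \<in> wedge_span (f y) (f y)" using \<tau> by (simp add: local_section_def)
    then obtain r where r: "\<tau> y = r *\<^sub>R wedge (\<sigma>1 y) (\<sigma>2 y)" using y.wedge_span_f_f by blast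
    have "ev (\<tau> y) = r * N y"
      unfolding r N_def by (simp add: linear_scale[OF bounded_linear.linear[OF ev]])
    then have "h y = r" using elim by (simp add: h_def)
    then show ?case using r by simp
  qed
  then show ?thesis using that h by blast
qed

lemma tder_gauge:
  assumes \<tau>: "local_section A (\<lambda>y. wedge_span (f y) (f y)) UNIV \<tau>"
  obtains b h where "\<And>V. tder A \<tau> x V = b V *\<^sub>R wedge (\<sigma>1 x) (\<sigma>2 x) +
    h *\<^sub>R (wedge (\<sigma>1 x) (tder A \<sigma>2 x V) + wedge (tder A \<sigma>1 x V) (\<sigma>2 x))"
proof -
  obtain h where h: "smooth_near A x h" "\<forall>\<^sub>F y in nhds x. \<tau> y = h y *\<^sub>R wedge (\<sigma>1 y) (\<sigma>2 y)"
    using gauge_function[OF \<tau>] .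
  have "tder A \<tau> x V = tder A h x V *\<^sub>R wedge (\<sigma>1 x) (\<sigma>2 x) +
      h x *\<^sub>R (wedge (\<sigma>1 x) (tder A \<sigma>2 x V) + wedge (tder A \<sigma>1 x V) (\<sigma>2 x))" for V
    unfolding tder_transform[OF h(2)]
    using h(1) smooth_sections
    by (simp add: tder_bilinear[OF bounded_bilinear_scaleR] tder_bilinear[OF bounded_bilinear_wedge]
        smooth_near_bilinear[OF bounded_bilinear_wedge])
  then show ?thesis using that by blast
qed

lemma f_wedge_perp_kills_f:
  assumes "B \<in> wedge_span (f x) (perp (f x))" "v \<in> f x"
  shows "blinfun_apply B v = 0"
proof -
  have "ip (blinfun_apply B v) d = 0" for d
    by (rule wedge_span_eq_0[OF assms(1)]) (use assms(2) ip_f in \<open>auto simp: perp_def ip_commute[of _ v]\<close>)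
  then show ?thesis by (rule ip_nondegenerate)
qed

text \<open>
  The endomorphism whose trace is \<open>q(V, W)\<close> is well defined: derivatives of sections with the same value at \<open>x\<close>
  differ by an element of \<open>f\<close>, which \<open>\<eta>(V)\<close> annihilates.
\<close>

lemma eta_d_eq:
  assumes B: "\<eta> x V \<in> wedge_span (f x) (perp (f x))" and W: "W \<in> tangent_space A x"
  shows "eta_d A f \<eta> x V W (r *\<^sub>R \<sigma>1 x + s *\<^sub>R \<sigma>2 x) =
    r *\<^sub>R blinfun_apply (\<eta> x V) (tder A \<sigma>1 x W) + s *\<^sub>R blinfun_apply (\<eta> x V) (tder A \<sigma>2 x W)" (is "_ = ?w")
proof -
  let ?\<rho> = "\<lambda>y. r *\<^sub>R \<sigma>1 y + s *\<^sub>R \<sigma>2 y"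
  have *: "blinfun_apply (\<eta> x V) (tder A \<sigma> x W) = ?w"
    if \<sigma>: "section_near A f x \<sigma>" "\<sigma> x = ?\<rho> x" for \<sigma>
  proof -
    have "blinfun_apply (\<eta> x V) (tder A \<sigma> x W - (r *\<^sub>R tder A \<sigma>1 x W + s *\<^sub>R tder A \<sigma>2 x W)) = 0"
      by (rule f_wedge_perp_kills_f[OF B tder_tensorial[OF \<sigma>(1) section_near_sections W \<sigma>(2)]])
    then show ?thesis by (simp add: blinfun.diff_right blinfun.add_right blinfun.scaleR_right)
  qed
  have \<rho>: "section_near A f x ?\<rho>"
    using section_near_combination[OF section_near_sections subspace_f] .
  show ?thesis
    unfolding eta_d_def
  proof (rule the_equality)
    show "\<exists>U \<sigma>. x \<in> U \<and> local_section A f U \<sigma> \<and> \<sigma> x = ?\<rho> x \<and>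
        ?w = blinfun_apply (\<eta> x V) (tder A \<sigma> x W)"
    proof -
      obtain U where "x \<in> U" "local_section A f U ?\<rho>" using \<rho> unfolding section_near_def by blast
      then show ?thesis using *[OF \<rho> refl] by (intro exI[of _ U] exI[of _ ?\<rho>]) simp
    qed
    fix w assume "\<exists>U \<sigma>. x \<in> U \<and> local_section A f U \<sigma> \<and> \<sigma> x = ?\<rho> x \<and>
      w = blinfun_apply (\<eta> x V) (tder A \<sigma> x W)"
    then show "w = ?w" using * unfolding section_near_def by blast
  qed
qed

end

subsection \<open>Its shape in a frame\<close>

locale middle_potential_surface = umbilic_free_legendre A f s1 s2
  for A :: "'m::{t2_space,second_countable_topology} chart set" and f s1 s2 +
  fixes \<eta> \<omega> :: "('m, o42) form1"
  assumes Omega: "Omega_surface A f \<eta>"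
    and middle: "middle_potential A f s1 s2 \<eta> \<omega>"
begin

lemma gauge_potential: "gauge_potential A f \<eta>"
  using Omega by (simp add: Omega_surface_def)

lemma \<eta>_in_wedge_span: "V \<in> tangent_space A x \<Longrightarrow> \<eta> x V \<in> wedge_span (f x) (perp (f x))"
  using gauge_potential by (simp add: gauge_potential_def)

lemma \<eta>_linear:
  assumes "V \<in> tangent_space A x" "W \<in> tangent_space A x"
  shows "\<eta> x (r *\<^sub>R V + s *\<^sub>R W) = r *\<^sub>R \<eta> x V + s *\<^sub>R \<eta> x W"
  using gauge_potential assms by (simp add: gauge_potential_def smooth_form1_def)

lemma obtain_gauge:
  obtains \<tau> where "local_section A (\<lambda>x. wedge_span (f x) (f x)) UNIV \<tau>"
    "\<forall>x. \<forall>V\<in>tangent_space A x. \<omega> x V = \<eta> x V - tder A \<tau> x V"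
proof -
  have "\<omega> \<in> gauge_orbit A f \<eta>" using middle by (simp add: middle_potential_def)
  then show ?thesis using that unfolding gauge_orbit_def by blast
qed

lemma \<omega>_linear:
  assumes "V \<in> tangent_space A x" "W \<in> tangent_space A x"
  shows "\<omega> x (r *\<^sub>R V + s *\<^sub>R W) = r *\<^sub>R \<omega> x V + s *\<^sub>R \<omega> x W"
proof -
  obtain \<tau> where \<tau>: "local_section A (\<lambda>x. wedge_span (f x) (f x)) UNIV \<tau>"
    "\<forall>x. \<forall>V\<in>tangent_space A x. \<omega> x V = \<eta> x V - tder A \<tau> x V"
    using obtain_gauge .
  have "smooth_near A x \<tau>" using \<tau>(1) unfolding local_section_def by (blast intro: smooth_nearI)
  then have lin: "linear (tder A \<tau> x)" by (rule linear_tder)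
  have "r *\<^sub>R V + s *\<^sub>R W \<in> tangent_space A x"
    using assms subspace_tangent_space by (intro subspace_add subspace_scale)
  note \<tau>V = \<tau>(2)[rule_format, OF assms(1)] \<tau>(2)[rule_format, OF assms(2)]
    \<tau>(2)[rule_format, OF this]
  show ?thesis
    unfolding \<tau>V \<eta>_linear[OF assms] linear_add[OF lin] linear_scale[OF lin]
    by (simp add: algebra_simps)
qed

end

locale middle_frame =
  curvature_frame A f s1 s2 x \<sigma>1 \<sigma>2 X Y + middle_potential_surface A f s1 s2 \<eta> \<omega>
  for A :: "'m::{t2_space,second_countable_topology} chart set" and f s1 s2 x \<sigma>1 \<sigma>2 X Y \<eta> \<omega>
begin

interpretation sw: curvature_frame A f s2 s1 x \<sigma>2 \<sigma>1 Y X by (rule swapped_frame)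

lemma perp_f_tder:
  assumes "V \<in> tangent_space A x"
  shows "tder A \<sigma>1 x V \<in> perp (f x)" "tder A \<sigma>2 x V \<in> perp (f x)"
  using tder_perp_f section_near_sections assms by blast+

lemma \<eta>_expansion:
  assumes V: "V \<in> tangent_space A x"
  obtains b h where "\<eta> x V = \<omega> x V + (b *\<^sub>R wedge (\<sigma>1 x) (\<sigma>2 x) +
    h *\<^sub>R (wedge (\<sigma>1 x) (tder A \<sigma>2 x V) + wedge (tder A \<sigma>1 x V) (\<sigma>2 x)))"
proof -
  obtain \<tau> where \<tau>: "local_section A (\<lambda>x. wedge_span (f x) (f x)) UNIV \<tau>"
    "\<forall>x. \<forall>V\<in>tangent_space A x. \<omega> x V = \<eta> x V - tder A \<tau> x V"
    using obtain_gauge .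
  obtain b h where bh: "\<And>V. tder A \<tau> x V = b V *\<^sub>R wedge (\<sigma>1 x) (\<sigma>2 x) +
    h *\<^sub>R (wedge (\<sigma>1 x) (tder A \<sigma>2 x V) + wedge (tder A \<sigma>1 x V) (\<sigma>2 x))"
    using tder_gauge[OF \<tau>(1)] by metis
  show ?thesis by (rule that[of "b V" h]) (simp add: bh[symmetric] \<tau>(2)[rule_format, OF V])
qed

lemma \<omega>_in_wedge_span:
  assumes V: "V \<in> tangent_space A x"
  shows "\<omega> x V \<in> wedge_span (f x) (perp (f x))"
proof -
  obtain b h where bh: "\<eta> x V = \<omega> x V + (b *\<^sub>R wedge (\<sigma>1 x) (\<sigma>2 x) +
    h *\<^sub>R (wedge (\<sigma>1 x) (tder A \<sigma>2 x V) + wedge (tder A \<sigma>1 x V) (\<sigma>2 x)))" (is "_ = _ + ?D")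
    using \<eta>_expansion[OF V] .
  have "\<sigma>2 x \<in> perp (f x)" using ip_f sections_mem(2) by (simp add: perp_def)
  then have "?D \<in> wedge_span (f x) (perp (f x))"
    unfolding wedge_swap[of "tder A \<sigma>1 x V"] using sections_mem perp_f_tder[OF V]
    by (intro subspace_add subspace_scale subspace_neg subspace_wedge_span wedge_in_wedge_span)
  moreover have "\<omega> x V = \<eta> x V - ?D" using bh by simp
  ultimately show ?thesis
    using subspace_diff[OF subspace_wedge_span \<eta>_in_wedge_span[OF V]] by simp
qed

lemma \<omega>_skew:
  assumes "V \<in> tangent_space A x"
  shows "ip (blinfun_apply (\<omega> x V) a) b = - ip a (blinfun_apply (\<omega> x V) b)"
  using wedge_span_skew[OF \<omega>_in_wedge_span[OF assms]] .

text \<open>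
  The coefficients of \<open>\<sigma>\<^sub>1 \<and> u\<^sub>1\<close> and \<open>\<sigma>\<^sub>2 \<and> u\<^sub>2\<close> in \<open>\<omega>(V)\<close>. They are read off from \<open>(\<sigma>\<^sub>1 \<and> u\<^sub>1) u\<^sub>1 = - (u\<^sub>1, u\<^sub>1) \<sigma>\<^sub>1\<close>
  and \<open>(\<sigma>\<^sub>1, w\<^sub>1) = - (u\<^sub>1, u\<^sub>1)\<close>.
\<close>

definition pcoeff :: "'m tvec \<Rightarrow> real" where
  "pcoeff V = ip (blinfun_apply (\<omega> x V) u1) w1 / (ip u1 u1)\<^sup>2"

definition qcoeff :: "'m tvec \<Rightarrow> real" where
  "qcoeff V = ip (blinfun_apply (\<omega> x V) u2) w2 / (ip u2 u2)\<^sup>2"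

lemma \<omega>_expansion:
  assumes V: "V \<in> tangent_space A x"
  obtains c where "\<omega> x V = c *\<^sub>R wedge (\<sigma>1 x) (\<sigma>2 x) + pcoeff V *\<^sub>R wedge (\<sigma>1 x) u1 +
    qcoeff V *\<^sub>R wedge (\<sigma>2 x) u2"
proof -
  have "mixed_component (cyclide_bundle A s1 T2 x) (cyclide_bundle A s2 T1 x) (\<omega> x V) \<in>
      wedge_span (f x) (f x)"
    using middle V unfolding middle_potential_def Let_def by blast
  then have mid: "mixed_component S1 S2 (\<omega> x V) \<in> wedge_span (span {\<sigma>1 x, \<sigma>2 x}) (span {\<sigma>1 x, \<sigma>2 x})"
    unfolding cyclide_bundle_eq sw.cyclide_bundle_eq f_eq_span .
  obtain c p q where *: "\<omega> x V = c *\<^sub>R wedge (\<sigma>1 x) (\<sigma>2 x) + p *\<^sub>R wedge (\<sigma>1 x) u1 +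
    q *\<^sub>R wedge (\<sigma>2 x) u2"
    using middle_expansion[OF \<omega>_in_wedge_span[OF V, unfolded f_eq_span] mid] .
  have "ip (blinfun_apply (\<omega> x V) u1) w1 = p * (ip u1 u1)\<^sup>2"
    "ip (blinfun_apply (\<omega> x V) u2) w2 = q * (ip u2 u2)\<^sup>2"
    unfolding * using ip_frame ip_\<sigma>1_w1 sw.ip_\<sigma>1_w1
    by (simp_all add: blinfun.add_left blinfun.scaleR_left wedge_apply ip_simps power2_eq_square)
  then have "p = pcoeff V" "q = qcoeff V"
    using ip_u1_u1 sw.ip_u1_u1 by (simp_all add: pcoeff_def qcoeff_def)
  then show ?thesis using that * by blast
qed

lemma coeff_linear:
  assumes "V \<in> tangent_space A x" "W \<in> tangent_space A x"
  shows "pcoeff (r *\<^sub>R V + s *\<^sub>R W) = r * pcoeff V + s * pcoeff W"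
    "qcoeff (r *\<^sub>R V + s *\<^sub>R W) = r * qcoeff V + s * qcoeff W"
  unfolding pcoeff_def qcoeff_def \<omega>_linear[OF assms]
  by (simp_all add: blinfun.add_left blinfun.scaleR_left ip_simps add_divide_distrib)

text \<open>
  If \<open>\<omega>(V) \<in> \<and>\<^sup>2f\<close>, then \<open>\<eta>(V)\<close> is \<open>h d\<^sub>V(\<sigma>\<^sub>1 \<and> \<sigma>\<^sub>2)\<close> modulo \<open>\<and>\<^sup>2f\<close>. Since \<open>d\<sigma>\<^sub>1\<close> and \<open>d\<sigma>\<^sub>2\<close> are orthogonal,
  the endomorphism \<open>\<sigma> \<mapsto> \<eta>(V) d\<^sub>W \<sigma>\<close> of \<open>f\<close> then maps \<open>s\<^sub>1\<close> into \<open>s\<^sub>2\<close> and \<open>s\<^sub>2\<close> into \<open>s\<^sub>1\<close>, and has trace 0.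
\<close>

lemma qform_eq_0:
  assumes V: "V \<in> tangent_space A x" and zero: "pcoeff V = 0" "qcoeff V = 0"
    and W: "W \<in> tangent_space A x"
  shows "qform A f \<eta> x V W = 0"
proof -
  obtain b h where bh: "\<eta> x V = \<omega> x V + (b *\<^sub>R wedge (\<sigma>1 x) (\<sigma>2 x) +
    h *\<^sub>R (wedge (\<sigma>1 x) (tder A \<sigma>2 x V) + wedge (tder A \<sigma>1 x V) (\<sigma>2 x)))" (is "_ = _ + ?D")
    using \<eta>_expansion[OF V] .
  obtain c where c: "\<omega> x V = c *\<^sub>R wedge (\<sigma>1 x) (\<sigma>2 x)"
    using \<omega>_expansion[OF V] zero by auto
  have \<eta>: "\<eta> x V = (c + b) *\<^sub>R wedge (\<sigma>1 x) (\<sigma>2 x) +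
    h *\<^sub>R (wedge (\<sigma>1 x) (tder A \<sigma>2 x V) + wedge (tder A \<sigma>1 x V) (\<sigma>2 x))"
    using c bh by (simp add: algebra_simps)
  note orth = ip_f_tder[OF section_near_sections(1) W] ip_f_tder[OF section_near_sections(2) W] sections_mem
    ip_tder_\<sigma>1_tder_\<sigma>2[OF V W] ip_tder_\<sigma>1_tder_\<sigma>2[OF W V]
  have "ip (tder A \<sigma>2 x V) (tder A \<sigma>1 x W) = 0"
    using ip_tder_\<sigma>1_tder_\<sigma>2[OF W V] ip_commute by simp
  then have 1: "blinfun_apply (\<eta> x V) (tder A \<sigma>1 x W) = (h * ip (tder A \<sigma>1 x V) (tder A \<sigma>1 x W)) *\<^sub>R \<sigma>2 x"
    unfolding \<eta> using orth
    by (simp add: blinfun.add_left blinfun.scaleR_left wedge_apply)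
  have 2: "blinfun_apply (\<eta> x V) (tder A \<sigma>2 x W) = (- h * ip (tder A \<sigma>2 x V) (tder A \<sigma>2 x W)) *\<^sub>R \<sigma>1 x"
    unfolding \<eta> using orth
    by (simp add: blinfun.add_left blinfun.scaleR_left wedge_apply)
  show ?thesis
    unfolding qform_def
    by (rule trace_on_offdiagonal[OF f_eq_span independent_sections])
      (simp_all only: eta_d_eq[where \<eta> = \<eta> and V = V, OF \<eta>_in_wedge_span[OF V] W] 1 2)
qed

text \<open>
  The two linear forms have no common zero in the tangent plane, so neither vanishes. The vectors \<open>?V\<close> and \<open>?W\<close> below
  span the kernels of \<open>q\<close> and \<open>p\<close>, unless those are the whole plane.
\<close>

lemma coeffs_nonzero:
  assumes nd: "nondegenerate_on (tangent_space A x) (qform A f \<eta> x)"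
  obtains V W where "V \<in> tangent_space A x" "pcoeff V \<noteq> 0" "W \<in> tangent_space A x" "qcoeff W \<noteq> 0"
proof -
  have nz: "V = 0" if "V \<in> tangent_space A x" "pcoeff V = 0" "qcoeff V = 0" for V
    using nd that qform_eq_0[OF that] unfolding nondegenerate_on_def by blast
  let ?V = "qcoeff (Y x) *\<^sub>R X x + (- qcoeff (X x)) *\<^sub>R Y x"
  let ?W = "pcoeff (Y x) *\<^sub>R X x + (- pcoeff (X x)) *\<^sub>R Y x"
  have tan: "r *\<^sub>R X x + s *\<^sub>R Y x \<in> tangent_space A x" for r s
    using X_at Y_at subspace_tangent_space by (intro subspace_add subspace_scale)
  have "qcoeff ?V = 0" "pcoeff ?W = 0"
    by (simp_all only: coeff_linear[OF X_at(3) Y_at(3)]) simp_all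
  then have "?V = 0 \<or> pcoeff ?V \<noteq> 0" "?W = 0 \<or> qcoeff ?W \<noteq> 0"
    using nz[OF tan] by blast+
  have ind: "r = 0 \<and> s = 0" if zero: "r *\<^sub>R X x + s *\<^sub>R Y x = 0" for r s
  proof -
    have "r *\<^sub>R tder A \<sigma>1 x (X x) + s *\<^sub>R u1 = tder A \<sigma>1 x (r *\<^sub>R X x + s *\<^sub>R Y x)"
      "r *\<^sub>R u2 + s *\<^sub>R tder A \<sigma>2 x (Y x) = tder A \<sigma>2 x (r *\<^sub>R X x + s *\<^sub>R Y x)"
      using linear_tder[OF smooth_sections(1)] linear_tder[OF smooth_sections(2)]
      by (simp_all add: linear_add linear_scale)
    then have "r *\<^sub>R tder A \<sigma>1 x (X x) + s *\<^sub>R u1 = 0" "r *\<^sub>R u2 + s *\<^sub>R tder A \<sigma>2 x (Y x) = 0"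
      unfolding zero using linear_0[OF linear_tder[OF smooth_sections(1)]]
        linear_0[OF linear_tder[OF smooth_sections(2)]] by simp_all
    then have "ip (r *\<^sub>R tder A \<sigma>1 x (X x) + s *\<^sub>R u1) u1 = 0"
      "ip (r *\<^sub>R u2 + s *\<^sub>R tder A \<sigma>2 x (Y x)) u2 = 0" by (simp_all add: ip_simps)
    then show ?thesis
      using ip_f_u1[OF tder_\<sigma>1_X] sw.ip_f_u1[OF sw.tder_\<sigma>1_X] ip_u1_u1 sw.ip_u1_u1
      by (simp add: ip_simps)
  qed
  have "\<exists>V\<in>tangent_space A x. pcoeff V \<noteq> 0"
  proof (rule ccontr)
    assume none: "\<not> ?thesis"
    then have "?V = 0" using \<open>?V = 0 \<or> pcoeff ?V \<noteq> 0\<close> tan by blast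
    then have "qcoeff (X x) = 0" using ind[of "qcoeff (Y x)" "- qcoeff (X x)"] by simp
    then show False using nz[OF X_at(3)] none X_at by blast
  qed
  moreover have "\<exists>W\<in>tangent_space A x. qcoeff W \<noteq> 0"
  proof (rule ccontr)
    assume none: "\<not> ?thesis"
    then have "?W = 0" using \<open>?W = 0 \<or> qcoeff ?W \<noteq> 0\<close> tan by blast
    then have "pcoeff (X x) = 0" using ind[of "pcoeff (Y x)" "- pcoeff (X x)"] by simp
    then show False using nz[OF X_at(3)] none X_at by blast
  qed
  ultimately show ?thesis using that by blast
qed

end

section \<open>Linear conserved quantities\<close>

context middle_potential_surface
begin

lemma obtain_middle_frame:
  obtains \<sigma>1 \<sigma>2 X Y where "middle_frame A f s1 s2 x \<sigma>1 \<sigma>2 X Y \<eta> \<omega>"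
proof -
  obtain \<sigma>1 \<sigma>2 X Y where F: "curvature_frame A f s1 s2 x \<sigma>1 \<sigma>2 X Y"
    using obtain_curvature_frame .
  interpret curvature_frame A f s1 s2 x \<sigma>1 \<sigma>2 X Y by (rule F)
  have "middle_frame A f s1 s2 x \<sigma>1 \<sigma>2 X Y \<eta> \<omega>" ..
  then show ?thesis by (rule that)
qed

abbreviation "conserved \<equiv> linear_conserved_quantity A \<omega>"

lemma smooth_conserved:
  assumes "conserved \<alpha>"
  shows "smooth_near A x (fst \<alpha>)" "smooth_near A x (snd \<alpha>)"
    "smooth_map_on A UNIV (fst \<alpha>)" "smooth_map_on A UNIV (snd \<alpha>)"
  using assms smooth_nearI[OF _ open_UNIV] unfolding linear_conserved_quantity_def by blast+

text \<open>The coefficients of the quadratic polynomial \<open>(d + t \<omega>)(p\<^sub>0 + t p\<^sub>1)\<close> in \<open>t\<close>.\<close>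

lemma conservation_laws:
  assumes \<alpha>: "conserved \<alpha>" and V: "V \<in> tangent_space A x"
  shows "tder A (fst \<alpha>) x V = 0"
    "tder A (snd \<alpha>) x V = - blinfun_apply (\<omega> x V) (fst \<alpha> x)"
    "blinfun_apply (\<omega> x V) (snd \<alpha> x) = 0"
proof -
  let ?d0 = "tder A (fst \<alpha>) x V" and ?d1 = "tder A (snd \<alpha>) x V"
    and ?e0 = "blinfun_apply (\<omega> x V) (fst \<alpha> x)" and ?e1 = "blinfun_apply (\<omega> x V) (snd \<alpha> x)"
  have *: "?d0 + t *\<^sub>R (?d1 + ?e0) + t *\<^sub>R t *\<^sub>R ?e1 = 0" for t
  proof -
    have "tder A (at_param t \<alpha>) x V + t *\<^sub>R blinfun_apply (\<omega> x V) (at_param t \<alpha> x) = 0"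
      using \<alpha> V unfolding linear_conserved_quantity_def by blast
    moreover have "tder A (at_param t \<alpha>) x V = 1 *\<^sub>R ?d0 + t *\<^sub>R ?d1"
      using tder_combination[OF smooth_conserved(1,2)[OF \<alpha>], where r = 1 and s = t and X = V] by (simp add: at_param_def)
    ultimately show ?thesis
      by (simp add: at_param_def blinfun.add_right blinfun.scaleR_right algebra_simps)
  qed
  from *[of 0] show d0: "?d0 = 0" by simp
  from *[of 1] *[of "-1"] have "?d1 + ?e0 + ?e1 = 0" "- (?d1 + ?e0) + ?e1 = 0"
    by (simp_all add: d0)
  moreover have "2 *\<^sub>R ?e1 = (?d1 + ?e0 + ?e1) + (- (?d1 + ?e0) + ?e1)"
    by (simp add: scaleR_2)
  ultimately have "?e1 = 0" "?d1 + ?e0 = 0" by simp_all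
  then show "?d1 = - ?e0" "?e1 = 0" by (simp_all add: eq_neg_iff_add_eq_0)
qed

end

context middle_frame
begin

interpretation sw: curvature_frame A f s2 s1 x \<sigma>2 \<sigma>1 Y X by (rule swapped_frame)

text \<open>
  The components of \<open>\<omega>(V) p\<^sub>1 = 0\<close> along \<open>u\<^sub>1\<close> and \<open>u\<^sub>2\<close> show \<open>(\<sigma>\<^sub>i, p\<^sub>1) = 0\<close>; those along \<open>\<sigma>\<^sub>1\<close> and \<open>\<sigma>\<^sub>2\<close> then show
  \<open>(u\<^sub>i, p\<^sub>1) = 0\<close>.
\<close>

lemma top_coefficient_in_f_generic:
  assumes nd: "nondegenerate_on (tangent_space A x) (qform A f \<eta> x)" and \<alpha>: "conserved \<alpha>"
  shows "snd \<alpha> x \<in> f x"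
proof -
  let ?v = "snd \<alpha> x"
  have *: "pcoeff V * ip (\<sigma>1 x) ?v = 0 \<and> qcoeff V * ip (\<sigma>2 x) ?v = 0 \<and>
      (ip (\<sigma>1 x) ?v = 0 \<longrightarrow> ip (\<sigma>2 x) ?v = 0 \<longrightarrow> pcoeff V * ip u1 ?v = 0 \<and> qcoeff V * ip u2 ?v = 0)"
    if V: "V \<in> tangent_space A x" for V
  proof -
    obtain c where c: "\<omega> x V = c *\<^sub>R wedge (\<sigma>1 x) (\<sigma>2 x) + pcoeff V *\<^sub>R wedge (\<sigma>1 x) u1 +
      qcoeff V *\<^sub>R wedge (\<sigma>2 x) u2"
      using \<omega>_expansion[OF V] .
    have e: "ip (blinfun_apply (\<omega> x V) ?v) d = 0" for d
      using conservation_laws(3)[OF \<alpha> V] by (simp add: ip_simps)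
    have "pcoeff V * ip (\<sigma>1 x) ?v = 0" "qcoeff V * ip (\<sigma>2 x) ?v = 0"
      using e[of u1] e[of u2] ip_frame unfolding c
      by (simp_all add: blinfun.add_left blinfun.scaleR_left wedge_apply ip_simps)
    moreover have "pcoeff V * ip u1 ?v = 0" "qcoeff V * ip u2 ?v = 0"
      if "ip (\<sigma>1 x) ?v = 0" "ip (\<sigma>2 x) ?v = 0"
      using e[of w1] e[of w2] that ip_frame unfolding c
      by (simp_all add: blinfun.add_left blinfun.scaleR_left wedge_apply ip_simps)
    ultimately show ?thesis by blast
  qed
  obtain V W where VW: "V \<in> tangent_space A x" "pcoeff V \<noteq> 0" "W \<in> tangent_space A x" "qcoeff W \<noteq> 0"
    using coeffs_nonzero[OF nd] .
  then have "ip (\<sigma>1 x) ?v = 0" "ip (\<sigma>2 x) ?v = 0" using *[of V] *[of W] by simp_all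
  moreover from this have "ip u1 ?v = 0" "ip u2 ?v = 0" using *[of V] *[of W] VW by simp_all
  ultimately obtain r s where "?v = r *\<^sub>R \<sigma>1 x + s *\<^sub>R \<sigma>2 x"
    using perp_a_u_imp_in_span_a[of ?v] ip_commute by metis
  then show ?thesis unfolding f_eq_span in_span_2 by blast
qed

text \<open>Being in \<open>f\<close> is a closed condition: \<open>v \<in> f\<close> iff \<open>v\<close> is a null vector orthogonal to \<open>f\<close>.\<close>

lemma top_coefficient_in_f:
  assumes \<alpha>: "conserved \<alpha>"
  shows "snd \<alpha> x \<in> f x"
proof -
  obtain D where D: "open D" "closure D = UNIV"
    "\<And>y. y \<in> D \<Longrightarrow> nondegenerate_on (tangent_space A y) (qform A f \<eta> y)"
    using Omega unfolding Omega_surface_def by blast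
  have zero: "g x = 0"
    if g: "smooth_near A x g" "\<forall>\<^sub>F y in nhds x. snd \<alpha> y \<in> f y \<longrightarrow> g y = 0" for g :: "'m \<Rightarrow> real"
  proof (rule ccontr)
    assume "g x \<noteq> 0"
    then have "\<forall>\<^sub>F y in nhds x. g y \<noteq> 0"
      by (rule smooth_near_eventually_nonzero[OF g(1)])
    then have "\<forall>\<^sub>F y in nhds x. y \<notin> D"
      using g(2)
    proof eventually_elim
      case (elim y)
      obtain \<sigma>1' \<sigma>2' X' Y' where "middle_frame A f s1 s2 y \<sigma>1' \<sigma>2' X' Y' \<eta> \<omega>"
        using obtain_middle_frame .
      then show ?case using elim middle_frame.top_coefficient_in_f_generic[OF _ D(3) \<alpha>] by blast
    qed
    then obtain U where "open U" "x \<in> U" "U \<inter> D = {}" unfolding eventually_nhds by blast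
    then have "x \<notin> closure D" using open_Int_closure_eq_empty by blast
    then show False using D(2) by blast
  qed
  have sm: "smooth_near A x (\<lambda>y. ip (\<sigma> y) (snd \<alpha> y))" if "smooth_near A x \<sigma>" for \<sigma>
    using that smooth_conserved(2)[OF \<alpha>] by (intro smooth_near_bilinear[OF bounded_bilinear_ip])
  have "ip (\<sigma>1 x) (snd \<alpha> x) = 0"
    by (rule zero[OF sm[OF smooth_sections(1)] eventually_mono[OF section_near_eventually[OF section_near_sections(1)]]])
      (blast intro: ip_f section_near_mem)
  moreover have "ip (\<sigma>2 x) (snd \<alpha> x) = 0"
    by (rule zero[OF sm[OF smooth_sections(2)] eventually_mono[OF section_near_eventually[OF section_near_sections(2)]]])
      (blast intro: ip_f section_near_mem)
  ultimately have "snd \<alpha> x \<in> perp (f x)"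
    unfolding f_eq_span in_perp_a by (simp add: ip_commute)
  moreover have "ip (snd \<alpha> x) (snd \<alpha> x) = 0"
    by (rule zero[OF sm[OF smooth_conserved(2)[OF \<alpha>]]]) (simp add: ip_f)
  ultimately show ?thesis
    by (rule null_perp_isotropic[OF subspace_f dim_f isotropic_f])
qed

text \<open>
  Modulo \<open>f\<close>, the equation \<open>dp\<^sub>1 = - \<omega> p\<^sub>0\<close> along \<open>T\<^sub>2\<close> and \<open>T\<^sub>1\<close> determines the components of \<open>p\<^sub>1\<close> in \<open>s\<^sub>1\<close> and
  \<open>s\<^sub>2\<close>. The coefficients \<open>- p(Y)\<close> and \<open>- q(X)\<close> are the same for all conserved quantities.
\<close>

lemma top_coefficient_eq:
  assumes \<alpha>: "conserved \<alpha>"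
  shows "snd \<alpha> x = (- pcoeff (Y x) * ip (\<sigma>1 x) (fst \<alpha> x)) *\<^sub>R \<sigma>1 x +
    (- qcoeff (X x) * ip (\<sigma>2 x) (fst \<alpha> x)) *\<^sub>R \<sigma>2 x"
proof -
  obtain r s where rs: "snd \<alpha> x = r *\<^sub>R \<sigma>1 x + s *\<^sub>R \<sigma>2 x"
    using top_coefficient_in_f[OF \<alpha>] unfolding f_eq_span in_span_2 by blast
  have sec: "section_near A f x (snd \<alpha>)"
    unfolding section_near_iff
  proof
    show "\<forall>\<^sub>F y in nhds x. snd \<alpha> y \<in> f y"
    proof (rule always_eventually, rule allI)
      fix y
      obtain \<sigma>1' \<sigma>2' X' Y' where "middle_frame A f s1 s2 y \<sigma>1' \<sigma>2' X' Y' \<eta> \<omega>"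
        using obtain_middle_frame .
      then show "snd \<alpha> y \<in> f y" using middle_frame.top_coefficient_in_f \<alpha> by blast
    qed
  qed (rule smooth_conserved(2)[OF \<alpha>])
  have ipd: "ip (tder A (snd \<alpha>) x V) u = r * ip (tder A \<sigma>1 x V) u + s * ip (tder A \<sigma>2 x V) u"
    if V: "V \<in> tangent_space A x" and u: "\<And>v. v \<in> f x \<Longrightarrow> ip v u = 0" for V u
    using u[OF tder_tensorial[OF sec section_near_sections V rs]] by (simp add: ip_simps)
  obtain c where c: "\<omega> x (Y x) = c *\<^sub>R wedge (\<sigma>1 x) (\<sigma>2 x) + pcoeff (Y x) *\<^sub>R wedge (\<sigma>1 x) u1 +
    qcoeff (Y x) *\<^sub>R wedge (\<sigma>2 x) u2"
    using \<omega>_expansion[OF Y_at(3)] .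
  have "r * ip u1 u1 = - (pcoeff (Y x) * ip (\<sigma>1 x) (fst \<alpha> x)) * ip u1 u1"
    using ipd[OF Y_at(3) ip_f_u1] ip_f_u1[OF sw.tder_\<sigma>1_X] ip_frame
    unfolding conservation_laws(2)[OF \<alpha> Y_at(3)] c
    by (simp add: blinfun.add_left blinfun.scaleR_left wedge_apply ip_simps)
  then have r: "r = - (pcoeff (Y x) * ip (\<sigma>1 x) (fst \<alpha> x))"
    using mult_right_cancel[OF ip_u1_u1] by blast
  obtain c' where c': "\<omega> x (X x) = c' *\<^sub>R wedge (\<sigma>1 x) (\<sigma>2 x) + pcoeff (X x) *\<^sub>R wedge (\<sigma>1 x) u1 +
    qcoeff (X x) *\<^sub>R wedge (\<sigma>2 x) u2"
    using \<omega>_expansion[OF X_at(3)] .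
  have "s * ip u2 u2 = - (qcoeff (X x) * ip (\<sigma>2 x) (fst \<alpha> x)) * ip u2 u2"
    using ipd[OF X_at(3) sw.ip_f_u1] sw.ip_f_u1[OF tder_\<sigma>1_X] ip_frame
    unfolding conservation_laws(2)[OF \<alpha> X_at(3)] c'
    by (simp add: blinfun.add_left blinfun.scaleR_left wedge_apply ip_simps)
  then have "s = - (qcoeff (X x) * ip (\<sigma>2 x) (fst \<alpha> x))"
    using mult_right_cancel[OF sw.ip_u1_u1] by blast
  then show ?thesis using rs r by simp
qed

end

context middle_potential_surface
begin

lemma conserved_in_f: "conserved \<alpha> \<Longrightarrow> snd \<alpha> x \<in> f x"
  by (rule obtain_middle_frame[of x]) (rule middle_frame.top_coefficient_in_f)

lemma conserved_pairing_symmetric: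
  assumes "conserved \<alpha>" "conserved \<beta>"
  shows "ip (fst \<alpha> x) (snd \<beta> x) = ip (fst \<beta> x) (snd \<alpha> x)"
proof -
  obtain \<sigma>1 \<sigma>2 X Y where "middle_frame A f s1 s2 x \<sigma>1 \<sigma>2 X Y \<eta> \<omega>"
    using obtain_middle_frame .
  then interpret middle_frame A f s1 s2 x \<sigma>1 \<sigma>2 X Y \<eta> \<omega> .
  show ?thesis
    unfolding top_coefficient_eq[OF assms(1)] top_coefficient_eq[OF assms(2)]
    by (simp add: ip_simps ip_commute)
qed

text \<open>The derivative is \<open>- (\<alpha>\<^sub>0, \<omega> \<beta>\<^sub>0) - (\<beta>\<^sub>0, \<omega> \<alpha>\<^sub>0)\<close>, which vanishes as \<open>\<omega>\<close> is skew.\<close>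

lemma g_inf_constant:
  assumes conn: "connected (UNIV :: 'm set)" and \<alpha>: "conserved \<alpha>" and \<beta>: "conserved \<beta>"
  shows "g_inf x \<alpha> \<beta> = g_inf z \<alpha> \<beta>"
proof (rule constant_if_tder_zero[OF conn, where h = "\<lambda>x. g_inf x \<alpha> \<beta>"])
  show "smooth_map_on A UNIV (\<lambda>x. g_inf x \<alpha> \<beta>)"
    unfolding g_inf_def using smooth_conserved(3,4)[OF \<alpha>] smooth_conserved(3,4)[OF \<beta>]
    by (intro smooth_map_on_add smooth_map_on_bilinear[OF bounded_bilinear_ip] open_UNIV)
  fix y V assume V: "V \<in> tangent_space A y"
  obtain \<sigma>1 \<sigma>2 X Y where "middle_frame A f s1 s2 y \<sigma>1 \<sigma>2 X Y \<eta> \<omega>"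
    using obtain_middle_frame .
  then interpret middle_frame A f s1 s2 y \<sigma>1 \<sigma>2 X Y \<eta> \<omega> .
  show "tder A (\<lambda>x. g_inf x \<alpha> \<beta>) y V = 0"
    unfolding g_inf_def
    using smooth_conserved(1,2)[OF \<alpha>] smooth_conserved(1,2)[OF \<beta>] \<omega>_skew[OF V, of "fst \<alpha> y" "fst \<beta> y"]
    by (simp add: tder_add tder_bilinear[OF bounded_bilinear_ip] smooth_near_bilinear[OF bounded_bilinear_ip]
        conservation_laws[OF \<alpha> V] conservation_laws[OF \<beta> V] ip_simps ip_commute)
qed

lemma conserved_pairing:
  assumes "connected (UNIV :: 'm set)" "conserved \<alpha>" "conserved \<beta>"
  shows "ip (fst \<alpha> x) (snd \<beta> x) = g_inf z \<alpha> \<beta> / 2"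
  using g_inf_constant[OF assms, of x z] conserved_pairing_symmetric[OF assms(2,3), of x]
  by (simp add: g_inf_def)

end

section \<open>The symmetric square of a plane\<close>

text \<open>
  For a plane in an infinite-dimensional space, such as one of polynomials with functions as coefficients.
\<close>

lemma plane_eq_span:
  fixes P :: "'v::real_vector set"
  assumes P: "subspace P" "dim P = 2" and mem: "\<alpha> \<in> P" "\<beta> \<in> P"
    and ind: "\<And>r s. r *\<^sub>R \<alpha> + s *\<^sub>R \<beta> = 0 \<Longrightarrow> r = 0 \<and> s = 0"
  shows "P = span {\<alpha>, \<beta>}"
proof
  show "span {\<alpha>, \<beta>} \<subseteq> P" using P(1) mem by (intro span_minimal) auto
  show "P \<subseteq> span {\<alpha>, \<beta>}"
  proof (rule ccontr)
    assume "\<not> P \<subseteq> span {\<alpha>, \<beta>}"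
    then obtain \<gamma> where \<gamma>: "\<gamma> \<in> P" "\<gamma> \<notin> span {\<alpha>, \<beta>}" by blast
    have "\<beta> \<noteq> 0" using ind[of 0 1] by auto
    moreover have "\<alpha> \<noteq> k *\<^sub>R \<beta>" for k using ind[of 1 "- k"] by auto
    then have "\<alpha> \<notin> span {\<beta>}" by (auto simp: span_singleton)
    ultimately have "independent {\<alpha>, \<beta>}" "\<alpha> \<noteq> \<beta>"
      by (auto simp: independent_insert span_base)
    moreover have "\<gamma> \<noteq> \<alpha>" "\<gamma> \<noteq> \<beta>" using \<gamma>(2) span_base[of _ "{\<alpha>, \<beta>}"] by auto
    ultimately have 3: "independent {\<gamma>, \<alpha>, \<beta>}" "card {\<gamma>, \<alpha>, \<beta>} = 3"
      using \<gamma>(2) by (auto simp: independent_insert[of \<gamma>])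
    obtain B where B: "B \<subseteq> P" "independent B" "P \<subseteq> span B" "card B = 2"
      using basis_exists[of P] P(2) by metis
    have "finite B" using B(4) by (simp add: card_ge_0_finite)
    then have "card {\<gamma>, \<alpha>, \<beta>} \<le> card B"
      using 3(1) B(3) \<gamma>(1) mem independent_span_bound[of B "{\<gamma>, \<alpha>, \<beta>}"] by blast
    then show False using 3(2) B(4) by simp
  qed
qed

lemma odot_combination:
  "(r *\<^sub>R v + s *\<^sub>R w) \<odot> (r' *\<^sub>R v + s' *\<^sub>R w) =
    (r * r') *\<^sub>R (v \<odot> v) + (r * s' + s * r') *\<^sub>R (v \<odot> w) + (s * s') *\<^sub>R (w \<odot> w)"
  by (auto simp: odot_def fun_eq_iff scaleR_fun_def plus_fun_def linear_add linear_scale field_simps)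

lemma sym_square_span:
  assumes "\<Xi> \<in> sym_square (span {v, w})"
  obtains x y z where "\<Xi> = x *\<^sub>R (v \<odot> v) + y *\<^sub>R (v \<odot> w) + z *\<^sub>R (w \<odot> w)"
proof -
  have "\<exists>x y z. \<Xi> = x *\<^sub>R (v \<odot> v) + y *\<^sub>R (v \<odot> w) + z *\<^sub>R (w \<odot> w)"
    using assms unfolding sym_square_def
  proof (induction rule: span_induct_alt)
    case base
    show ?case by (intro exI[of _ 0]) simp
  next
    case (step c \<Theta> \<Xi>)
    then obtain a b x y z where ab: "a \<in> span {v, w}" "b \<in> span {v, w}" "\<Theta> = a \<odot> b"
      and \<Xi>: "\<Xi> = x *\<^sub>R (v \<odot> v) + y *\<^sub>R (v \<odot> w) + z *\<^sub>R (w \<odot> w)" by blast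
    obtain r s r' s' where "a = r *\<^sub>R v + s *\<^sub>R w" "b = r' *\<^sub>R v + s' *\<^sub>R w"
      using ab(1,2) unfolding in_span_2 by blast
    then have "c *\<^sub>R \<Theta> + \<Xi> = (c * (r * r') + x) *\<^sub>R (v \<odot> v) + (c * (r * s' + s * r') + y) *\<^sub>R (v \<odot> w) +
        (c * (s * s') + z) *\<^sub>R (w \<odot> w)"
      unfolding ab(3) \<Xi> by (simp only: odot_combination) (simp add: algebra_simps)
    then show ?case by blast
  qed
  then show ?thesis using that by blast
qed

lemma g_inf_commute: "g_inf z \<gamma> \<delta> = g_inf z \<delta> \<gamma>"
  by (simp add: g_inf_def add.commute)

lemma g_inf_combination:
  "g_inf z (r *\<^sub>R \<gamma> + s *\<^sub>R \<delta>) \<epsilon> = r * g_inf z \<gamma> \<epsilon> + s * g_inf z \<delta> \<epsilon>"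
  "g_inf z \<epsilon> (r *\<^sub>R \<gamma> + s *\<^sub>R \<delta>) = r * g_inf z \<epsilon> \<gamma> + s * g_inf z \<epsilon> \<delta>"
  unfolding g_inf_commute[of z \<epsilon>]
  by (simp_all add: linear_add[OF linear_g_inf] linear_scale[OF linear_g_inf])

text \<open>
  In a basis, \<open>\<phi>\<^sub>\<infinity>\<close> is the congruence \<open>\<Theta> \<mapsto> g \<Theta> g\<close> by the Gram matrix of \<open>g\<^sub>\<infinity>\<close>. So it is injective, and the
  preimage of \<open>g\<^sub>\<infinity>\<close> is the inverse of \<open>g\<close>.
\<close>

lemma phi_inf_inverse:
  fixes P :: "'m lpoly set" and \<alpha> \<beta> :: "'m lpoly" and z :: 'm
  defines "g \<equiv> g_inf z"
  defines "d \<equiv> g \<alpha> \<alpha> * g \<beta> \<beta> - (g \<alpha> \<beta>)\<^sup>2"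
  assumes P: "P = span {\<alpha>, \<beta>}" and d: "d \<noteq> 0"
  shows "the_inv_into (sym_square P) (phi_inf P z) (form_on P g) =
    (g \<beta> \<beta> / d) *\<^sub>R (\<alpha> \<odot> \<alpha>) + (2 * (- g \<alpha> \<beta> / d)) *\<^sub>R (\<alpha> \<odot> \<beta>) + (g \<alpha> \<alpha> / d) *\<^sub>R (\<beta> \<odot> \<beta>)" (is "_ = ?\<Theta>")
proof -
  note sym = g_inf_commute[of z, folded g_def] and lin = g_inf_combination[of z, folded g_def]
  have mem: "\<alpha> \<in> P" "\<beta> \<in> P" unfolding P by (auto intro: span_base)
  have comb: "r *\<^sub>R \<alpha> + s *\<^sub>R \<beta> \<in> P" for r s unfolding P in_span_2 by blast
  have phi: "phi_inf P z (a *\<^sub>R (\<alpha> \<odot> \<alpha>) + b *\<^sub>R (\<alpha> \<odot> \<beta>) + c *\<^sub>R (\<beta> \<odot> \<beta>)) \<gamma> \<delta> =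
      a * (g \<alpha> \<gamma> * g \<alpha> \<delta>) + b * ((g \<alpha> \<gamma> * g \<beta> \<delta> + g \<alpha> \<delta> * g \<beta> \<gamma>) / 2) + c * (g \<beta> \<gamma> * g \<beta> \<delta>)"
    if "\<gamma> \<in> P" "\<delta> \<in> P" for a b c \<gamma> \<delta>
    unfolding linear_add[OF linear_phi_inf] linear_scale[OF linear_phi_inf]
    by (simp add: plus_fun_def scaleR_fun_def phi_inf_odot[OF that] g_def)
  have inj: "inj_on (phi_inf P z) (sym_square P)"
  proof (rule linear_inj_on_iff_eq_0[OF linear_phi_inf, THEN iffD2])
    show "subspace (sym_square P)" unfolding sym_square_def by (rule subspace_span)
    show "\<forall>\<Xi>\<in>sym_square P. phi_inf P z \<Xi> = 0 \<longrightarrow> \<Xi> = 0"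
    proof (intro ballI impI)
      fix \<Xi> assume \<Xi>: "\<Xi> \<in> sym_square P" "phi_inf P z \<Xi> = 0"
      obtain a b c where abc: "\<Xi> = a *\<^sub>R (\<alpha> \<odot> \<alpha>) + b *\<^sub>R (\<alpha> \<odot> \<beta>) + c *\<^sub>R (\<beta> \<odot> \<beta>)"
        using sym_square_span \<Xi>(1) unfolding P by metis
      define \<alpha>' where "\<alpha>' = (g \<beta> \<beta> / d) *\<^sub>R \<alpha> + (- g \<alpha> \<beta> / d) *\<^sub>R \<beta>"
      define \<beta>' where "\<beta>' = (- g \<alpha> \<beta> / d) *\<^sub>R \<alpha> + (g \<alpha> \<alpha> / d) *\<^sub>R \<beta>"
      have dual: "g \<alpha> \<alpha>' = 1" "g \<beta> \<alpha>' = 0" "g \<alpha> \<beta>' = 0" "g \<beta> \<beta>' = 1"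
      proof -
        have "g \<beta> \<beta> * g \<alpha> \<alpha> - g \<alpha> \<beta> * g \<alpha> \<beta> = d" by (simp add: d_def power2_eq_square)
        moreover have "g \<alpha> \<alpha>' = (g \<beta> \<beta> * g \<alpha> \<alpha> - g \<alpha> \<beta> * g \<alpha> \<beta>) / d"
          "g \<beta> \<beta>' = (g \<beta> \<beta> * g \<alpha> \<alpha> - g \<alpha> \<beta> * g \<alpha> \<beta>) / d"
          unfolding \<alpha>'_def \<beta>'_def lin sym[of \<beta> \<alpha>] by (simp_all add: diff_divide_distrib mult.commute)
        ultimately show "g \<alpha> \<alpha>' = 1" "g \<beta> \<beta>' = 1" using d by simp_all
        show "g \<beta> \<alpha>' = 0" "g \<alpha> \<beta>' = 0"
          unfolding \<alpha>'_def \<beta>'_def lin sym[of \<beta> \<alpha>] by simp_all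
      qed
      have mem': "\<alpha>' \<in> P" "\<beta>' \<in> P" unfolding \<alpha>'_def \<beta>'_def by (rule comb)+
      have "phi_inf P z \<Xi> \<alpha>' \<alpha>' = 0" "phi_inf P z \<Xi> \<alpha>' \<beta>' = 0" "phi_inf P z \<Xi> \<beta>' \<beta>' = 0"
        unfolding \<Xi>(2) by simp_all
      then have "a = 0" "b = 0" "c = 0"
        unfolding abc phi[OF mem'(1,1)] phi[OF mem'(1,2)] phi[OF mem'(2,2)] dual by simp_all
      then show "\<Xi> = 0" unfolding abc by simp
    qed
  qed
  have "?\<Theta> \<in> sym_square P"
    unfolding sym_square_def using mem by (intro span_add span_scale span_base) blast+
  moreover have "phi_inf P z ?\<Theta> = form_on P g"
  proof (intro ext)
    fix \<gamma> \<delta>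
    show "phi_inf P z ?\<Theta> \<gamma> \<delta> = form_on P g \<gamma> \<delta>"
    proof (cases "\<gamma> \<in> P \<and> \<delta> \<in> P")
      case True
      then obtain r s r' s' where eq: "\<gamma> = r *\<^sub>R \<alpha> + s *\<^sub>R \<beta>" "\<delta> = r' *\<^sub>R \<alpha> + s' *\<^sub>R \<beta>"
        unfolding P in_span_2 by blast
      have "d * phi_inf P z ?\<Theta> \<gamma> \<delta> = g \<beta> \<beta> * (g \<alpha> \<gamma> * g \<alpha> \<delta>)
          - g \<alpha> \<beta> * (g \<alpha> \<gamma> * g \<beta> \<delta> + g \<alpha> \<delta> * g \<beta> \<gamma>) + g \<alpha> \<alpha> * (g \<beta> \<gamma> * g \<beta> \<delta>)"
        unfolding phi[OF conjunct1[OF True] conjunct2[OF True]] using d by (simp add: field_simps)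
      also have "\<dots> = d * g \<gamma> \<delta>"
        unfolding eq lin sym[of \<beta> \<alpha>] d_def by (simp add: algebra_simps power2_eq_square)
      finally show ?thesis using d True by (simp add: form_on_def)
    qed (auto simp: phi_inf_def form_on_def)
  qed
  ultimately show ?thesis using the_inv_into_f_f[OF inj] by metis
qed

section \<open>Linear Weingarten surfaces\<close>

text \<open>
  Here \<open>G = A v\<^sub>1 v\<^sub>1\<^sup>T + B v\<^sub>2 v\<^sub>2\<^sup>T\<close> with \<open>v\<^sub>i = (x\<^sub>i, y\<^sub>i)\<close>. The adjugate of a 2 by 2 matrix is linear in the matrix, and
  that of \<open>v v\<^sup>T\<close> annihilates \<open>v\<close>; so \<open>v\<^sub>1\<close> and \<open>v\<^sub>2\<close> are conjugate for the adjugate of \<open>G\<close>. Dividing by \<open>y\<^sub>1 y\<^sub>2\<close>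
  gives the relation.
\<close>

lemma weingarten_relation:
  fixes A B :: real
  assumes "y1 \<noteq> 0" "y2 \<noteq> 0"
    and "G11 = A * x1 * x1 + B * x2 * x2" "G12 = A * x1 * y1 + B * x2 * y2" "G22 = A * y1 * y1 + B * y2 * y2"
  shows "G22 * ((x1 / y1) * (x2 / y2)) - G12 * (x1 / y1 + x2 / y2) + G11 = 0"
  using assms by (simp add: field_simps)

context umbilic_free_legendre
begin

text \<open>
  Write \<open>\<sigma> = k \<tt> + l \<ff>\<close> at \<open>x\<close>. For \<open>X \<in> T\<^sub>1\<close> the vector \<open>k d\<^sub>X \<tt> + l d\<^sub>X \<ff>\<close> is in \<open>f\<close> and orthogonal to \<open>\<qq>\<close> and \<open>\<pp>\<close>,
  so it is 0. If \<open>k\<close> were 0 then \<open>\<ff>\<close> would not immerse.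
\<close>

lemma principal_curvature_T1:
  assumes \<ff>: "section_near A f x \<ff>" and \<tt>: "section_near A f x \<tt>"
    and pair: "\<And>y. ip (\<ff> y) \<qq> = -1" "\<And>y. ip (\<ff> y) \<pp> = 0" "\<And>y. ip (\<tt> y) \<qq> = 0" "\<And>y. ip (\<tt> y) \<pp> = -1"
    and inj: "\<And>v. v \<in> f x \<Longrightarrow> ip v \<qq> = 0 \<Longrightarrow> ip v \<pp> = 0 \<Longrightarrow> v = 0"
    and \<sigma>: "spanning_section x \<sigma>" and imm: "immerses_at A \<ff> x"
  shows "ip (\<sigma> x) \<pp> \<noteq> 0" "principal_curvature A T1 \<ff> \<tt> x (ip (\<sigma> x) \<qq> / ip (\<sigma> x) \<pp>)"
proof -
  let ?k = "- ip (\<sigma> x) \<pp>" and ?l = "- ip (\<sigma> x) \<qq>"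
  have \<sigma>f: "section_near A f x \<sigma>" using spanning_section_f[OF \<sigma>] .
  have mem: "\<ff> x \<in> f x" "\<tt> x \<in> f x" "\<sigma> x \<in> f x" using \<ff> \<tt> \<sigma>f by (auto intro: section_near_mem)
  have "\<sigma> x - (?k *\<^sub>R \<tt> x + ?l *\<^sub>R \<ff> x) = 0"
    using mem subspace_f pair
    by (intro inj) (auto simp: ip_simps intro!: subspace_diff subspace_add subspace_scale subspace_neg)
  then have eq: "\<sigma> x = ?k *\<^sub>R \<tt> x + ?l *\<^sub>R \<ff> x" by simp
  have zero: "?k *\<^sub>R tder A \<tt> x X + ?l *\<^sub>R tder A \<ff> x X = 0" if X: "X \<in> T1 x" for X
  proof (rule inj)
    have Xt: "X \<in> tangent_space A x" "tder A \<sigma> x X \<in> f x" using X T1_iff_spanning[OF \<sigma>] by blast+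
    from subspace_diff[OF subspace_f Xt(2) tder_tensorial[OF \<sigma>f \<tt> \<ff> Xt(1) eq]]
    show "?k *\<^sub>R tder A \<tt> x X + ?l *\<^sub>R tder A \<ff> x X \<in> f x" by (simp add: algebra_simps)
    have c: "ip (tder A \<rho> x X) v = 0" if "section_near A f x \<rho>" "\<And>y. ip (\<rho> y) v = c" for \<rho> v c
      using tder_linear[OF bounded_bilinear.bounded_linear_left[OF bounded_bilinear_ip], of x \<rho> v X] that
      by (simp add: section_near_smooth)
    show "ip (?k *\<^sub>R tder A \<tt> x X + ?l *\<^sub>R tder A \<ff> x X) \<qq> = 0"
      "ip (?k *\<^sub>R tder A \<tt> x X + ?l *\<^sub>R tder A \<ff> x X) \<pp> = 0"
      by (simp_all add: ip_simps c[OF \<tt> pair(3)] c[OF \<tt> pair(4)] c[OF \<ff> pair(1)] c[OF \<ff> pair(2)])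
  qed
  show k: "ip (\<sigma> x) \<pp> \<noteq> 0"
  proof
    assume k0: "ip (\<sigma> x) \<pp> = 0"
    then have l: "?l \<noteq> 0" using eq spanning_section_nonzero[OF \<sigma>] by auto
    obtain X where X: "X \<in> T1 x" "X \<noteq> 0" using T1_nonzero .
    then have "tder A \<ff> x X = 0" using zero[OF X(1)] k0 l by simp
    then show False using imm X T1_iff unfolding immerses_at_def by blast
  qed
  show "principal_curvature A T1 \<ff> \<tt> x (ip (\<sigma> x) \<qq> / ip (\<sigma> x) \<pp>)"
    unfolding principal_curvature_def
  proof
    fix X assume "X \<in> T1 x"
    from zero[OF this] have "ip (\<sigma> x) \<pp> *\<^sub>R tder A \<tt> x X + ip (\<sigma> x) \<qq> *\<^sub>R tder A \<ff> x X = 0"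
      by (metis (no_types, lifting) add.inverse_neutral minus_add_distrib minus_minus scaleR_minus_left add.commute)
    then have "(1 / ip (\<sigma> x) \<pp>) *\<^sub>R (ip (\<sigma> x) \<pp> *\<^sub>R tder A \<tt> x X + ip (\<sigma> x) \<qq> *\<^sub>R tder A \<ff> x X) = 0"
      by simp
    then show "tder A \<tt> x X + (ip (\<sigma> x) \<qq> / ip (\<sigma> x) \<pp>) *\<^sub>R tder A \<ff> x X = 0"
      using k by (simp add: scaleR_add_right)
  qed
qed

end

theorem proposition6p10:
  fixes A :: "'m::{t2_space,second_countable_topology} chart set"
    and f s1 s2 :: "'m \<Rightarrow> R42 set"
    and \<eta> \<eta>mid :: "('m, o42) form1"
    and P :: "'m lpoly set"
    and z :: 'm
    and \<qq> \<pp> :: R42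
  assumes "smooth_surface A" and "connected (UNIV :: 'm set)"
    and "Omega_surface A f \<eta>" and "constant_signature A f \<eta>"
    and "umbilic_free A f s1 s2"
    and "middle_potential A f s1 s2 \<eta> \<eta>mid"
    and "lcq_plane A \<eta>mid P"
    and "\<exists>\<alpha>\<in>P. \<exists>\<beta>\<in>P. g_at z 0 \<alpha> \<beta> \<noteq> 0"
    and "nondegenerate_on P (g_inf z)"
    and "ip \<pp> \<pp> = 1 \<or> ip \<pp> \<pp> = -1" and "\<qq> \<noteq> 0" and "ip \<qq> \<pp> = 0"
    and "(\<lambda>_. \<qq>) \<in> at_param 0 ` P" and "(\<lambda>_. \<pp>) \<in> at_param 0 ` P"
  shows "\<exists>\<ff> \<tt>.
    space_form_projection A f \<qq> \<pp> \<ff> \<and> tangent_plane_congruence A f \<qq> \<pp> \<tt> \<and>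
    (\<exists>a b c.
      linear_weingarten A (curvature_subbundle A f s1) (curvature_subbundle A f s2) \<ff> \<tt> a b c \<and>
      \<not> tubular a b c \<and>
      proj_eq (lw_condition a b c \<qq> \<pp>)
        (phi_at z 0 (the_inv_into (sym_square P) (phi_inf P z) (form_on P (g_inf z)))))"
proof -
  interpret middle_potential_surface A f s1 s2 \<eta> \<eta>mid
    using assms by unfold_locales (simp_all add: Omega_surface_def)
  have conn: "connected (UNIV :: 'm set)" by fact
  obtain \<alpha> \<beta> where \<alpha>: "\<alpha> \<in> P" "fst \<alpha> = (\<lambda>_. \<qq>)" and \<beta>: "\<beta> \<in> P" "fst \<beta> = (\<lambda>_. \<pp>)"
    using assms(13,14) by (auto simp: at_param_def)
  have pp: "ip \<pp> \<pp> \<noteq> 0" using assms(10) by auto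
  have ind\<qq>\<pp>: "r = 0 \<and> s = 0" if "r *\<^sub>R \<qq> + s *\<^sub>R \<pp> = 0" for r s
  proof -
    have "ip (r *\<^sub>R \<qq> + s *\<^sub>R \<pp>) \<pp> = 0" unfolding that by (rule ip.zero_left)
    then have "s = 0" using assms(12) pp by (simp add: ip_simps)
    then show ?thesis using that \<open>\<qq> \<noteq> 0\<close> by simp
  qed
  have ind: "r = 0 \<and> s = 0" if "r *\<^sub>R \<alpha> + s *\<^sub>R \<beta> = 0" for r s
  proof -
    have "fst (r *\<^sub>R \<alpha> + s *\<^sub>R \<beta>) z = 0" unfolding that by simp
    then show ?thesis using ind\<qq>\<pp> by (simp add: \<alpha>(2) \<beta>(2) scaleR_fun_def plus_fun_def)
  qed
  have cons: "conserved \<alpha>" "conserved \<beta>"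
    using assms(7) \<alpha>(1) \<beta>(1) ind[of 1 0] ind[of 0 1] unfolding lcq_plane_def by auto
  have P: "P = span {\<alpha>, \<beta>}"
    using assms(7) \<alpha>(1) \<beta>(1) ind by (intro plane_eq_span) (auto simp: lcq_plane_def)
  define g where "g = g_inf z"
  define d where "d = g \<alpha> \<alpha> * g \<beta> \<beta> - (g \<alpha> \<beta>)\<^sup>2"
  note g_sym = g_inf_commute[of z, folded g_def] and g_lin = g_inf_combination[of z, folded g_def]
  have radical: "r = 0 \<and> s = 0"
    if "r * g \<alpha> \<alpha> + s * g \<alpha> \<beta> = 0" "r * g \<alpha> \<beta> + s * g \<beta> \<beta> = 0" for r s
  proof (rule ind)
    have "g (r *\<^sub>R \<alpha> + s *\<^sub>R \<beta>) \<gamma> = 0" if \<gamma>: "\<gamma> \<in> P" for \<gamma>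
    proof -
      obtain r' s' where "\<gamma> = r' *\<^sub>R \<alpha> + s' *\<^sub>R \<beta>" using \<gamma> unfolding P in_span_2 by blast
      moreover have "g (r *\<^sub>R \<alpha> + s *\<^sub>R \<beta>) \<alpha> = 0" "g (r *\<^sub>R \<alpha> + s *\<^sub>R \<beta>) \<beta> = 0"
        using \<open>r * g \<alpha> \<alpha> + s * g \<alpha> \<beta> = 0\<close> \<open>r * g \<alpha> \<beta> + s * g \<beta> \<beta> = 0\<close>
        by (simp_all add: g_lin g_sym[of \<beta> \<alpha>])
      ultimately show ?thesis by (simp add: g_lin(2))
    qed
    moreover have "r *\<^sub>R \<alpha> + s *\<^sub>R \<beta> \<in> P" unfolding P in_span_2 by blast
    ultimately show "r *\<^sub>R \<alpha> + s *\<^sub>R \<beta> = 0"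
      using assms(9) unfolding nondegenerate_on_def g_def by blast
  qed
  have d: "d \<noteq> 0"
  proof
    assume "d = 0"
    then have "g \<beta> \<beta> = 0 \<and> - g \<alpha> \<beta> = 0"
      by (intro radical) (auto simp: d_def power2_eq_square mult.commute)
    then have "(0::real) = 0 \<and> (1::real) = 0" by (intro radical) auto
    then show False by simp
  qed
  have pairing: "ip \<qq> (snd \<alpha> x) = g \<alpha> \<alpha> / 2" "ip \<qq> (snd \<beta> x) = g \<alpha> \<beta> / 2"
    "ip \<pp> (snd \<alpha> x) = g \<alpha> \<beta> / 2" "ip \<pp> (snd \<beta> x) = g \<beta> \<beta> / 2" for x
    using conserved_pairing[OF conn cons(1,1), of x z] conserved_pairing[OF conn cons(1,2), of x z]
      conserved_pairing[OF conn cons(2,1), of x z] conserved_pairing[OF conn cons(2,2), of x z] g_sym[of \<beta> \<alpha>]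
    by (simp_all add: \<alpha>(2) \<beta>(2) g_def)
  \<comment> \<open>The coefficients solve the linear systems for \<open>(\<ff>, \<qq>) = -1\<close>, \<open>(\<ff>, \<pp>) = 0\<close> and \<open>(\<tt>, \<qq>) = 0\<close>, \<open>(\<tt>, \<pp>) = -1\<close>,
    whose matrix is half the Gram matrix of \<open>g\<^sub>\<infinity>\<close>.\<close>
  define \<ff> where "\<ff> x = (- 2 * g \<beta> \<beta> / d) *\<^sub>R snd \<alpha> x + (2 * g \<alpha> \<beta> / d) *\<^sub>R snd \<beta> x" for x
  define \<tt> where "\<tt> x = (2 * g \<alpha> \<beta> / d) *\<^sub>R snd \<alpha> x + (- 2 * g \<alpha> \<alpha> / d) *\<^sub>R snd \<beta> x" for x
  have combination: "local_section A f UNIV (\<lambda>x. r *\<^sub>R snd \<alpha> x + s *\<^sub>R snd \<beta> x)" for r s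
    unfolding local_section_def
    using smooth_conserved(4)[OF cons(1)] smooth_conserved(4)[OF cons(2)] conserved_in_f[OF cons(1)]
      conserved_in_f[OF cons(2)] subspace_f
    by (auto intro!: smooth_map_on_add smooth_map_on_linear[OF bounded_linear_scaleR_right]
        subspace_add subspace_scale)
  then have sec: "local_section A f UNIV \<ff>" "local_section A f UNIV \<tt>"
    unfolding \<ff>_def[abs_def] \<tt>_def[abs_def] by blast+
  have near: "section_near A f x \<ff>" "section_near A f x \<tt>" for x
    using sec unfolding section_near_def by blast+
  have pair: "ip (\<ff> x) \<qq> = -1" "ip (\<ff> x) \<pp> = 0" "ip (\<tt> x) \<qq> = 0" "ip (\<tt> x) \<pp> = -1" for x
  proof -
    have n: "g \<beta> \<beta> * g \<alpha> \<alpha> - g \<alpha> \<beta> * g \<alpha> \<beta> = d" by (simp add: d_def power2_eq_square)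
    have "ip (\<ff> x) \<qq> = - ((g \<beta> \<beta> * g \<alpha> \<alpha> - g \<alpha> \<beta> * g \<alpha> \<beta>) / d)"
      "ip (\<tt> x) \<pp> = - ((g \<beta> \<beta> * g \<alpha> \<alpha> - g \<alpha> \<beta> * g \<alpha> \<beta>) / d)"
      unfolding \<ff>_def \<tt>_def ip_simps pairing[unfolded ip_commute[of \<qq>] ip_commute[of \<pp>]]
      by (simp_all add: diff_divide_distrib mult.commute)
    then show "ip (\<ff> x) \<qq> = -1" "ip (\<tt> x) \<pp> = -1" unfolding n using d by simp_all
    show "ip (\<ff> x) \<pp> = 0" "ip (\<tt> x) \<qq> = 0"
      unfolding \<ff>_def \<tt>_def ip_simps pairing[unfolded ip_commute[of \<qq>] ip_commute[of \<pp>]] by simp_all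
  qed
  have mem: "\<ff> x \<in> f x" "\<tt> x \<in> f x" for x using near section_near_mem by blast+
  have f_inj: "v = 0" if v: "v \<in> f x" "ip v \<qq> = 0" "ip v \<pp> = 0" for v x
  proof -
    have i: "r = 0 \<and> s = 0" if "r *\<^sub>R \<ff> x + s *\<^sub>R \<tt> x = 0" for r s
    proof -
      have "ip (r *\<^sub>R \<ff> x + s *\<^sub>R \<tt> x) \<qq> = 0" "ip (r *\<^sub>R \<ff> x + s *\<^sub>R \<tt> x) \<pp> = 0"
        unfolding that by (simp_all add: ip_simps)
      then show ?thesis by (simp add: ip_simps pair)
    qed
    have span: "f x = span {\<ff> x, \<tt> x}" using plane_eq_span[OF subspace_f dim_f mem i] .
    obtain r s where "v = r *\<^sub>R \<ff> x + s *\<^sub>R \<tt> x"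
      using v(1) unfolding span in_span_2 by blast
    then show ?thesis using v(2,3) by (simp add: ip_simps pair)
  qed
  define a b c where "a = g \<beta> \<beta> / d" and "b = - g \<alpha> \<beta> / d" and "c = g \<alpha> \<alpha> / d"
  have nt: "\<not> tubular a b c"
  proof -
    have "b\<^sup>2 - a * c = - ((g \<alpha> \<alpha> * g \<beta> \<beta> - (g \<alpha> \<beta>)\<^sup>2) / d\<^sup>2)"
      unfolding a_def b_def c_def by (simp add: diff_divide_distrib power2_eq_square)
    also have "\<dots> = - (d / d\<^sup>2)" by (simp only: d_def)
    finally have "b\<^sup>2 - a * c = - (d / d\<^sup>2)" .
    then show ?thesis using d by (simp add: tubular_def)
  qed
  have abc: "(a, b, c) \<noteq> (0, 0, 0)" using nt by (auto simp: tubular_def)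
  have lw: "linear_weingarten A T1 T2 \<ff> \<tt> a b c"
    unfolding linear_weingarten_def
  proof (intro conjI allI impI abc)
    fix x assume imm: "immerses_at A \<ff> x"
    obtain \<sigma>1 \<sigma>2 X Y where "middle_frame A f s1 s2 x \<sigma>1 \<sigma>2 X Y \<eta> \<eta>mid"
      using obtain_middle_frame .
    then interpret F: middle_frame A f s1 s2 x \<sigma>1 \<sigma>2 X Y \<eta> \<eta>mid .
    let ?A = "- 2 * F.pcoeff (Y x)" and ?B = "- 2 * F.qcoeff (X x)"
    let ?x1 = "ip (\<sigma>1 x) \<qq>" and ?y1 = "ip (\<sigma>1 x) \<pp>" and ?x2 = "ip (\<sigma>2 x) \<qq>" and ?y2 = "ip (\<sigma>2 x) \<pp>"
    note pc1 = principal_curvature_T1[OF near pair f_inj[where x = x] F.\<sigma>1 imm]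
    note pc2 = F.swap.principal_curvature_T1[OF near pair f_inj[where x = x] F.\<sigma>2 imm]
    have G: "g \<alpha> \<alpha> = ?A * ?x1 * ?x1 + ?B * ?x2 * ?x2"
      "g \<alpha> \<beta> = ?A * ?x1 * ?y1 + ?B * ?x2 * ?y2"
      "g \<beta> \<beta> = ?A * ?y1 * ?y1 + ?B * ?y2 * ?y2"
    proof -
      have "g \<alpha> \<alpha> = 2 * ip \<qq> (snd \<alpha> x)" "g \<alpha> \<beta> = 2 * ip \<qq> (snd \<beta> x)" "g \<beta> \<beta> = 2 * ip \<pp> (snd \<beta> x)"
        by (simp_all add: pairing)
      then show "g \<alpha> \<alpha> = ?A * ?x1 * ?x1 + ?B * ?x2 * ?x2"
        "g \<alpha> \<beta> = ?A * ?x1 * ?y1 + ?B * ?x2 * ?y2" "g \<beta> \<beta> = ?A * ?y1 * ?y1 + ?B * ?y2 * ?y2"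
        unfolding F.top_coefficient_eq[OF cons(1)] F.top_coefficient_eq[OF cons(2)] \<alpha>(2) \<beta>(2)
          ip_simps ip_commute[of \<qq>] ip_commute[of \<pp>] by (simp_all add: algebra_simps)
    qed
    have "d * (a * K + 2 * b * (S / 2) + c) = g \<beta> \<beta> * K - g \<alpha> \<beta> * S + g \<alpha> \<alpha>" for K S
      using d by (simp add: a_def b_def c_def distrib_left right_diff_distrib)
    then have "d * (a * ((?x1 / ?y1) * (?x2 / ?y2)) + 2 * b * ((?x1 / ?y1 + ?x2 / ?y2) / 2) + c) =
        g \<beta> \<beta> * ((?x1 / ?y1) * (?x2 / ?y2)) - g \<alpha> \<beta> * (?x1 / ?y1 + ?x2 / ?y2) + g \<alpha> \<alpha>" .
    also have "\<dots> = 0" using weingarten_relation[OF pc1(1) pc2(1) G] .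
    finally have "a * ((?x1 / ?y1) * (?x2 / ?y2)) + 2 * b * ((?x1 / ?y1 + ?x2 / ?y2) / 2) + c = 0"
      using d by simp
    then show "\<exists>\<kappa>1 \<kappa>2. principal_curvature A T1 \<ff> \<tt> x \<kappa>1 \<and> principal_curvature A T2 \<ff> \<tt> x \<kappa>2 \<and>
        (let K = \<kappa>1 * \<kappa>2; H = (\<kappa>1 + \<kappa>2) / 2 in a * K + 2 * b * H + c = 0)"
      using pc1(2) pc2(2) unfolding Let_def by blast
  qed
  have \<Theta>: "phi_at z 0 (the_inv_into (sym_square P) (phi_inf P z) (form_on P (g_inf z))) =
      lw_condition a b c \<qq> \<pp>"
  proof -
    have "the_inv_into (sym_square P) (phi_inf P z) (form_on P (g_inf z)) =
        a *\<^sub>R (\<alpha> \<odot> \<alpha>) + (2 * b) *\<^sub>R (\<alpha> \<odot> \<beta>) + c *\<^sub>R (\<beta> \<odot> \<beta>)"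
      using phi_inf_inverse[OF P, of z] d unfolding a_def b_def c_def d_def g_def by blast
    moreover have "at_param 0 \<alpha> z = \<qq>" "at_param 0 \<beta> z = \<pp>"
      by (simp_all add: at_param_def \<alpha>(2) \<beta>(2))
    ultimately show ?thesis
      using linear_phi_at[of z 0]
      by (simp add: lw_condition_def linear_add linear_scale phi_at_odot)
  qed
  have W0: "lw_condition a b c \<qq> \<pp> \<noteq> 0"
  proof
    assume W: "lw_condition a b c \<qq> \<pp> = 0"
    \<comment> \<open>The functionals \<open>- (\<ff>, \<cdot>)\<close> and \<open>- (\<tt>, \<cdot>)\<close> are dual to \<open>\<qq>\<close> and \<open>\<pp>\<close>.\<close>
    define \<phi> where "\<phi> y = - ip (\<ff> z) y" for y
    define \<psi> where "\<psi> y = - ip (\<tt> z) y" for y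
    have lin: "linear \<phi>" "linear \<psi>"
      unfolding \<phi>_def[abs_def] \<psi>_def[abs_def] by (auto intro!: linearI simp only: ip_simps) simp_all
    have "\<phi> \<qq> = 1" "\<phi> \<pp> = 0" "\<psi> \<qq> = 0" "\<psi> \<pp> = 1"
      by (simp_all add: \<phi>_def \<psi>_def pair)
    then have "lw_condition a b c \<qq> \<pp> \<phi> \<phi> = a" "lw_condition a b c \<qq> \<pp> \<phi> \<psi> = b"
      "lw_condition a b c \<qq> \<pp> \<psi> \<psi> = c"
      by (simp_all add: lw_condition_def odot_def lin scaleR_fun_def plus_fun_def)
    then show False using abc unfolding W by simp
  qed
  have "proj_eq (lw_condition a b c \<qq> \<pp>)
      (phi_at z 0 (the_inv_into (sym_square P) (phi_inf P z) (form_on P (g_inf z))))"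
    unfolding \<Theta> proj_eq_def using W0 by (auto intro: exI[of _ 1])
  moreover have "space_form_projection A f \<qq> \<pp> \<ff>"
    using sec(1) pair ip_f[OF mem(1,1)] by (simp add: space_form_projection_def space_form_def lightcone_def)
  moreover have "tangent_plane_congruence A f \<qq> \<pp> \<tt>"
    using sec(2) pair by (simp add: tangent_plane_congruence_def)
  ultimately show ?thesis using lw nt by blast
qed

end
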